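(* Let $\Sigma\subset\mathbb{C}$ be a compact set with connected complement $\Omega=\overline{\mathbb{C}}\setminus\Sigma$, let $f$ be analytic on a neighborhood $V$ of $\Sigma$, let $m\in\mathbb{Z}_+$, and let $\{w_n\}_{n\in\mathbb{N}}$ be monic polynomials with $\deg w_n=n$ whose zeros all lie in $\Sigma$. Let the positive unit Borel measure $\mu$ supported on $\Sigma$ be the asymptotic zero distribution of the sequence of interpolation points given by $\{w_n\}_{n\in\mathbb{N}}$, and suppose that these interpolation points form a newtonian table. Let $\Pi_{n,m}$, $n\ge m$, be the multi-point Padé approximants of type $(n,m)$ of $f$. Suppose that the function $f$ is defined at a point $z\in\mathbb{C}$, $z\notin\Sigma$, and fulfills $$\limsup_{n\to\infty}|f(z)-\Pi_{n,m}(z)|^{1/n}\le\frac{\rho_\mu(\{z\})}{R}<1 .$$ Then $R_{\mu,m}\ge R$, that is, $f$ admits meromorphic continuation with at most $m$ poles on the set $E_\mu(R)$.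
   Context: Newtonian table: the interpolation points form a newtonian table if $w_n$ divides $w_{n+1}$ for all $n\in\mathbb{N}$, i.e. $w_n(z)=\prod_{i=1}^n(z-\alpha_i)$ for a single sequence $\{\alpha_i\}\subset\Sigma$. Potentials: $P(\mu;z)=\int_\Sigma -\log|z-\zeta|\,d\mu(\zeta)$; $r_0=\inf_{z\in\Sigma}\exp\{-P(\mu;z)\}\ge 0$; for $r>r_0$, $E_\mu(r)=\{z\in\mathbb{C}:\exp\{-P(\mu;z)\}<r\}$ (a non-empty open set, which need not contain $\Sigma$; $E_\mu(+\infty)=\mathbb{C}$). For compact $K$, $\rho_\mu(K)=\max_{z\in K}\exp\{-P(\mu;z)\}$; in particular $\rho_\mu(\{z\})=\exp\{-P(\mu;z)\}$. Asymptotic zero distribution: $\mu$ is the asymptotic zero distribution of $\{w_n\}$ if the normalized zero counting measures $\Theta_{w_n}=\frac1n\sum_{\xi:\,w_n(\xi)=0}\delta_\xi$ (zeros counted with multiplicity) converge weak-* to $\mu$ as $n\to\infty$. Multi-point Padé approximants: for $n\ge m\ge 0$ there exist polynomials $P,Q$ with $\deg P\le n-m$, $\deg Q\le m$, $Q\not\equiv0$ and $(Qf-P)/w_{n+1}$ analytic in $V$; any such pair defines the same rational function $\Pi_{n,m}=P/Q$, the multi-point Padé approximant of type $(n,m)$ of $f$. Meromorphic continuation: $f$ admits meromorphic continuation with at most $m$ poles (counting multiplicities) on $E_\mu(r)$ if there is a function meromorphic on $E_\mu(r)\cup V_0$, for some open $V_0$ with $\Sigma\subset V_0\subset V$, that equals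 $f$ on $V_0$ and has at most $m$ poles in $E_\mu(r)$. $R_{\mu,m}$ is the supremum of the numbers $r>r_0$ such that $f$ admits meromorphic continuation with at most $m$ poles on $E_\mu(r)$; one has $R_{\mu,m}>r_0$. The set of $m$-meromorphy of $f$ relative to $\mu$ is $D_{\mu,m}=E_\mu(R_{\mu,m})$, and $f$ admits meromorphic continuation with at most $m$ poles on $D_{\mu,m}$.
   Formalization: That f admits meromorphic continuation with at most m poles on D_{μ,m}=E_μ(R_{μ,m}), stated in the context as a fact, is assumed explicitly; it can fail, and then so does the claim (Σ={0,2}, w_n=z^n, μ=δ_0, m=0, f=0 near 0 and 1 near 2, z=1/4, R=4). *)

theory Defs
  imports "HOL-Probability.Probability" "HOL-Complex_Analysis.Complex_Analysis"
begin

text \<open>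
  The kernel \<open>-log |z - \<zeta>|\<close> and the logarithmic potential take the value \<open>\<infinity>\<close>: on the diagonal
  (in HOL \<open>ln 0 = 0\<close>), respectively where the integral diverges. The potential is the integral
  of the positive part minus the integral of the negative part; for a finite measure carried by
  a compact set the latter is finite.
\<close>

definition log_kernel :: "complex \<Rightarrow> complex \<Rightarrow> ereal" where
  "log_kernel z \<zeta> = (if \<zeta> = z then \<infinity> else ereal (- ln (dist z \<zeta>)))"

definition log_potential :: "complex measure \<Rightarrow> complex \<Rightarrow> ereal" where
  "log_potential \<mu> z =
     enn2ereal (\<integral>\<^sup>+ \<zeta>. e2ennreal (log_kernel z \<zeta>) \<partial>\<mu>)
     - enn2ereal (\<integral>\<^sup>+ \<zeta>. e2ennreal (- log_kernel z \<zeta>) \<partial>\<mu>)"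

definition exp_neg_potential :: "complex measure \<Rightarrow> complex \<Rightarrow> real" where
  "exp_neg_potential \<mu> z =
     (if log_potential \<mu> z = \<infinity> then 0 else exp (- real_of_ereal (log_potential \<mu> z)))"

definition rho :: "complex measure \<Rightarrow> complex set \<Rightarrow> real" where
  "rho \<mu> K = (SUP z\<in>K. exp_neg_potential \<mu> z)"

definition r_zero :: "complex set \<Rightarrow> complex measure \<Rightarrow> real" where
  "r_zero S \<mu> = (INF z\<in>S. exp_neg_potential \<mu> z)"

definition level_set :: "complex measure \<Rightarrow> ereal \<Rightarrow> complex set" where
  "level_set \<mu> r = {z. ereal (exp_neg_potential \<mu> z) < r}"

definition zero_counting_measure :: "complex poly \<Rightarrow> complex measure" where
  "zero_counting_measure p =
     distr (point_measure {\<xi>. poly p \<xi> = 0} (\<lambda>\<xi>. ennreal (real (order \<xi> p) / real (degree p))))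
       borel (\<lambda>\<xi>. \<xi>)"

text \<open>
  Weak-* convergence in the dual of \<open>C(S)\<close>; all measures involved are carried by the compact
  set \<open>S\<close>.
\<close>

definition asymptotic_zero_distribution ::
    "complex set \<Rightarrow> (nat \<Rightarrow> complex poly) \<Rightarrow> complex measure \<Rightarrow> bool" where
  "asymptotic_zero_distribution S w \<mu> \<longleftrightarrow>
     (\<forall>\<phi> :: complex \<Rightarrow> real. continuous_on S \<phi> \<longrightarrow>
        (\<lambda>n. LINT \<xi>:S|zero_counting_measure (w n). \<phi> \<xi>) \<longlonglongrightarrow> (LINT \<xi>:S|\<mu>. \<phi> \<xi>))"

definition newtonian_table :: "(nat \<Rightarrow> complex poly) \<Rightarrow> bool" where
  "newtonian_table w \<longleftrightarrow> (\<forall>n. w n dvd w (Suc n))"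

text \<open>
  As \<open>f\<close> is analytic in \<open>V\<close>, analyticity of \<open>(Q f - P) / w\<^sub>n\<^sub>+\<^sub>1\<close> in \<open>V\<close> (after removing
  singularities) means that \<open>Q f - P\<close> is \<open>w\<^sub>n\<^sub>+\<^sub>1\<close> times an analytic function. The
  approximant itself is the rational function \<open>P / Q\<close>, which is represented by numerator and
  denominator in lowest terms.
\<close>

definition multipoint_pade_pair ::
    "(complex \<Rightarrow> complex) \<Rightarrow> complex set \<Rightarrow> (nat \<Rightarrow> complex poly) \<Rightarrow> nat \<Rightarrow> nat \<Rightarrow>
     complex poly \<Rightarrow> complex poly \<Rightarrow> bool" where
  "multipoint_pade_pair f V w n m P Q \<longleftrightarrow>
     degree P \<le> n - m \<and> degree Q \<le> m \<and> Q \<noteq> 0 \<and>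
     (\<exists>h. h analytic_on V \<and>
        (\<forall>\<zeta>\<in>V. poly Q \<zeta> * f \<zeta> - poly P \<zeta> = h \<zeta> * poly (w (Suc n)) \<zeta>))"

definition multipoint_pade ::
    "(complex \<Rightarrow> complex) \<Rightarrow> complex set \<Rightarrow> (nat \<Rightarrow> complex poly) \<Rightarrow> nat \<Rightarrow> nat \<Rightarrow>
     complex poly \<Rightarrow> complex poly \<Rightarrow> bool" where
  "multipoint_pade f V w n m p q \<longleftrightarrow>
     coprime p q \<and> (\<exists>P Q. multipoint_pade_pair f V w n m P Q \<and> P * q = p * Q)"

text \<open>
  \<open>|c - (p/q)(z)|\<^bsup>1/n\<^esup>\<close> for coprime \<open>p\<close> and \<open>q\<close>; infinite if \<open>p/q\<close> has a pole at \<open>z\<close>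
  (in HOL the quotient would be \<open>0\<close> there).
\<close>

definition nth_root_error ::
    "nat \<Rightarrow> complex \<Rightarrow> complex poly \<Rightarrow> complex poly \<Rightarrow> complex \<Rightarrow> ereal" where
  "nth_root_error n c p q z =
     (if poly q z = 0 then \<infinity> else ereal (root n (cmod (c - poly p z / poly q z))))"

definition at_most_poles :: "(complex \<Rightarrow> complex) \<Rightarrow> complex set \<Rightarrow> nat \<Rightarrow> bool" where
  "at_most_poles g A m \<longleftrightarrow>
     finite {\<zeta>\<in>A. is_pole g \<zeta>} \<and> (\<Sum>\<zeta> | \<zeta> \<in> A \<and> is_pole g \<zeta>. nat (- zorder g \<zeta>)) \<le> m"

definition meromorphic_continuation ::
    "(complex \<Rightarrow> complex) \<Rightarrow> complex set \<Rightarrow> complex set \<Rightarrow> nat \<Rightarrow> complex set \<Rightarrow> bool" where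
  "meromorphic_continuation f S V m A \<longleftrightarrow>
     (\<exists>V0 g. open V0 \<and> S \<subseteq> V0 \<and> V0 \<subseteq> V \<and> g nicely_meromorphic_on (A \<union> V0) \<and>
        (\<forall>\<zeta>\<in>V0. g \<zeta> = f \<zeta>) \<and> at_most_poles g A m)"

definition meromorphy_radius ::
    "(complex \<Rightarrow> complex) \<Rightarrow> complex set \<Rightarrow> complex set \<Rightarrow> complex measure \<Rightarrow> nat \<Rightarrow> ereal" where
  "meromorphy_radius f S V \<mu> m =
     Sup (ereal ` {r. r_zero S \<mu> < r \<and> meromorphic_continuation f S V m (level_set \<mu> (ereal r))})"

definition meromorphy_set ::
    "(complex \<Rightarrow> complex) \<Rightarrow> complex set \<Rightarrow> complex set \<Rightarrow> complex measure \<Rightarrow> nat \<Rightarrow> complex set" where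
  "meromorphy_set f S V \<mu> m = level_set \<mu> (meromorphy_radius f S V \<mu> m)"

text \<open>
  That \<open>f\<close> continues with at most \<open>m\<close> poles to \<open>meromorphy_set f S V \<mu> m\<close> is a standing
  assumption of the theory. It has to be stated as a hypothesis, since it can fail: for
  \<open>S = {0, 2}\<close>, \<open>w\<^sub>n = z\<^sup>n\<close>, \<open>\<mu>\<close> the unit mass at \<open>0\<close>, \<open>m = 0\<close> and \<open>f\<close> equal to \<open>0\<close> near
  \<open>0\<close> and to \<open>1\<close> near \<open>2\<close>, the radius is \<open>2\<close>, but every neighbourhood of \<open>2\<close> meets the disc
  \<open>|z| < 2\<close>, on which a continuation would have to vanish. All approximants are \<open>0\<close> in this
  example.
\<close>

end

theory Submission
  imports Defs "HOL-Computational_Algebra.Fundamental_Theorem_Algebra"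
begin

text \<open>
  Write \<open>U = exp (- P(\<mu>; \<cdot>))\<close>, let \<open>P\<^sub>n / Q\<^sub>n\<close> be the approximants, with \<open>Q\<^sub>n\<close> normalised by the
  sum of the moduli of its coefficients, and let \<open>E(r)\<close> be the set where \<open>U < r\<close>.

  In a newtonian table \<open>P\<^sub>n\<^sub>+\<^sub>1 Q\<^sub>n - P\<^sub>n Q\<^sub>n\<^sub>+\<^sub>1\<close> vanishes at all zeros of \<open>w\<^sub>n\<^sub>+\<^sub>1\<close> and has degree at most
  \<open>n + 1\<close>; hence it is a constant \<open>A\<^sub>n\<close> times \<open>w\<^sub>n\<^sub>+\<^sub>1\<close> (\<open>consecutive_difference\<close>). A constant can be
  measured at any single point. At \<open>z\<close>, outside the carrier \<open>S\<close>, \<open>\<bar>w\<^sub>n(z)\<bar>\<^bsup>1/n\<^esup>\<close> tends to \<open>U(z)\<close>, so the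
  assumed rate of convergence at \<open>z\<close> gives \<open>limsup \<bar>A\<^sub>n\<bar>\<^bsup>1/n\<^esup> \<le> 1 / R\<close> (\<open>coefficient_decay\<close>). Near every
  point of \<open>E(R)\<close> the \<open>w\<^sub>n\<close> grow more slowly than \<open>R\<^sup>n\<close>, so the telescoping series
  \<open>\<Sum> A\<^sub>n w\<^sub>n\<^sub>+\<^sub>1 / (Q\<^sub>n Q\<^sub>n\<^sub>+\<^sub>1)\<close> converges wherever the denominators are not too small. Each has at most
  \<open>m\<close> zeros, so around each point there is a circle on which \<open>\<bar>Q\<^sub>n\<bar>\<close> decreases at most polynomially
  in \<open>n\<close> for all \<open>n\<close> at once. There the approximants are bounded, and by the maximum principle the
  polynomials \<open>P\<^sub>n\<close> are locally bounded on \<open>E(R)\<close> (\<open>P_locally_bounded\<close>). Montel's theorem yields a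
  limit \<open>g / Q\<close>, with \<open>g\<close> holomorphic on \<open>E(R)\<close> and \<open>Q \<noteq> 0\<close> of degree at most \<open>m\<close>: a function
  with at most \<open>m\<close> poles.

  It remains to compare \<open>g / Q\<close> with \<open>f\<close>. Near a point of the support of \<open>\<mu>\<close> the number of
  interpolation conditions tends to infinity, which forces \<open>Q f = g\<close> there
  (\<open>limit_interpolates_at_support\<close>). Elsewhere on the part of \<open>E(R)\<close> close to \<open>S\<close> the two functions
  may differ, because neither \<open>S\<close> nor \<open>E(R)\<close> has to be connected and \<open>U\<close> is only upper
  semicontinuous. Suppose the radius of meromorphy \<open>\<rho>\<close> is less than \<open>R\<close>. Every component of
  \<open>E(\<rho>)\<close> meets the support (\<open>low_open_set_meets_carrier\<close>), so the given continuation of \<open>f\<close>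
  to \<open>E(\<rho>)\<close> agrees with \<open>g / Q\<close>, and the open set \<open>B\<close> of disagreement lies where \<open>U \<ge> \<rho>\<close>,
  away from the support. If \<open>B\<close> approached \<open>S\<close> along values of \<open>U\<close> tending to \<open>\<rho>\<close>, then \<open>U\<close>
  would attain its minimum over \<open>B\<close> and be constant on an open set outside \<open>S\<close>. This is
  impossible: the derivative of the potential would vanish on the connected complement of \<open>S\<close>,
  although \<open>U\<close> grows at infinity (\<open>low_values_avoid_S\<close>). Hence for some \<open>r > \<rho>\<close> a neighbourhood of
  \<open>S\<close> avoids the part of \<open>B\<close> in \<open>E(r)\<close>, and \<open>f\<close> continues to \<open>E(r)\<close> with at most \<open>m\<close> poles,
  which contradicts the choice of \<open>\<rho>\<close>.

  Two tools keep the potential theory elementary. Values of the potential at nearby points are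
  compared through the measure of small balls, which is small wherever \<open>U\<close> is positive
  (\<open>potential_comparison\<close>); and harmonicity enters through averages over roots of unity
  (\<open>minimum_principle_local\<close>).
\<close>

section \<open>Polynomials: divisibility, normalisation, small values\<close>

text \<open>
  The quotient is only known as a continuous function, so multiplicities are treated by splitting
  off one zero at a time: after cancelling \<open>x - a\<close> the identity persists off \<open>a\<close>, and at \<open>a\<close> by
  continuity.
\<close>

lemma poly_dvd_of_continuous_quotient:
  fixes X W :: "complex poly"
  assumes V: "open V" and h: "continuous_on V h"
    and "W \<noteq> 0" and "{\<xi>. poly W \<xi> = 0} \<subseteq> V"
    and "\<And>\<zeta>. \<zeta> \<in> V \<Longrightarrow> poly X \<zeta> = h \<zeta> * poly W \<zeta>"
  shows "W dvd X"
  using assms(3-)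
proof (induction "degree W" arbitrary: W X)
  case 0
  then show ?case by (simp add: is_unit_iff_degree unit_imp_dvd)
next
  case (Suc n)
  have "\<not> constant (poly W)" using Suc.hyps(2) by (simp add: constant_degree)
  then obtain a where a: "poly W a = 0" using fundamental_theorem_of_algebra by blast
  then obtain W' where W': "W = [:-a, 1:] * W'" using poly_eq_0_iff_dvd by blast
  have aV: "a \<in> V" using a Suc.prems by auto
  have "poly X a = 0" using Suc.prems(3)[OF aV] a by simp
  then obtain X' where X': "X = [:-a, 1:] * X'" using poly_eq_0_iff_dvd by blast
  have W'0: "W' \<noteq> 0" using W' Suc.prems by auto
  have deg: "n = degree W'"
    using Suc.hyps(2) W'0 unfolding W' by (subst (asm) degree_mult_eq) auto
  have off: "poly X' \<zeta> = h \<zeta> * poly W' \<zeta>" if "\<zeta> \<in> V" "\<zeta> \<noteq> a" for \<zeta>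
  proof -
    have "(\<zeta> - a) * poly X' \<zeta> = (\<zeta> - a) * (h \<zeta> * poly W' \<zeta>)"
      using Suc.prems(3)[OF that(1)] unfolding W' X' by (simp add: algebra_simps)
    then show ?thesis using that(2) by simp
  qed
  have at: "poly X' a = h a * poly W' a"
  proof -
    have hc: "isCont h a" using h V aV by (simp add: continuous_on_eq_continuous_at)
    have 1: "((\<lambda>\<zeta>. h \<zeta> * poly W' \<zeta>) \<longlongrightarrow> h a * poly W' a) (at a)"
      using hc by (intro tendsto_intros) (auto simp: isCont_def)
    have 2: "((\<lambda>\<zeta>. poly X' \<zeta>) \<longlongrightarrow> poly X' a) (at a)"
      by (intro tendsto_intros)
    have "\<forall>\<^sub>F \<zeta> in at a. h \<zeta> * poly W' \<zeta> = poly X' \<zeta>"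
      using V aV off unfolding eventually_at_topological by metis
    then have "((\<lambda>\<zeta>. poly X' \<zeta>) \<longlongrightarrow> h a * poly W' a) (at a)"
      using 1 tendsto_cong by force
    then show ?thesis using 2 tendsto_unique trivial_limit_at by blast
  qed
  have "W' dvd X'"
    
  proof (rule Suc.hyps(1)[OF deg W'0])
    show "{\<xi>. poly W' \<xi> = 0} \<subseteq> V" using Suc.prems(2) W' by auto
    show "poly X' \<zeta> = h \<zeta> * poly W' \<zeta>" if "\<zeta> \<in> V" for \<zeta>
      using off at that by blast
  qed
  then show ?case unfolding W' X' by (intro mult_dvd_mono) auto
qed

lemma cmod_monic_poly:
  fixes p :: "complex poly"
  assumes "lead_coeff p = 1"
  shows "cmod (poly p x) = (\<Prod>\<xi> | poly p \<xi> = 0. cmod (x - \<xi>) ^ order \<xi> p)"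
proof -
  have "p = (\<Prod>z|poly p z = 0. [:-z, 1:] ^ order z p)"
    using complex_poly_decompose[of p] assms by simp
  then have "poly p x = poly (\<Prod>z|poly p z = 0. [:-z, 1:] ^ order z p) x" by simp
  also have "\<dots> = (\<Prod>\<xi> | poly p \<xi> = 0. (x - \<xi>) ^ order \<xi> p)"
    by (simp add: poly_prod poly_power)
  finally show ?thesis by (simp add: prod_norm[symmetric] norm_power)
qed

text \<open>
  Denominators are normalised by this norm rather than by their leading coefficient: the
  normalised polynomials of bounded degree form a compact set that avoids \<open>0\<close>.
\<close>

definition coeff_norm :: "complex poly \<Rightarrow> real" where
  "coeff_norm p = (\<Sum>i\<le>degree p. cmod (coeff p i))"

lemma coeff_norm_eq_sum:
  assumes "degree p \<le> n"
  shows "coeff_norm p = (\<Sum>i\<le>n. cmod (coeff p i))"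
  unfolding coeff_norm_def
  by (rule sum.mono_neutral_left) (use assms in \<open>auto simp: coeff_eq_0\<close>)

lemma coeff_norm_nonneg [simp]: "0 \<le> coeff_norm p"
  unfolding coeff_norm_def by (simp add: sum_nonneg)

lemma coeff_norm_pos:
  assumes "p \<noteq> 0"
  shows "0 < coeff_norm p"
proof -
  have "0 < cmod (coeff p (degree p))" using assms by simp
  also have "\<dots> \<le> coeff_norm p"
    unfolding coeff_norm_def by (rule member_le_sum) auto
  finally show ?thesis .
qed

lemma coeff_norm_smult: "coeff_norm (smult c p) = cmod c * coeff_norm p"
  by (subst (1 2) coeff_norm_eq_sum[of _ "degree p"])
     (auto simp: norm_mult sum_distrib_left degree_smult_le)

lemma norm_coeff_le_coeff_norm: "cmod (coeff p i) \<le> coeff_norm p"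
proof (cases "i \<le> degree p")
  case True
  then show ?thesis unfolding coeff_norm_def by (intro member_le_sum) auto
qed (simp add: coeff_eq_0)

lemma norm_poly_le_coeff_norm:
  assumes "degree p \<le> m" and "cmod x \<le> L" and "1 \<le> L"
  shows "cmod (poly p x) \<le> coeff_norm p * L ^ m"
proof -
  have "cmod (poly p x) \<le> (\<Sum>i\<le>degree p. cmod (coeff p i) * cmod x ^ i)"
    unfolding poly_altdef by (rule order_trans[OF norm_sum]) (simp add: norm_mult norm_power)
  also have "\<dots> \<le> (\<Sum>i\<le>degree p. cmod (coeff p i) * L ^ m)"
  proof (intro sum_mono mult_left_mono)
    fix i assume "i \<in> {..degree p}"
    have "cmod x ^ i \<le> L ^ i" using assms by (intro power_mono) auto
    also have "\<dots> \<le> L ^ m" using assms \<open>i \<in> _\<close> by (intro power_increasing) auto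
    finally show "cmod x ^ i \<le> L ^ m" .
  qed auto
  finally show ?thesis by (simp add: coeff_norm_def sum_distrib_right)
qed

lemma coeff_norm_linear_mult:
  "coeff_norm ([:-a, 1:] * p) \<le> (1 + cmod a) * coeff_norm p"
proof -
  have eq: "[:-a, 1:] * p = smult (-a) p + pCons 0 p" by simp
  have d1: "degree ([:-a, 1:] * p) \<le> Suc (degree p)"
    using degree_mult_le[of "[:-a, 1:]" p] by simp
  have "coeff_norm ([:-a, 1:] * p) = (\<Sum>i\<le>Suc (degree p). cmod (coeff ([:-a, 1:] * p) i))"
    by (rule coeff_norm_eq_sum[OF d1])
  also have "\<dots> \<le> (\<Sum>i\<le>Suc (degree p). cmod a * cmod (coeff p i) + cmod (coeff (pCons 0 p) i))"
    unfolding eq by (intro sum_mono) (metis coeff_add coeff_smult norm_minus_cancel norm_mult norm_triangle_ineq)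
  also have "\<dots> = cmod a * (\<Sum>i\<le>Suc (degree p). cmod (coeff p i))
       + (\<Sum>i\<le>Suc (degree p). cmod (coeff (pCons 0 p) i))"
    by (simp only: sum.distrib sum_distrib_left)
  also have "(\<Sum>i\<le>Suc (degree p). cmod (coeff p i)) = coeff_norm p"
    by (subst coeff_norm_eq_sum[of p "Suc (degree p)"]) auto
  also have "(\<Sum>i\<le>Suc (degree p). cmod (coeff (pCons 0 p) i)) = coeff_norm p"
    by (subst sum.atMost_Suc_shift) (simp add: coeff_norm_def)
  finally show ?thesis by (simp add: algebra_simps)
qed

text \<open>
  A linear factor \<open>x - a\<close> raises the coefficient norm by at most the factor \<open>1 + \<bar>a\<bar>\<close>, and for \<open>a\<close>
  outside the disc of radius \<open>2 L\<close> its modulus on the disc of radius \<open>L\<close> is comparable with \<open>\<bar>a\<bar>\<close>.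
  Hence remote zeros do not spoil the bound, which is uniform over all polynomials of given degree
  and norm.
\<close>

lemma poly_lower_bound_off_roots:
  fixes Q :: "complex poly"
  assumes "1 \<le> L" and "degree Q \<le> m"
  shows "\<exists>\<Xi>. finite \<Xi> \<and> card \<Xi> \<le> m \<and>
    (\<forall>x \<epsilon>. cmod x \<le> L \<longrightarrow> 0 < \<epsilon> \<longrightarrow> \<epsilon> \<le> 1 \<longrightarrow> (\<forall>\<xi>\<in>\<Xi>. \<epsilon> \<le> cmod (x - \<xi>)) \<longrightarrow>
       coeff_norm Q * (\<epsilon> / (4 * L)) ^ m \<le> cmod (poly Q x))"
  using assms(2)
proof (induction m arbitrary: Q)
  case 0
  then obtain c where Q: "Q = [:c:]" by (metis le_zero_eq degree_eq_zeroE)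
  show ?case by (rule exI[of _ "{}"]) (auto simp: Q coeff_norm_def)
next
  case (Suc m)
  have mono: "coeff_norm Q * (\<epsilon> / (4 * L)) ^ Suc m \<le> coeff_norm Q * (\<epsilon> / (4 * L)) ^ m"
    if "0 < \<epsilon>" "\<epsilon> \<le> 1" for \<epsilon> and Q
  proof -
    have "\<epsilon> / (4 * L) \<le> 1" using that assms(1) by simp
    then have "(\<epsilon> / (4 * L)) ^ Suc m \<le> (\<epsilon> / (4 * L)) ^ m"
      using that assms(1) by (intro power_decreasing) auto
    then show ?thesis by (intro mult_left_mono) auto
  qed
  show ?case
  proof (cases "degree Q \<le> m")
    case True
    then show ?thesis 
    proof -
      from Suc.IH[OF True] obtain \<Xi> where \<Xi>: "finite \<Xi>" "card \<Xi> \<le> m"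
        "\<And>x \<epsilon>. cmod x \<le> L \<Longrightarrow> 0 < \<epsilon> \<Longrightarrow> \<epsilon> \<le> 1 \<Longrightarrow> (\<forall>\<xi>\<in>\<Xi>. \<epsilon> \<le> cmod (x - \<xi>)) \<Longrightarrow>
         coeff_norm Q * (\<epsilon> / (4 * L)) ^ m \<le> cmod (poly Q x)" by blast
      then show ?thesis
        using order_trans[OF mono \<Xi>(3)] by (intro exI[of _ \<Xi>]) auto
    qed
  next
    case False
    then have "\<not> constant (poly Q)" by (simp add: constant_degree)
    then obtain a where "poly Q a = 0" using fundamental_theorem_of_algebra by blast
    then obtain Q' where Q': "Q = [:-a, 1:] * Q'" using poly_eq_0_iff_dvd by blast
    have "Q' \<noteq> 0" using Q' False by auto
    then have "degree Q = Suc (degree Q')" unfolding Q' by (subst degree_mult_eq) auto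
    then have "degree Q' \<le> m" using Suc.prems by simp
    from Suc.IH[OF this] obtain \<Xi> where \<Xi>: "finite \<Xi>" "card \<Xi> \<le> m"
      "\<And>x \<epsilon>. cmod x \<le> L \<Longrightarrow> 0 < \<epsilon> \<Longrightarrow> \<epsilon> \<le> 1 \<Longrightarrow> (\<forall>\<xi>\<in>\<Xi>. \<epsilon> \<le> cmod (x - \<xi>)) \<Longrightarrow>
       coeff_norm Q' * (\<epsilon> / (4 * L)) ^ m \<le> cmod (poly Q' x)" by blast
    have "coeff_norm Q * (\<epsilon> / (4 * L)) ^ Suc m \<le> cmod (poly Q x)"
      if x: "cmod x \<le> L" "0 < \<epsilon>" "\<epsilon> \<le> 1" "\<forall>\<xi>\<in>insert a \<Xi>. \<epsilon> \<le> cmod (x - \<xi>)" for x \<epsilon>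
    proof -
      have factor: "(1 + cmod a) * (\<epsilon> / (4 * L)) \<le> cmod (x - a)"
      proof (cases "cmod a \<le> 2 * L")
        case True
        then have "(1 + cmod a) * (\<epsilon> / (4 * L)) \<le> (4 * L) * (\<epsilon> / (4 * L))"
          using assms(1) x by (intro mult_right_mono) auto
        also have "\<dots> = \<epsilon>" using assms(1) by simp
        finally show ?thesis using x(4) by simp
      next
        case False
        have "\<epsilon> / (4 * L) \<le> 1 / 4" using assms(1) x frac_le[of 1 \<epsilon> 4 "4 * L"] by simp
        then have "(1 + cmod a) * (\<epsilon> / (4 * L)) \<le> (1 + cmod a) * (1/4)"
          by (intro mult_left_mono) auto
        also have "\<dots> \<le> cmod a - L" using False assms(1) by simp
        also have "\<dots> \<le> cmod (x - a)" using x(1) norm_triangle_ineq2[of a x]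
          by (simp add: norm_minus_commute)
        finally show ?thesis .
      qed
      have "coeff_norm Q * (\<epsilon> / (4 * L)) ^ Suc m
          \<le> ((1 + cmod a) * coeff_norm Q') * (\<epsilon> / (4 * L)) ^ Suc m"
        unfolding Q' using assms(1) x by (intro mult_right_mono coeff_norm_linear_mult) auto
      also have "\<dots> = ((1 + cmod a) * (\<epsilon> / (4 * L))) * (coeff_norm Q' * (\<epsilon> / (4 * L)) ^ m)"
        by (simp add: algebra_simps)
      also have "\<dots> \<le> cmod (x - a) * cmod (poly Q' x)"
        using factor \<Xi>(3)[OF x(1-3)] x assms(1) by (intro mult_mono) auto
      also have "\<dots> = cmod ((x - a) * poly Q' x)" by (simp add: norm_mult)
      also have "(x - a) * poly Q' x = poly Q x" unfolding Q' by (simp add: algebra_simps)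
      finally show ?thesis .
    qed
    moreover have "card (insert a \<Xi>) \<le> Suc m" using \<Xi> by (simp add: card_insert_if)
    ultimately show ?thesis using \<Xi>(1) by (intro exI[of _ "insert a \<Xi>"]) blast
  qed
qed

lemma polys_convergent_subsequence:
  fixes Q :: "nat \<Rightarrow> complex poly"
  assumes "\<And>n. degree (Q n) \<le> m" and "\<And>n. coeff_norm (Q n) = 1"
  obtains r Q' where "strict_mono (r :: nat \<Rightarrow> nat)" "degree Q' \<le> m" "Q' \<noteq> 0"
    "\<And>x. (\<lambda>n. poly (Q (r n)) x) \<longlonglongrightarrow> poly Q' x"
proof -
  have "\<exists>r. strict_mono (r :: nat \<Rightarrow> nat) \<and> (\<forall>i<k. convergent (\<lambda>n. coeff (Q (r n)) i))" for k
  proof (induction k)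
    case 0
    then show ?case using strict_mono_id by auto
  next
    case (Suc k)
    then obtain r where r: "strict_mono (r :: nat \<Rightarrow> nat)" "\<forall>i<k. convergent (\<lambda>n. coeff (Q (r n)) i)"
      by blast
    have "bounded (range (\<lambda>n. coeff (Q (r n)) k))"
    proof (rule boundedI)
      fix y assume "y \<in> range (\<lambda>n. coeff (Q (r n)) k)"
      then obtain n where "y = coeff (Q (r n)) k" by auto
      then show "cmod y \<le> 1" using norm_coeff_le_coeff_norm[of "Q (r n)" k] assms(2) by simp
    qed
    then obtain l s where s: "strict_mono (s :: nat \<Rightarrow> nat)" "((\<lambda>n. coeff (Q (r n)) k) \<circ> s) \<longlonglongrightarrow> l"
      using bounded_imp_convergent_subsequence by blast
    have "convergent (\<lambda>n. coeff (Q ((r \<circ> s) n)) i)" if "i < Suc k" for i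
    proof (cases "i = k")
      case True
      then show ?thesis using s(2) by (auto simp: convergent_def o_def)
    next
      case False
      then have "convergent (\<lambda>n. coeff (Q (r n)) i)" using r(2) that by simp
      from convergent_subseq_convergent[OF this s(1)] show ?thesis by (simp add: o_def)
    qed
    then show ?case using strict_mono_o[OF r(1) s(1)] by blast
  qed
  then obtain r where r: "strict_mono (r :: nat \<Rightarrow> nat)"
    "\<forall>i<Suc m. convergent (\<lambda>n. coeff (Q (r n)) i)" by blast
  define c where "c i = lim (\<lambda>n. coeff (Q (r n)) i)" for i
  have c: "(\<lambda>n. coeff (Q (r n)) i) \<longlonglongrightarrow> c i" if "i \<le> m" for i
    using r(2) that unfolding c_def by (simp add: convergent_LIMSEQ_iff)
  define Q' where "Q' = (\<Sum>i\<le>m. monom (c i) i)"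
  have coeffQ': "coeff Q' i = c i" if "i \<le> m" for i
    using that unfolding Q'_def by (simp add: coeff_sum)
  have degQ': "degree Q' \<le> m"
    unfolding Q'_def by (intro degree_sum_le) (auto intro: order_trans[OF degree_monom_le])
  have "(\<lambda>n. \<Sum>i\<le>m. cmod (coeff (Q (r n)) i)) \<longlonglongrightarrow> (\<Sum>i\<le>m. cmod (c i))"
    by (intro tendsto_intros c) auto
  moreover have "(\<Sum>i\<le>m. cmod (coeff (Q (r n)) i)) = 1" for n
    using coeff_norm_eq_sum[OF assms(1), of "r n"] assms(2)[of "r n"] by simp
  ultimately have "(\<Sum>i\<le>m. cmod (c i)) = 1" by (simp add: LIMSEQ_const_iff)
  moreover have "(\<Sum>i\<le>m. cmod (c i)) = 0" if "Q' = 0"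
    using coeffQ' that by (intro sum.neutral) auto
  ultimately have "Q' \<noteq> 0" by auto
  have palt: "poly p x = (\<Sum>i\<le>m. coeff p i * x ^ i)" if "degree p \<le> m" for p :: "complex poly" and x
    unfolding poly_altdef by (rule sum.mono_neutral_left) (use that in \<open>auto simp: coeff_eq_0\<close>)
  have "(\<lambda>n. poly (Q (r n)) x) \<longlonglongrightarrow> poly Q' x" for x
    unfolding palt[OF assms(1)] palt[OF degQ']
    by (intro tendsto_intros) (use c coeffQ' in auto)
  then show ?thesis using that r(1) degQ' \<open>Q' \<noteq> 0\<close> by blast
qed

text \<open>
  Averages over \<open>N\<close>-th roots serve below as a substitute for integrals over circles.
\<close>

lemma nth_roots_factorization:
  fixes t :: complex
  assumes "0 < N" and "t \<noteq> 0"
  shows "(\<Prod>\<xi> | \<xi> ^ N = t ^ N. x - \<xi>) = x ^ N - t ^ N"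
proof -
  define p where "p = monom 1 N + [:- (t ^ N):]"
  have deg: "degree p = N"
    unfolding p_def using assms by (subst degree_add_eq_left) (auto simp: degree_monom_eq)
  have lc: "lead_coeff p = 1"
    unfolding deg unfolding p_def using assms by (cases N) auto
  have p0: "p \<noteq> 0" using lc by auto
  have ev: "poly p y = y ^ N - t ^ N" for y unfolding p_def by (simp add: poly_monom)
  have "pderiv p = monom (of_nat N) (N - 1)" unfolding p_def by (simp add: pderiv_add pderiv_monom pderiv_pCons)
  then have "rsquarefree p"
    unfolding rsquarefree_roots using assms ev by (auto simp: poly_monom power_0_left)
  then have "smult (lead_coeff p) (\<Prod>z|poly p z = 0. [:-z, 1:]) = p"
    by (rule complex_poly_decompose_rsquarefree)
  then have "poly p x = poly (\<Prod>z|poly p z = 0. [:-z, 1:]) x" using lc by simp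
  also have "\<dots> = (\<Prod>\<xi> | \<xi> ^ N = t ^ N. x - \<xi>)" by (simp add: poly_prod ev)
  finally show ?thesis using ev by simp
qed

text \<open>
  The radii that come within \<open>c / (k + 1)\<^sup>2\<close> of the distance from \<open>x0\<close> to some point of \<open>X k\<close> have
  total length at most a multiple of \<open>c\<close>, because \<open>\<Sum> 1 / (k + 1)\<^sup>2\<close> converges. The quadratic
  decay, rather than a geometric one, will be absorbed by any geometric series.
\<close>

lemma radius_avoiding_finite_sets:
  fixes x0 :: complex and X :: "nat \<Rightarrow> complex set"
  assumes "0 < \<delta>" and fin: "\<And>k. finite (X k)" and card: "\<And>k. card (X k) \<le> m"
  obtains t c where "\<delta> / 2 < t" "t < \<delta>" "0 < c" "c \<le> 1"
    "\<And>k \<xi> x. \<xi> \<in> X k \<Longrightarrow> cmod (x - x0) = t \<Longrightarrow> c / (real k + 1) ^ 2 \<le> cmod (x - \<xi>)"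
proof -
  define a where "a k = 1 / (real k + 1) ^ 2" for k
  have suma: "summable a"
  proof -
    have "summable (\<lambda>k. inverse ((real (Suc k)) ^ 2))"
      using inverse_power_summable[of 2, where 'a = real] by (subst summable_Suc_iff) simp
    then show ?thesis unfolding a_def by (simp add: inverse_eq_divide add.commute)
  qed
  define C where "C = suminf a"
  have C0: "0 \<le> C" unfolding C_def by (rule suminf_nonneg[OF suma]) (simp add: a_def)
  define c where "c = min 1 (\<delta> / (8 * (real m + 1) * (C + 1)))"
  have c: "0 < c" "c \<le> 1" using assms C0 unfolding c_def by auto
  define B where "B k = (\<Union>\<xi>\<in>X k. ball (cmod (\<xi> - x0)) (c * a k))" for k
  have a0: "0 < a k" for k unfolding a_def by simp
  have Bs: "B k \<in> sets lborel" for k unfolding B_def by (auto intro!: borel_open open_UN)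
  have eB: "emeasure lborel (B k) \<le> ennreal (2 * real m * c * a k)" for k
  proof -
    have "emeasure lborel (B k) \<le> (\<Sum>\<xi>\<in>X k. emeasure lborel (ball (cmod (\<xi> - x0)) (c * a k)))"
      unfolding B_def using fin by (intro emeasure_subadditive_finite) auto
    also have "\<dots> = (\<Sum>\<xi>\<in>X k. ennreal (2 * c * a k))"
      using a0[of k] c by (intro sum.cong refl) (simp add: ball_eq_greaterThanLessThan)
    also have "\<dots> = ennreal (real (card (X k)) * (2 * c * a k))"
      using a0[of k] c by (simp add: ennreal_mult' ennreal_of_nat_eq_real_of_nat)
    also have "\<dots> \<le> ennreal (2 * real m * c * a k)"
      using card[of k] a0[of k] c by (intro ennreal_leI) (simp add: mult.assoc mult.left_commute mult_mono)
    finally show ?thesis .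
  qed
  have "emeasure lborel (\<Union>k. B k) \<le> (\<Sum>k. emeasure lborel (B k))"
    using Bs by (intro emeasure_subadditive_countably) auto
  also have "\<dots> \<le> (\<Sum>k. ennreal (2 * real m * c * a k))"
    by (intro suminf_le eB) auto
  also have "\<dots> = ennreal (\<Sum>k. 2 * real m * c * a k)"
    using suma a0 c by (intro suminf_ennreal2 summable_mult) (auto intro!: mult_nonneg_nonneg intro: less_imp_le)
  also have "(\<Sum>k. 2 * real m * c * a k) = 2 * real m * c * C"
    unfolding C_def by (rule suminf_mult[OF suma])
  also have "ennreal (2 * real m * c * C) < ennreal (\<delta> / 2)"
  proof (rule ennreal_lessI)
    have "2 * real m * c * C \<le> 2 * (real m + 1) * c * (C + 1)"
      using c C0 by (intro mult_mono) auto
    also have "\<dots> \<le> 2 * (real m + 1) * (\<delta> / (8 * (real m + 1) * (C + 1))) * (C + 1)"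
      using C0 by (intro mult_right_mono mult_left_mono) (auto simp: c_def)
    also have "\<dots> = \<delta> / 4"
    proof -
      have "(real m + 1) * (C + 1) \<noteq> 0" using C0 by simp
      then show ?thesis by (simp add: divide_simps)
    qed
    also have "\<dots> < \<delta> / 2" using assms by simp
    finally show "2 * real m * c * C < \<delta> / 2" .
  qed (use assms in auto)
  finally have small: "emeasure lborel (\<Union>k. B k) < ennreal (\<delta> / 2)" .
  have "\<not> {\<delta>/2<..<\<delta>} \<subseteq> (\<Union>k. B k)"
  proof
    assume "{\<delta>/2<..<\<delta>} \<subseteq> (\<Union>k. B k)"
    then have "emeasure lborel {\<delta>/2<..<\<delta>} \<le> emeasure lborel (\<Union>k. B k)"
      using Bs by (intro emeasure_mono) auto
    then show False using small assms by simp
  qed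
  then obtain t where t: "\<delta>/2 < t" "t < \<delta>" "\<And>k. t \<notin> B k"
    by (meson UN_I UNIV_I greaterThanLessThan_iff subsetI)
  have "c / (real k + 1) ^ 2 \<le> cmod (x - \<xi>)" if "\<xi> \<in> X k" "cmod (x - x0) = t" for k \<xi> x
  proof -
    have "c * a k \<le> \<bar>cmod (\<xi> - x0) - t\<bar>"
      using t(3)[of k] that(1) unfolding B_def by (auto simp: dist_real_def)
    also have "\<dots> \<le> cmod (\<xi> - x)" using norm_triangle_ineq3[of "\<xi> - x0" "x - x0"] that(2) by simp
    finally show ?thesis by (simp add: a_def norm_minus_commute)
  qed
  then show ?thesis using that t(1,2) c by blast
qed

section \<open>Truncated kernels and the exponential of the potential\<close>

text \<open>
  The kernel of the negative potential, cut off from below so as to be continuous in \<open>\<zeta>\<close>;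
  the weak convergence of the zero distributions can only be tested on continuous functions.
\<close>

definition trunc_log :: "real \<Rightarrow> complex \<Rightarrow> complex \<Rightarrow> real" where
  "trunc_log \<delta> x \<zeta> = ln (max (dist x \<zeta>) \<delta>)"

lemma trunc_log_mono: "0 < \<delta> \<Longrightarrow> \<delta> \<le> \<delta>' \<Longrightarrow> trunc_log \<delta> x \<zeta> \<le> trunc_log \<delta>' x \<zeta>"
  unfolding trunc_log_def by (subst ln_le_cancel_iff) auto

lemma continuous_trunc_log: "0 < \<delta> \<Longrightarrow> continuous_on A (trunc_log \<delta> x)"
  unfolding trunc_log_def by (intro continuous_intros) auto

lemma borel_measurable_trunc_log [measurable]: "trunc_log \<delta> x \<in> borel_measurable borel"
  unfolding trunc_log_def by measurable

lemma trunc_log_shift: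
  assumes "0 < \<delta>"
  shows "trunc_log \<delta> y \<zeta> \<le> trunc_log \<delta> x \<zeta> + ln (1 + dist x y / \<delta>)"
proof -
  let ?M = "max (dist x \<zeta>) \<delta>"
  have "dist y \<zeta> \<le> dist x \<zeta> + dist x y" by (metis dist_commute dist_triangle add.commute)
  moreover have "dist x y \<le> ?M * (dist x y / \<delta>)"
  proof -
    have "\<delta> * (dist x y / \<delta>) \<le> ?M * (dist x y / \<delta>)"
      using assms by (intro mult_right_mono) auto
    then show ?thesis using assms by simp
  qed
  ultimately have "max (dist y \<zeta>) \<delta> \<le> ?M * (1 + dist x y / \<delta>)"
    using assms by (auto simp: distrib_left intro: add_mono order_trans add_increasing2)
  then have "ln (max (dist y \<zeta>) \<delta>) \<le> ln (?M * (1 + dist x y / \<delta>))"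
    using assms by (subst ln_le_cancel_iff) (auto intro!: mult_pos_pos add_pos_nonneg)
  also have "\<dots> = ln ?M + ln (1 + dist x y / \<delta>)"
    using assms by (intro ln_mult_pos) (auto intro!: add_pos_nonneg)
  finally show ?thesis unfolding trunc_log_def .
qed

locale compactly_supported_prob = prob_space \<mu> for \<mu> :: "complex measure" +
  fixes S :: "complex set"
  assumes compact_S: "compact S" and sets_eq: "sets \<mu> = sets borel"
    and null_off_S: "emeasure \<mu> (- S) = 0"
begin

abbreviation "U \<equiv> exp_neg_potential \<mu>"

lemma space_eq [simp]: "space \<mu> = UNIV"
  using sets_eq_imp_space_eq[OF sets_eq] by simp

lemma measurable_eq [measurable_cong]: "sets \<mu> = sets borel" by (rule sets_eq)

lemma AE_in_S: "AE \<zeta> in \<mu>. \<zeta> \<in> S"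
  by (rule AE_I[of _ _ "- S"]) (use null_off_S compact_S sets_eq compact_imp_closed in \<open>auto intro: borel_open\<close>)

lemma S_nonempty: "S \<noteq> {}"
  using null_off_S emeasure_space_1 by (auto simp del: emeasure_space_1)

lemma dist_bound:
  obtains D where "1 \<le> D" "\<And>\<zeta>. \<zeta> \<in> S \<Longrightarrow> dist x \<zeta> \<le> D"
proof -
  obtain D where "\<forall>\<zeta>\<in>S. dist x \<zeta> \<le> D"
    using compact_imp_bounded[OF compact_S] bounded_any_center by metis
  then show ?thesis using that[of "max 1 D"] by (metis max.cobounded1 max.coboundedI2)
qed

lemma trunc_log_upper:
  assumes "0 < \<delta>" "\<delta> \<le> 1" "1 \<le> D" "dist x \<zeta> \<le> D"
  shows "trunc_log \<delta> x \<zeta> \<le> ln D"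
  unfolding trunc_log_def using assms by (subst ln_le_cancel_iff) auto

lemma integrable_trunc_log [simp]:
  assumes "0 < \<delta>"
  shows "integrable \<mu> (trunc_log \<delta> x)"
proof -
  obtain D where D: "1 \<le> D" "\<And>\<zeta>. \<zeta> \<in> S \<Longrightarrow> dist x \<zeta> \<le> D" using dist_bound[of x] by metis
  show ?thesis
  proof (rule integrable_const_bound[where B = "\<bar>ln \<delta>\<bar> + \<bar>ln (max D \<delta>)\<bar>"])
    show "AE \<zeta> in \<mu>. norm (trunc_log \<delta> x \<zeta>) \<le> \<bar>ln \<delta>\<bar> + \<bar>ln (max D \<delta>)\<bar>"
      using AE_in_S
    proof eventually_elim
      case (elim \<zeta>)
      have "ln \<delta> \<le> trunc_log \<delta> x \<zeta>" "trunc_log \<delta> x \<zeta> \<le> ln (max D \<delta>)"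
        unfolding trunc_log_def using assms D(2)[OF elim] by (auto simp: less_max_iff_disj max.coboundedI1 intro!: ln_mono)
      then show ?case by auto
    qed
  qed measurable
qed

definition trunc_pot :: "real \<Rightarrow> complex \<Rightarrow> real" where
  "trunc_pot \<delta> x = (\<integral>\<zeta>. trunc_log \<delta> x \<zeta> \<partial>\<mu>)"

lemma trunc_pot_mono: "0 < \<delta> \<Longrightarrow> \<delta> \<le> \<delta>' \<Longrightarrow> trunc_pot \<delta> x \<le> trunc_pot \<delta>' x"
  unfolding trunc_pot_def by (intro integral_mono trunc_log_mono) auto

text \<open>
  Both parts of the truncated kernel are treated separately: the positive part does not depend on
  the truncation, and the negative part increases to that of the full kernel, so that monotone
  convergence applies even where the potential is infinite. Semicontinuity, comparison and growth of
  \<open>U\<close> are all derived from this limit and from monotonicity in \<open>\<delta>\<close>.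
\<close>

lemma trunc_pot_tendsto: "(\<lambda>n. exp (trunc_pot (1 / real (Suc n)) x)) \<longlonglongrightarrow> U x"
proof -
  define d where "d n = 1 / real (Suc n)" for n
  have d: "0 < d n" "d n \<le> 1" for n unfolding d_def by auto
  have d_anti: "d (Suc n) \<le> d n" for n unfolding d_def by (simp add: frac_le)
  have d0: "d \<longlonglongrightarrow> 0" unfolding d_def by (rule LIMSEQ_Suc[OF lim_1_over_n])
  define g where "g \<zeta> = max 0 (trunc_log 1 x \<zeta>)" for \<zeta>
  define h where "h n \<zeta> = max 0 (- trunc_log (d n) x \<zeta>)" for n \<zeta>
  have gi: "integrable \<mu> g" unfolding g_def by (intro Bochner_Integration.integrable_max) auto
  have hi: "integrable \<mu> (h n)" for n unfolding h_def using d by (intro Bochner_Integration.integrable_max) auto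
  have h0: "0 \<le> h n \<zeta>" for n \<zeta> unfolding h_def by simp
  have hinc: "h n \<zeta> \<le> h (Suc n) \<zeta>" for n \<zeta>
    unfolding h_def using trunc_log_mono[OF d(1) d_anti[of n], of x \<zeta>] by (intro max.mono) auto
  have split: "trunc_log (d n) x \<zeta> = g \<zeta> - h n \<zeta>" for n \<zeta>
  proof (cases "dist x \<zeta> \<le> 1")
    case True
    then have "max (dist x \<zeta>) (d n) \<le> 1" "0 < max (dist x \<zeta>) (d n)" using d[of n] by auto
    then have "ln (max (dist x \<zeta>) (d n)) \<le> 0" by (simp add: less_max_iff_disj)
    then show ?thesis using True unfolding g_def h_def trunc_log_def by (simp add: max_def)
  next
    case False
    then have "max (dist x \<zeta>) (d n) = dist x \<zeta>" "max (dist x \<zeta>) 1 = dist x \<zeta>" using d[of n] by auto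
    moreover have "0 < ln (dist x \<zeta>)" using False by (intro ln_gt_zero) linarith
    ultimately show ?thesis unfolding g_def h_def trunc_log_def by simp
  qed
  have neg: "e2ennreal (- log_kernel x \<zeta>) = ennreal (g \<zeta>)" for \<zeta>
  proof (cases "\<zeta> = x")
    case True
    then show ?thesis by (simp add: log_kernel_def g_def trunc_log_def e2ennreal_neg)
  next
    case False
    then show ?thesis
      by (cases "dist x \<zeta> \<le> 1") (auto simp: log_kernel_def g_def trunc_log_def max_def ennreal_neg)
  qed
  have pos: "e2ennreal (log_kernel x \<zeta>) = (SUP n. ennreal (h n \<zeta>))" for \<zeta>
  proof (cases "\<zeta> = x")
    case True
    have "h n x = - ln (d n)" for n
      using d[of n] unfolding h_def trunc_log_def by (simp add: max_def)
    moreover have "(SUP n. ennreal (- ln (d n))) = \<infinity>"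
      unfolding infinity_ennreal_def
    proof (rule ennreal_SUP_eq_top)
      fix n :: nat
      have "\<exists>k. real n \<le> - ln (d k)"
      proof -
        obtain k where "exp (real n) \<le> real k" using real_arch_simple by blast
        then have "exp (real n) \<le> real (Suc k)" by simp
        then have "real n \<le> ln (real (Suc k))" by (subst ln_ge_iff) auto
        then show ?thesis by (intro exI[of _ k]) (simp add: d_def ln_div)
      qed
      then show "\<exists>i\<in>UNIV. of_nat n \<le> ennreal (- ln (d i))"
        by (auto simp: ennreal_of_nat_eq_real_of_nat intro: ennreal_leI)
    qed
    ultimately have "(SUP n. ennreal (h n x)) = \<infinity>" by (simp only:)
    moreover have "e2ennreal (log_kernel x x) = \<infinity>" by (simp add: log_kernel_def)
    ultimately show ?thesis using True by (simp only:)
  next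
    case False
    then have dp: "0 < dist x \<zeta>" by simp
    have "\<forall>\<^sub>F n in sequentially. d n < dist x \<zeta>" using d0 dp by (rule order_tendstoD)
    then obtain n where n: "d n < dist x \<zeta>" by (auto simp: eventually_sequentially)
    have le: "h k \<zeta> \<le> max 0 (- ln (dist x \<zeta>))" for k
      unfolding h_def trunc_log_def using dp d[of k] by (auto simp: max_def)
    have eq: "h n \<zeta> = max 0 (- ln (dist x \<zeta>))"
      unfolding h_def trunc_log_def using n by (simp add: max_def)
    have "(SUP n. ennreal (h n \<zeta>)) = ennreal (max 0 (- ln (dist x \<zeta>)))"
      by (rule antisym) (auto intro!: SUP_least SUP_upper2[of n] ennreal_leI le simp: eq simp del: ennreal_max_0)
    also have "\<dots> = ennreal (- ln (dist x \<zeta>))" by simp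
    finally show ?thesis using False by (simp add: log_kernel_def)
  qed
  define H where "H n = (\<integral>\<zeta>. h n \<zeta> \<partial>\<mu>)" for n
  define G where "G = (\<integral>\<zeta>. g \<zeta> \<partial>\<mu>)"
  have H0: "0 \<le> H n" for n unfolding H_def using h0 by simp
  have incH: "incseq (\<lambda>n. ereal (H n))"
    unfolding H_def by (rule incseq_SucI) (auto intro!: integral_mono hi hinc)
  have tp: "trunc_pot (d n) x = G - H n" for n
    unfolding trunc_pot_def H_def G_def split using gi hi by simp
  have "(\<integral>\<^sup>+ \<zeta>. e2ennreal (- log_kernel x \<zeta>) \<partial>\<mu>) = ennreal G"
    unfolding neg G_def by (rule nn_integral_eq_integral[OF gi]) (simp add: g_def)
  moreover have "(\<integral>\<^sup>+ \<zeta>. e2ennreal (log_kernel x \<zeta>) \<partial>\<mu>) = (SUP n. ennreal (H n))"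
  proof -
    have "(\<integral>\<^sup>+ \<zeta>. e2ennreal (log_kernel x \<zeta>) \<partial>\<mu>) = (\<integral>\<^sup>+ \<zeta>. (SUP n. ennreal (h n \<zeta>)) \<partial>\<mu>)"
      unfolding pos ..
    also have "\<dots> = (SUP n. (\<integral>\<^sup>+ \<zeta>. ennreal (h n \<zeta>) \<partial>\<mu>))"
      using borel_measurable_integrable[OF hi]
      by (intro nn_integral_monotone_convergence_SUP)
        (auto intro!: incseq_SucI le_funI ennreal_leI hinc)
    also have "\<dots> = (SUP n. ennreal (H n))"
      unfolding H_def by (intro SUP_cong refl nn_integral_eq_integral hi) (simp add: h0)
    finally show ?thesis .
  qed
  moreover have "enn2ereal (SUP n. ennreal (H n)) = (SUP n. ereal (H n))"
  proof -
    have "0 \<le> (SUP n. ereal (H n))" using H0 by (intro SUP_upper2[of 0]) auto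
    moreover have "enn2ereal (SUP n. ennreal (H n)) = sup 0 (SUP n. ereal (H n))"
      using H0 by (simp add: Sup_ennreal.rep_eq image_image enn2ereal_ennreal)
    ultimately show ?thesis by (simp add: sup.absorb2)
  qed
  moreover have "0 \<le> G" unfolding G_def g_def by simp
  ultimately have pot: "log_potential \<mu> x = (SUP n. ereal (H n)) - ereal G"
    unfolding log_potential_def by (simp add: enn2ereal_ennreal)
  have "(\<lambda>n. ereal (H n)) \<longlonglongrightarrow> (SUP n. ereal (H n))" by (rule LIMSEQ_SUP[OF incH])
  then have lim: "(\<lambda>n. ereal (H n) - ereal G) \<longlonglongrightarrow> log_potential \<mu> x"
    unfolding pot by (intro tendsto_diff_ereal_general tendsto_const) auto
  have "(\<lambda>n. exp (trunc_pot (d n) x)) \<longlonglongrightarrow> U x"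
  proof (cases "log_potential \<mu> x")
    case (real p)
    then have "(\<lambda>n. ereal (H n - G)) \<longlonglongrightarrow> ereal p" using lim by simp
    then have "(\<lambda>n. H n - G) \<longlonglongrightarrow> p" by simp
    then have "(\<lambda>n. exp (- (H n - G))) \<longlonglongrightarrow> exp (- p)" by (intro tendsto_intros)
    then show ?thesis unfolding tp exp_neg_potential_def real by simp
  next
    case PInf
    then have "(\<lambda>n. ereal (H n - G)) \<longlonglongrightarrow> \<infinity>" using lim by simp
    then have "filterlim (\<lambda>n. H n - G) at_top sequentially" by (simp add: tendsto_PInfty_eq_at_top)
    then have "filterlim (\<lambda>n. - (H n - G)) at_bot sequentially" by (rule filterlim_compose[OF filterlim_uminus_at_bot_at_top])
    then have "(\<lambda>n. exp (- (H n - G))) \<longlonglongrightarrow> 0" by (rule filterlim_compose[OF exp_at_bot])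
    then show ?thesis unfolding tp exp_neg_potential_def PInf by simp
  next
    case MInf
    have "ereal (H 0) \<le> (SUP n. ereal (H n))" by (rule SUP_upper) simp
    then have "ereal (H 0) - ereal G \<le> log_potential \<mu> x" unfolding pot by (rule ereal_minus_mono) simp
    then show ?thesis using MInf by simp
  qed
  then show ?thesis unfolding d_def .
qed

lemma exp_neg_potential_le:
  assumes "0 < \<delta>"
  shows "U x \<le> exp (trunc_pot \<delta> x)"
proof -
  obtain N where N: "1 / \<delta> \<le> real N" using real_arch_simple by blast
  show ?thesis
  proof (rule LIMSEQ_le_const2[OF trunc_pot_tendsto], intro exI[of _ N] allI impI)
    fix n assume "N \<le> n"
    then have "1 / \<delta> \<le> real (Suc n)" using N by linarith
    then have "1 / real (Suc n) \<le> \<delta>" using assms by (simp add: field_simps)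
    then show "exp (trunc_pot (1 / real (Suc n)) x) \<le> exp (trunc_pot \<delta> x)"
      using trunc_pot_mono[of "1 / real (Suc n)" \<delta> x] by simp
  qed
qed

lemma exp_neg_potential_greatest:
  assumes "0 < \<delta>'" and "\<And>\<delta>. 0 < \<delta> \<Longrightarrow> \<delta> \<le> \<delta>' \<Longrightarrow> a \<le> exp (trunc_pot \<delta> x)"
  shows "a \<le> U x"
proof -
  obtain N where N: "1 / \<delta>' \<le> real N" using real_arch_simple by blast
  show ?thesis
  proof (rule LIMSEQ_le_const[OF trunc_pot_tendsto], intro exI[of _ N] allI impI)
    fix n assume "N \<le> n"
    then have "1 / \<delta>' \<le> real (Suc n)" using N by linarith
    then have "1 / real (Suc n) \<le> \<delta>'" using assms(1) by (simp add: field_simps)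
    then show "a \<le> exp (trunc_pot (1 / real (Suc n)) x)" by (intro assms(2)) auto
  qed
qed

lemma exp_neg_potential_lessE:
  assumes "U x < a"
  obtains \<delta> where "0 < \<delta>" "exp (trunc_pot \<delta> x) < a"
  using exp_neg_potential_greatest[of 1 a x] assms by (meson not_less zero_less_one)

lemma exp_neg_potential_nonneg: "0 \<le> U x"
  unfolding exp_neg_potential_def by simp

lemma trunc_pot_shift:
  assumes "0 < \<delta>"
  shows "trunc_pot \<delta> y \<le> trunc_pot \<delta> x + ln (1 + dist x y / \<delta>)"
proof -
  have "trunc_pot \<delta> y \<le> (\<integral>\<zeta>. trunc_log \<delta> x \<zeta> + ln (1 + dist x y / \<delta>) \<partial>\<mu>)"
    unfolding trunc_pot_def using assms by (intro integral_mono trunc_log_shift) auto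
  also have "\<dots> = trunc_pot \<delta> x + ln (1 + dist x y / \<delta>)"
    unfolding trunc_pot_def using assms prob_space by simp
  finally show ?thesis .
qed

lemma integrable_indicator_borel [simp]:
  "A \<in> sets borel \<Longrightarrow> integrable \<mu> (indicator A :: complex \<Rightarrow> real)"
  by (intro integrable_real_indicator) (auto simp: sets_eq less_top[symmetric])

text \<open>
  Upper semicontinuity: \<open>U\<close> is an infimum of the functions \<open>exp (trunc_pot \<delta> x)\<close>, which are
  continuous in \<open>x\<close>.
\<close>

lemma open_level_set: "open {x. U x < a}"
  unfolding open_contains_ball
proof
  fix x assume "x \<in> {x. U x < a}"
  then obtain \<delta> where \<delta>: "0 < \<delta>" "exp (trunc_pot \<delta> x) < a"
    using exp_neg_potential_lessE by blast
  define e where "e = \<delta> * (a / exp (trunc_pot \<delta> x) - 1)"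
  have e: "0 < e" using \<delta> unfolding e_def by (simp add: field_simps)
  have "U y < a" if "dist x y < e" for y
  proof -
    have "exp (trunc_pot \<delta> y) \<le> exp (trunc_pot \<delta> x + ln (1 + dist x y / \<delta>))"
      using trunc_pot_shift[OF \<delta>(1)] by simp
    also have "\<dots> = exp (trunc_pot \<delta> x) * (1 + dist x y / \<delta>)"
      using \<delta>(1) by (subst exp_add, subst exp_ln) (auto intro!: add_pos_nonneg)
    also have "\<dots> < exp (trunc_pot \<delta> x) * (1 + e / \<delta>)"
      using \<delta>(1) that by (intro mult_strict_left_mono) (auto simp: divide_strict_right_mono)
    also have "\<dots> = a" using \<delta>(1) unfolding e_def by (simp add: field_simps)
    finally show ?thesis using exp_neg_potential_le[OF \<delta>(1), of y] by simp
  qed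
  then show "\<exists>e>0. ball x e \<subseteq> {x. U x < a}"
    using e by (intro exI[of _ e]) auto
qed

lemma exp_neg_potential_ge_dist:
  assumes "0 < d" and "AE \<zeta> in \<mu>. d \<le> dist x \<zeta>"
  shows "d \<le> U x"
proof (rule exp_neg_potential_greatest[of 1])
  fix \<delta> :: real assume \<delta>: "0 < \<delta>" "\<delta> \<le> 1"
  have "ln d = (\<integral>\<zeta>. ln d \<partial>\<mu>)" using prob_space by simp
  also have "\<dots> \<le> trunc_pot \<delta> x"
    unfolding trunc_pot_def
  proof (rule integral_mono_AE)
    show "AE \<zeta> in \<mu>. ln d \<le> trunc_log \<delta> x \<zeta>"
      using assms(2) by eventually_elim (use assms(1) in \<open>auto simp: trunc_log_def intro!: ln_mono\<close>)
  qed (use \<delta> in auto)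
  finally show "d \<le> exp (trunc_pot \<delta> x)" using assms(1) by (metis exp_le_cancel_iff exp_ln)
qed simp

lemma open_level_set_ereal: "open (level_set \<mu> R)"
proof -
  have "\<exists>T. open T \<and> x \<in> T \<and> T \<subseteq> level_set \<mu> R" if x: "x \<in> level_set \<mu> R" for x
  proof -
    have "ereal (U x) < R" using x unfolding level_set_def by simp
    then obtain r where r: "U x < r" "ereal r < R" using ereal_dense2 by (metis less_ereal.simps(1))
    have "{x. U x < r} \<subseteq> level_set \<mu> R"
    proof
      fix y assume "y \<in> {x. U x < r}"
      then have "ereal (U y) < ereal r" by simp
      then show "y \<in> level_set \<mu> R" unfolding level_set_def using r(2) less_trans by blast
    qed
    then show ?thesis using open_level_set[of r] r(1) by blast
  qed
  then show ?thesis by (subst open_subopen) blast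
qed

lemma bounded_level_set: "bounded {x. U x < a}"
proof -
  obtain D where D: "1 \<le> D" "\<And>\<zeta>. \<zeta> \<in> S \<Longrightarrow> dist 0 \<zeta> \<le> D" using dist_bound[of 0] by metis
  have "cmod x \<le> D + \<bar>a\<bar> + 1" if "U x < a" for x
  proof (rule ccontr)
    assume "\<not> ?thesis"
    then have big: "D + \<bar>a\<bar> + 1 < cmod x" by simp
    have "\<bar>a\<bar> + 1 \<le> U x"
    proof (rule exp_neg_potential_ge_dist)
      show "AE \<zeta> in \<mu>. \<bar>a\<bar> + 1 \<le> dist x \<zeta>"
        using AE_in_S
      proof eventually_elim
        case (elim \<zeta>)
        then show ?case using D(2)[OF elim] big norm_triangle_ineq2[of x \<zeta>] by (simp add: dist_norm)
      qed
    qed auto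
    then show False using that by simp
  qed
  then show ?thesis unfolding bounded_iff by blast
qed

definition log_pot :: "complex \<Rightarrow> real" where
  "log_pot x = (\<integral>\<zeta>. ln (dist x \<zeta>) \<partial>\<mu>)"

lemma off_support:
  assumes "0 < d" and "AE \<zeta> in \<mu>. d \<le> dist x \<zeta>"
  shows integrable_log_dist: "integrable \<mu> (\<lambda>\<zeta>. ln (dist x \<zeta>))"
    and trunc_pot_eq_log_pot: "\<And>\<delta>. 0 < \<delta> \<Longrightarrow> \<delta> \<le> d \<Longrightarrow> trunc_pot \<delta> x = log_pot x"
    and exp_neg_potential_eq: "U x = exp (log_pot x)"
proof -
  have eq: "AE \<zeta> in \<mu>. trunc_log \<delta> x \<zeta> = ln (dist x \<zeta>)" if "0 < \<delta>" "\<delta> \<le> d" for \<delta>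
    using assms(2) by eventually_elim (use that in \<open>auto simp: trunc_log_def max_absorb1\<close>)
  show "integrable \<mu> (\<lambda>\<zeta>. ln (dist x \<zeta>))"
    using integrable_cong_AE[of "trunc_log d x" \<mu> "\<lambda>\<zeta>. ln (dist x \<zeta>)"] eq[of d] assms(1) by auto
  show tp: "trunc_pot \<delta> x = log_pot x" if "0 < \<delta>" "\<delta> \<le> d" for \<delta>
    unfolding trunc_pot_def log_pot_def using eq[OF that] by (intro integral_cong_AE) auto
  show "U x = exp (log_pot x)"
  proof (rule antisym)
    show "U x \<le> exp (log_pot x)" using exp_neg_potential_le[OF assms(1), of x] tp[of d] assms(1) by simp
    show "exp (log_pot x) \<le> U x"
      by (rule exp_neg_potential_greatest[OF assms(1)]) (simp add: tp)
  qed
qed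

text \<open>
  An atom at \<open>s\<close> contributes \<open>\<mu>{s} ln \<delta>\<close> to the truncated potential, which tends to \<open>-\<infinity>\<close>.
\<close>

lemma no_atom:
  assumes "0 < U s"
  shows "measure \<mu> {s} = 0"
proof (rule ccontr)
  define p where "p = measure \<mu> {s}"
  assume "measure \<mu> {s} \<noteq> 0"
  then have p: "0 < p" unfolding p_def using measure_nonneg[of \<mu> "{s}"] by linarith
  obtain D where D: "1 \<le> D" "\<And>\<zeta>. \<zeta> \<in> S \<Longrightarrow> dist s \<zeta> \<le> D" using dist_bound[of s] by metis
  have le: "U s \<le> exp (ln D - p * t)" if "0 \<le> t" for t
  proof -
    have "trunc_pot (exp (- t)) s \<le> (\<integral>\<zeta>. ln D + (- t) * indicator {s} \<zeta> \<partial>\<mu>)"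
      unfolding trunc_pot_def
    proof (rule integral_mono_AE)
      show "AE \<zeta> in \<mu>. trunc_log (exp (- t)) s \<zeta> \<le> ln D + (- t) * indicator {s} \<zeta>"
        using AE_in_S
      proof eventually_elim
        case (elim \<zeta>)
        show ?case
        proof (cases "\<zeta> = s")
          case True
          then show ?thesis using D(1) by (simp add: trunc_log_def)
        next
          case False
          then show ?thesis using trunc_log_upper[OF _ _ D(1) D(2)[OF elim], of "exp (- t)"] that by simp
        qed
      qed
    qed auto
    also have "\<dots> = ln D + (- t) * p"
      using prob_space unfolding p_def
      by (subst Bochner_Integration.integral_add) (auto intro!: integrable_mult_right simp: sets_eq)
    finally show ?thesis using exp_neg_potential_le[of "exp (- t)" s] 
      by (simp add: mult.commute) (meson exp_le_cancel_iff order_trans)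
  qed
  have "filterlim (\<lambda>t. ln D - p * t) at_bot at_top"
    using p by real_asymp
  then have "((\<lambda>t. exp (ln D - p * t)) \<longlongrightarrow> 0) at_top" by (rule filterlim_compose[OF exp_at_bot])
  then have "U s \<le> 0"
    by (rule tendsto_lowerbound) (auto intro: eventually_mono[OF eventually_ge_at_top[of 0]] le)
  then show False using assms by simp
qed

lemma small_ball_measure:
  assumes "0 < U s" and "0 < \<epsilon>"
  obtains \<rho> where "0 < \<rho>" "measure \<mu> (ball s \<rho>) < \<epsilon>"
proof -
  have "(\<Inter>n. ball s (1 / real (Suc n))) = {s}"
  proof safe
    fix x assume x: "x \<in> (\<Inter>n. ball s (1 / real (Suc n)))"
    show "x = s"
    proof (rule ccontr)
      assume "x \<noteq> s"
      then obtain n where "inverse (real (Suc n)) < dist s x"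
        using reals_Archimedean[of "dist s x"] by auto
      moreover have "dist s x < 1 / real (Suc n)" using x by auto
      ultimately show False by (simp add: inverse_eq_divide)
    qed
  qed auto
  moreover have "(\<lambda>n. measure \<mu> (ball s (1 / real (Suc n)))) \<longlonglongrightarrow> measure \<mu> (\<Inter>n. ball s (1 / real (Suc n)))"
    by (rule finite_Lim_measure_decseq)
       (auto intro!: decseq_SucI subset_ball frac_le simp: sets_eq borel_open)
  ultimately have "(\<lambda>n. measure \<mu> (ball s (1 / real (Suc n)))) \<longlonglongrightarrow> 0"
    using no_atom[OF assms(1)] by simp
  then have "\<forall>\<^sub>F n in sequentially. measure \<mu> (ball s (1 / real (Suc n))) < \<epsilon>"
    using assms(2) by (rule order_tendstoD)
  then obtain n where "measure \<mu> (ball s (1 / real (Suc n))) < \<epsilon>" by (auto simp: eventually_sequentially)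
  then show ?thesis using that[of "1 / real (Suc n)"] by simp
qed

text \<open>
  For \<open>\<zeta>\<close> away from \<open>s\<close> the kernels at \<open>x\<close> and \<open>y\<close> differ little. For \<open>\<zeta>\<close> close to \<open>s\<close> the
  hypothesis bounds the difference by \<open>ln 2\<close>, but such \<open>\<zeta>\<close> have small total measure, since \<open>s\<close> is
  not an atom. This estimate takes the place of lower semicontinuity, which \<open>U\<close> lacks in general.
\<close>

lemma potential_comparison:
  assumes "0 < U s" and "0 < \<epsilon>" and T: "AE \<zeta> in \<mu>. \<zeta> \<in> T"
  obtains \<rho> where "0 < \<rho>"
    "\<And>x y. x \<in> ball s \<rho> \<Longrightarrow> y \<in> ball s \<rho> \<Longrightarrow> (\<And>\<zeta>. \<zeta> \<in> T \<Longrightarrow> dist y \<zeta> \<le> 2 * dist x \<zeta>) \<Longrightarrow>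
       (1 - \<epsilon>) * U y \<le> U x"
proof -
  define \<eta> where "\<eta> = min (1/2) (\<epsilon> / 2)"
  have \<eta>: "0 < \<eta>" "\<eta> \<le> 1/2" "2 * \<eta> \<le> \<epsilon>" unfolding \<eta>_def using assms(2) by auto
  obtain \<rho>0 where \<rho>0: "0 < \<rho>0" "measure \<mu> (ball s \<rho>0) < \<eta>"
    using small_ball_measure[OF assms(1) \<eta>(1)] by blast
  \<comment> \<open>Two points of the ball of radius \<open>\<rho>\<close> differ by at most \<open>\<eta>\<close> times half the radius of the ball
    of small measure, and they keep at least that half radius away from its complement.\<close>
  define \<rho> where "\<rho> = \<eta> * \<rho>0 / 4"
  have \<rho>: "0 < \<rho>" "\<rho> \<le> \<rho>0 / 8" using \<eta> \<rho>0 unfolding \<rho>_def by auto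
  have "(1 - \<epsilon>) * U y \<le> U x"
    if x: "x \<in> ball s \<rho>" and y: "y \<in> ball s \<rho>"
      and 2: "\<And>\<zeta>. \<zeta> \<in> T \<Longrightarrow> dist y \<zeta> \<le> 2 * dist x \<zeta>" for x y
  proof (rule exp_neg_potential_greatest[of "\<rho>0 / 4"])
    fix \<delta> assume \<delta>: "0 < \<delta>" "\<delta> \<le> \<rho>0 / 4"
    have pt: "trunc_log (2 * \<delta>) y \<zeta> - \<eta> - indicator (ball s \<rho>0) \<zeta> \<le> trunc_log \<delta> x \<zeta>"
      if "\<zeta> \<in> T" for \<zeta>
    proof (cases "\<zeta> \<in> ball s \<rho>0")
      case True
      have "max (dist y \<zeta>) (2 * \<delta>) \<le> 2 * max (dist x \<zeta>) \<delta>" using 2[OF that] by auto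
      then have "trunc_log (2 * \<delta>) y \<zeta> \<le> ln (2 * max (dist x \<zeta>) \<delta>)"
        unfolding trunc_log_def using \<delta> by (intro ln_mono) auto
      also have "\<dots> = ln 2 + trunc_log \<delta> x \<zeta>"
        unfolding trunc_log_def using \<delta> by (intro ln_mult_pos) auto
      also have "\<dots> \<le> 1 + trunc_log \<delta> x \<zeta>" using ln_le_minus_one[of 2] by simp
      finally show ?thesis using True \<eta> by simp
    next
      case False
      have sx: "dist s x < \<rho>" "dist s y < \<rho>" using x y by auto
      have far: "\<rho>0 \<le> dist s \<zeta>" using False by auto
      have "dist s \<zeta> \<le> dist s x + dist x \<zeta>" "dist s \<zeta> \<le> dist s y + dist y \<zeta>"
        by (rule dist_triangle)+
      then have lo: "\<rho>0 / 2 \<le> dist x \<zeta>" "\<rho>0 / 2 \<le> dist y \<zeta>" using sx far \<rho> by auto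
      have "dist y \<zeta> \<le> dist x \<zeta> + 2 * \<rho>"
        using dist_triangle[of y \<zeta> x] dist_triangle[of y x s] sx by (simp add: dist_commute)
      also have "2 * \<rho> = \<eta> * (\<rho>0 / 2)" unfolding \<rho>_def by simp
      also have "\<eta> * (\<rho>0 / 2) \<le> \<eta> * dist x \<zeta>" using lo \<eta> by (intro mult_left_mono) auto
      finally have "dist y \<zeta> \<le> dist x \<zeta> * (1 + \<eta>)" by (simp add: algebra_simps)
      then have "ln (dist y \<zeta>) \<le> ln (dist x \<zeta> * (1 + \<eta>))"
        using lo \<rho>0 \<eta> by (intro ln_mono) auto
      also have "\<dots> = ln (dist x \<zeta>) + ln (1 + \<eta>)"
        using lo \<rho>0 \<eta> by (intro ln_mult_pos) auto
      also have "\<dots> \<le> ln (dist x \<zeta>) + \<eta>" using ln_add_one_self_le_self[of \<eta>] \<eta> by simp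
      finally have "ln (dist y \<zeta>) \<le> ln (dist x \<zeta>) + \<eta>" .
      moreover have "max (dist y \<zeta>) (2 * \<delta>) = dist y \<zeta>" "max (dist x \<zeta>) \<delta> = dist x \<zeta>"
        using lo \<delta> \<rho>0 by auto
      ultimately show ?thesis using False unfolding trunc_log_def by simp
    qed
    have "trunc_pot (2 * \<delta>) y - \<eta> - measure \<mu> (ball s \<rho>0)
        = (\<integral>\<zeta>. trunc_log (2 * \<delta>) y \<zeta> - \<eta> - indicator (ball s \<rho>0) \<zeta> \<partial>\<mu>)"
      unfolding trunc_pot_def using \<delta> prob_space
      by (subst Bochner_Integration.integral_diff Bochner_Integration.integral_diff)+
        (auto simp: sets_eq borel_open)
    also have "\<dots> \<le> trunc_pot \<delta> x"
      unfolding trunc_pot_def using T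
      by (intro integral_mono_AE) (use \<delta> pt in \<open>auto simp: sets_eq borel_open elim: eventually_mono\<close>)
    finally have "trunc_pot (2 * \<delta>) y - 2 * \<eta> \<le> trunc_pot \<delta> x" using \<rho>0 by simp
    then have "exp (trunc_pot (2 * \<delta>) y - 2 * \<eta>) \<le> exp (trunc_pot \<delta> x)" by simp
    moreover have "(1 - \<epsilon>) * U y \<le> exp (- 2 * \<eta>) * exp (trunc_pot (2 * \<delta>) y)"
    proof (rule mult_mono)
      show "1 - \<epsilon> \<le> exp (- 2 * \<eta>)" using exp_ge_add_one_self[of "- 2 * \<eta>"] \<eta> by simp
      show "U y \<le> exp (trunc_pot (2 * \<delta>) y)" using exp_neg_potential_le \<delta> by simp
    qed (auto simp: exp_neg_potential_nonneg)
    moreover have "exp (trunc_pot (2 * \<delta>) y - 2 * \<eta>) = exp (- 2 * \<eta>) * exp (trunc_pot (2 * \<delta>) y)"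
      unfolding exp_add[symmetric] by simp
    ultimately show "(1 - \<epsilon>) * U y \<le> exp (trunc_pot \<delta> x)" by simp
  qed (use \<rho>0 in auto)
  then show ?thesis using that \<rho>(1) by blast
qed

text \<open>
  Off the carrier of \<open>\<mu>\<close>, moving \<open>x\<close> changes all distances \<open>dist x \<zeta>\<close> by a factor close to \<open>1\<close>.
\<close>

lemma exp_neg_potential_near:
  assumes "0 < d" and x: "AE \<zeta> in \<mu>. d \<le> dist x \<zeta>" and "dist x y < d"
  shows "(1 - dist x y / d) * U x \<le> U y"
proof -
  define \<eta> where "\<eta> = dist x y / d"
  have \<eta>: "0 \<le> \<eta>" "\<eta> < 1" "dist x y = \<eta> * d" using assms unfolding \<eta>_def by auto
  have y: "AE \<zeta> in \<mu>. d - dist x y \<le> dist y \<zeta>"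
    using x
  proof eventually_elim
    case (elim \<zeta>)
    then show ?case using dist_triangle[of x \<zeta> y] by simp
  qed
  have dy: "0 < d - dist x y" using assms by simp
  have "ln (1 - \<eta>) + log_pot x = (\<integral>\<zeta>. ln (1 - \<eta>) + ln (dist x \<zeta>) \<partial>\<mu>)"
    unfolding log_pot_def using prob_space integrable_log_dist[OF assms(1) x] by simp
  also have "\<dots> \<le> log_pot y"
    unfolding log_pot_def
  proof (rule integral_mono_AE)
    show "AE \<zeta> in \<mu>. ln (1 - \<eta>) + ln (dist x \<zeta>) \<le> ln (dist y \<zeta>)"
      using x
    proof eventually_elim
      case (elim \<zeta>)
      have "\<eta> * d \<le> \<eta> * dist x \<zeta>" using elim \<eta> by (intro mult_left_mono) auto
      then have "(1 - \<eta>) * dist x \<zeta> \<le> dist y \<zeta>"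
        using dist_triangle[of x \<zeta> y] \<eta> by (simp add: algebra_simps)
      then have "ln ((1 - \<eta>) * dist x \<zeta>) \<le> ln (dist y \<zeta>)"
        using elim assms(1) \<eta> by (intro ln_mono) (auto intro!: mult_pos_pos)
      moreover have "ln ((1 - \<eta>) * dist x \<zeta>) = ln (1 - \<eta>) + ln (dist x \<zeta>)"
        using elim assms(1) \<eta> by (intro ln_mult_pos) auto
      ultimately show ?case by simp
    qed
  qed (use integrable_log_dist[OF assms(1) x] integrable_log_dist[OF dy y] in auto)
  finally have "exp (ln (1 - \<eta>) + log_pot x) \<le> exp (log_pot y)" by simp
  moreover have "exp (ln (1 - \<eta>) + log_pot x) = (1 - \<eta>) * exp (log_pot x)"
    using \<eta>(2) by (simp add: exp_add)
  ultimately show ?thesis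
    unfolding exp_neg_potential_eq[OF assms(1) x] exp_neg_potential_eq[OF dy y] \<eta>_def by simp
qed

lemma isCont_exp_neg_potential:
  assumes "0 < d" and "AE \<zeta> in \<mu>. d \<le> dist x \<zeta>"
  shows "isCont U x"
  unfolding isCont_def
proof (rule order_tendstoI)
  fix a assume "U x < a"
  then have "\<forall>\<^sub>F y in nhds x. U y < a"
    using open_level_set[of a] by (auto simp: eventually_nhds)
  then show "\<forall>\<^sub>F y in at x. U y < a" by (simp add: eventually_nhds_conv_at)
next
  fix a assume a: "a < U x"
  have "((\<lambda>y. (1 - dist x y / d) * U x) \<longlongrightarrow> (1 - dist x x / d) * U x) (at x)"
    using assms(1) by (intro tendsto_intros) auto
  then have "((\<lambda>y. (1 - dist x y / d) * U x) \<longlongrightarrow> U x) (at x)" by simp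
  then have "\<forall>\<^sub>F y in at x. a < (1 - dist x y / d) * U x" using a by (rule order_tendstoD)
  moreover have "\<forall>\<^sub>F y in at x. dist x y < d"
    unfolding eventually_at using assms(1) by (intro exI[of _ d]) (simp add: dist_commute)
  ultimately show "\<forall>\<^sub>F y in at x. a < U y"
    by eventually_elim (use exp_neg_potential_near[OF assms] in \<open>auto intro: less_le_trans\<close>)
qed

text \<open>
  Averaging the kernel over the \<open>N\<close> points \<open>x0 + \<xi>\<close> with \<open>\<xi>\<^sup>N = t\<^sup>N\<close> turns the product of the distances
  into \<open>\<bar>(\<zeta> - x0)\<^sup>N - t\<^sup>N\<bar>\<close>; hence the sum of the values at these points exceeds \<open>N\<close> times the value at the
  centre by at most \<open>q\<^sup>N\<close> with \<open>q < 1\<close>. As no value is below that at the centre, each single one, in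
  particular the one at \<open>x0 + t\<close>, exceeds it by at most \<open>q\<^sup>N\<close>. Letting \<open>N\<close> grow gives equality.
  The argument works because the mean excess \<open>q\<^sup>N / N\<close> decays faster than the weight \<open>1 / N\<close> of a
  single point.
\<close>

lemma minimum_principle_local:
  assumes d: "0 < d" and x0: "AE \<zeta> in \<mu>. d \<le> dist x0 \<zeta>"
    and min: "\<And>y. dist x0 y < d \<Longrightarrow> U x0 \<le> U y" and y: "dist x0 y < d"
  shows "U y = U x0"
proof (cases "y = x0")
  case False
  define t where "t = y - x0"
  have t: "t \<noteq> 0" "cmod t < d" 
  proof -
    have "cmod t = dist x0 y" unfolding t_def by (metis dist_commute dist_norm)
    then show "cmod t < d" using y by simp
    show "t \<noteq> 0" using False unfolding t_def by simp
  qed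
  define q where "q = cmod t / d"
  have q: "0 < q" "q < 1" using t d unfolding q_def by auto
  have near: "AE \<zeta> in \<mu>. d - cmod t \<le> dist (x0 + \<xi>) \<zeta>" if "cmod \<xi> = cmod t" for \<xi>
    using x0
  proof eventually_elim
    case (elim \<zeta>)
    then show ?case using dist_triangle[of x0 \<zeta> "x0 + \<xi>"] that by (simp add: dist_norm)
  qed
  have dt: "0 < d - cmod t" using t by simp
  have ge: "log_pot x0 \<le> log_pot (x0 + \<xi>)" if "cmod \<xi> = cmod t" for \<xi>
    using min[of "x0 + \<xi>"] that t exp_neg_potential_eq[OF d x0] exp_neg_potential_eq[OF dt near[OF that]]
    by (simp add: dist_norm)
  have bound: "log_pot y - log_pot x0 \<le> q ^ N" if N: "0 < N" for N
  proof -
    define Z where "Z = {\<xi>. \<xi> ^ N = t ^ N}"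
    have finZ: "finite Z" unfolding Z_def by (rule finite_nth_roots[OF N])
    have cardZ: "card Z = N" unfolding Z_def using card_nth_roots[of "t ^ N" N] N t by simp
    have normZ: "cmod \<xi> = cmod t" if "\<xi> \<in> Z" for \<xi>
    proof -
      have "cmod (\<xi> ^ N) = cmod (t ^ N)" using that unfolding Z_def by simp
      then have "cmod \<xi> ^ N = cmod t ^ N" by (simp only: norm_power)
      then show ?thesis using N by (intro power_eq_imp_eq_base[of "cmod \<xi>" N "cmod t"]) auto
    qed
    have tZ: "t \<in> Z" unfolding Z_def by simp
    have "(\<Sum>\<xi>\<in>Z. log_pot (x0 + \<xi>)) = (\<integral>\<zeta>. (\<Sum>\<xi>\<in>Z. ln (dist (x0 + \<xi>) \<zeta>)) \<partial>\<mu>)"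
      unfolding log_pot_def using integrable_log_dist[OF dt near[OF normZ]]
      by (subst Bochner_Integration.integral_sum) auto
    also have "\<dots> \<le> (\<integral>\<zeta>. real N * ln (dist x0 \<zeta>) + q ^ N \<partial>\<mu>)"
    proof (rule integral_mono_AE)
      show "AE \<zeta> in \<mu>. (\<Sum>\<xi>\<in>Z. ln (dist (x0 + \<xi>) \<zeta>)) \<le> real N * ln (dist x0 \<zeta>) + q ^ N"
        using x0
      proof eventually_elim
        case (elim \<zeta>)
        have pos: "0 < dist (x0 + \<xi>) \<zeta>" if "\<xi> \<in> Z" for \<xi>
        proof -
          have "dist x0 (x0 + \<xi>) = cmod t" using normZ[OF that] by (simp add: dist_norm)
          then show ?thesis using elim t(2) dist_triangle[of x0 \<zeta> "x0 + \<xi>"] by linarith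
        qed
        have x0p: "0 < dist x0 \<zeta>" using elim d by linarith
        have "(\<Sum>\<xi>\<in>Z. ln (dist (x0 + \<xi>) \<zeta>)) = ln (\<Prod>\<xi>\<in>Z. dist (x0 + \<xi>) \<zeta>)"
          using pos finZ by (subst ln_prod) auto
        also have "(\<Prod>\<xi>\<in>Z. dist (x0 + \<xi>) \<zeta>) = (\<Prod>\<xi>\<in>Z. cmod ((\<zeta> - x0) - \<xi>))"
          by (intro prod.cong refl) (simp add: dist_norm norm_minus_commute algebra_simps)
        also have "\<dots> = cmod ((\<zeta> - x0) ^ N - t ^ N)"
          unfolding prod_norm Z_def nth_roots_factorization[OF N t(1)] ..
        also have "ln \<dots> \<le> ln (dist x0 \<zeta> ^ N * (1 + q ^ N))"
        proof (rule ln_mono)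
          have "cmod ((\<zeta> - x0) ^ N - t ^ N) = (\<Prod>\<xi>\<in>Z. dist (x0 + \<xi>) \<zeta>)"
            unfolding Z_def nth_roots_factorization[OF N t(1), symmetric] prod_norm[symmetric]
            by (intro prod.cong refl) (simp add: dist_norm norm_minus_commute algebra_simps)
          also have "\<dots> > 0" using pos by (intro prod_pos) auto
          finally show "0 < cmod ((\<zeta> - x0) ^ N - t ^ N)" .
          have "cmod ((\<zeta> - x0) ^ N - t ^ N) \<le> dist x0 \<zeta> ^ N + cmod t ^ N"
            using norm_triangle_ineq4[of "(\<zeta> - x0) ^ N" "t ^ N"]
            by (simp add: norm_power dist_norm norm_minus_commute)
          also have "cmod t ^ N \<le> dist x0 \<zeta> ^ N * q ^ N"
          proof -
            have "cmod t = d * q" using d unfolding q_def by simp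
            also have "d * q \<le> dist x0 \<zeta> * q" using elim q by (intro mult_right_mono) auto
            finally have "cmod t ^ N \<le> (dist x0 \<zeta> * q) ^ N" by (intro power_mono) auto
            then show ?thesis by (simp add: power_mult_distrib)
          qed
          finally show "cmod ((\<zeta> - x0) ^ N - t ^ N) \<le> dist x0 \<zeta> ^ N * (1 + q ^ N)"
            by (simp add: algebra_simps)
        qed
        also have "\<dots> = real N * ln (dist x0 \<zeta>) + ln (1 + q ^ N)"
        proof -
          have "0 < 1 + q ^ N" using q by (simp add: add_pos_pos)
          then show ?thesis using x0p by (subst ln_mult_pos) (auto simp: ln_realpow)
        qed
        also have "\<dots> \<le> real N * ln (dist x0 \<zeta>) + q ^ N"
          using ln_add_one_self_le_self[of "q ^ N"] q by simp
        finally show ?case .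
      qed
    qed (use integrable_log_dist[OF dt near[OF normZ]] integrable_log_dist[OF d x0] in auto)
    also have "\<dots> = real N * log_pot x0 + q ^ N"
      unfolding log_pot_def using prob_space integrable_log_dist[OF d x0] by simp
    finally have 1: "(\<Sum>\<xi>\<in>Z. log_pot (x0 + \<xi>)) \<le> real N * log_pot x0 + q ^ N" .
    have "log_pot (x0 + t) - log_pot x0 \<le> (\<Sum>\<xi>\<in>Z. log_pot (x0 + \<xi>) - log_pot x0)"
    proof (rule member_le_sum[OF tZ _ finZ])
      fix \<xi> assume "\<xi> \<in> Z - {t}"
      then show "0 \<le> log_pot (x0 + \<xi>) - log_pot x0" using ge[OF normZ[of \<xi>]] by simp
    qed
    also have "\<dots> \<le> q ^ N" using 1 cardZ by (simp add: sum_subtractf)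
    finally show ?thesis unfolding t_def by simp
  qed
  have "(\<lambda>N. q ^ Suc N) \<longlonglongrightarrow> 0" using q by (intro LIMSEQ_Suc LIMSEQ_power_zero) auto
  then have "log_pot y - log_pot x0 \<le> 0"
    by (rule LIMSEQ_le_const) (use bound in blast)
  moreover have "AE \<zeta> in \<mu>. d - cmod t \<le> dist y \<zeta>" using near[of t] unfolding t_def by simp
  ultimately have "U y \<le> U x0"
    using exp_neg_potential_eq[OF d x0] exp_neg_potential_eq[OF dt, of y] by simp
  then show ?thesis using min[OF y] by simp
qed simp

end

section \<open>Boundary behaviour and minimum principles\<close>

context compactly_supported_prob
begin

lemma AE_dist_ge:
  assumes "closed T" "AE \<zeta> in \<mu>. \<zeta> \<in> T" "x \<notin> T"
  obtains d where "0 < d" "AE \<zeta> in \<mu>. d \<le> dist x \<zeta>"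
proof -
  have "open (- T)" "x \<in> - T" using assms(1,3) by (auto simp: open_Compl)
  then obtain d where d: "0 < d" "ball x d \<subseteq> - T" using openE by blast
  have "AE \<zeta> in \<mu>. d \<le> dist x \<zeta>"
    using assms(2) by eventually_elim (use d(2) in \<open>auto simp: not_less[symmetric]\<close>)
  then show ?thesis using that d(1) by blast
qed

lemma carrier_nonempty:
  assumes "AE \<zeta> in \<mu>. \<zeta> \<in> T"
  shows "T \<noteq> {}"
  using assms AE_False by auto

text \<open>
  Suppose \<open>l\<close> were on the frontier of \<open>G\<close>. A point \<open>y\<close> of \<open>G\<close> near \<open>l\<close> has a frontier point \<open>b\<close> that is
  no farther from \<open>y\<close> than the carrier \<open>T\<close> is: either \<open>l\<close> itself, or the point at which the segment
  to the nearest point of \<open>T\<close> leaves \<open>G\<close>. Then \<open>dist b \<zeta> \<le> 2 dist y \<zeta>\<close> on \<open>T\<close>, and the comparison of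
  potentials gives \<open>U y\<close> almost the value \<open>U b \<ge> c\<close>. So values tending to \<open>i < c\<close> cannot lead to
  the frontier.
\<close>

lemma limit_of_low_values:
  assumes T: "closed T" "AE \<zeta> in \<mu>. \<zeta> \<in> T"
    and G: "open G" "G \<inter> T = {}"
    and e: "0 < e" and front: "\<And>y. y \<in> frontier G \<Longrightarrow> dist l y < e \<Longrightarrow> c \<le> U y"
    and x: "\<And>n. x n \<in> G" "x \<longlonglongrightarrow> l" and Ux: "(\<lambda>n. U (x n)) \<longlonglongrightarrow> i" and "i < c"
  shows "l \<in> G \<and> U l = i"
proof -
  have i0: "0 \<le> i" by (rule LIMSEQ_le_const[OF Ux]) (auto simp: exp_neg_potential_nonneg)
  have lG: "l \<in> G"
  proof (rule ccontr)
    assume "l \<notin> G"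
    moreover have "l \<in> closure G" using x closure_sequential by blast
    ultimately have lf: "l \<in> frontier G" using G(1) by (simp add: frontier_def interior_open)
    have Ul: "c \<le> U l" using front[OF lf] e by simp
    define \<epsilon> where "\<epsilon> = (c - i) / (2 * c)"
    have c0: "0 < c" using i0 assms by simp
    have \<epsilon>: "0 < \<epsilon>" "\<epsilon> \<le> 1 / 2" using c0 i0 assms(10) unfolding \<epsilon>_def by (auto simp: field_simps)
    have "(1 - \<epsilon>) * c = (c + i) / 2" using c0 unfolding \<epsilon>_def by (simp add: field_simps)
    then have ic: "i < (1 - \<epsilon>) * c" using assms(10) by simp
    have "0 < U l" using Ul c0 by simp
    then obtain \<rho> where \<rho>: "0 < \<rho>"
      "\<And>x y. x \<in> ball l \<rho> \<Longrightarrow> y \<in> ball l \<rho> \<Longrightarrow> (\<And>\<zeta>. \<zeta> \<in> T \<Longrightarrow> dist y \<zeta> \<le> 2 * dist x \<zeta>) \<Longrightarrow>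
         (1 - \<epsilon>) * U y \<le> U x"
      using potential_comparison[OF _ \<epsilon>(1) T(2)] by blast
    define r where "r = min e \<rho> / 2"
    have r: "0 < r" "2 * r \<le> e" "2 * r \<le> \<rho>" using e \<rho>(1) unfolding r_def by auto
    have low: "(1 - \<epsilon>) * c \<le> U y" if y: "y \<in> G" "dist l y < r" for y
    proof -
      obtain a where a: "a \<in> T" "\<And>\<zeta>. \<zeta> \<in> T \<Longrightarrow> dist y a \<le> dist y \<zeta>"
        using distance_attains_inf[OF T(1) carrier_nonempty[OF T(2)], of y] by blast
      have "\<exists>b. b \<in> frontier G \<and> dist y b \<le> dist y a \<and> dist y b \<le> dist l y"
      proof (cases "dist l y \<le> dist y a")
        case True
        then show ?thesis using lf by (intro exI[of _ l]) (simp add: dist_commute)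
      next
        case False
        have "closed_segment y a \<inter> frontier G \<noteq> {}"
          using y a(1) G(2) by (intro connected_Int_frontier) auto
        then obtain b where "b \<in> closed_segment y a" "b \<in> frontier G" by blast
        then show ?thesis using False dist_in_closed_segment[of b y a]
          by (intro exI[of _ b]) (auto simp: dist_commute)
      qed
      then obtain b where b: "b \<in> frontier G" "dist y b \<le> dist y a" "dist y b \<le> dist l y" by blast
      have "dist l b \<le> dist l y + dist y b" by (rule dist_triangle)
      then have lb: "dist l b < 2 * r" using b y by simp
      have "(1 - \<epsilon>) * U b \<le> U y"
      proof (rule \<rho>(2))
        fix \<zeta> assume "\<zeta> \<in> T"
        then show "dist b \<zeta> \<le> 2 * dist y \<zeta>"
          using a(2)[of \<zeta>] b(2) dist_triangle[of b \<zeta> y] by (simp add: dist_commute)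
      qed (use lb r y in auto)
      moreover have "(1 - \<epsilon>) * c \<le> (1 - \<epsilon>) * U b"
        using front[OF b(1)] lb r \<epsilon> by (intro mult_left_mono) auto
      ultimately show ?thesis by simp
    qed
    have "\<forall>\<^sub>F n in sequentially. dist l (x n) < r"
      using tendstoD[OF x(2) r(1)] by (simp add: dist_commute)
    then have "\<forall>\<^sub>F n in sequentially. (1 - \<epsilon>) * c \<le> U (x n)"
      by eventually_elim (use low x in blast)
    then have "(1 - \<epsilon>) * c \<le> i" by (intro tendsto_lowerbound[OF Ux]) auto
    then show False using ic by simp
  qed
  then have "l \<notin> T" using G(2) by blast
  then obtain d where "0 < d" "AE \<zeta> in \<mu>. d \<le> dist l \<zeta>" using AE_dist_ge[OF T] by blast
  then have "isCont U l" by (rule isCont_exp_neg_potential)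
  then have "(\<lambda>n. U (x n)) \<longlonglongrightarrow> U l" using x(2) by (rule isCont_tendsto_compose)
  then show ?thesis using lG Ux LIMSEQ_unique by blast
qed

text \<open>
  The points where a minimum over \<open>G\<close> is attained form an open set by the local minimum principle,
  and they cannot accumulate at a frontier point that carries a larger value.
\<close>

lemma minimum_set_clopen:
  assumes T: "closed T" "AE \<zeta> in \<mu>. \<zeta> \<in> T"
    and G: "open G" "G \<inter> T = {}"
    and W: "open W" and front: "\<forall>y\<in>frontier G \<inter> W. c \<le> U y"
    and low: "\<forall>x\<in>G. i \<le> U x" and "i < c"
  shows "open {x\<in>G. U x = i}"
    and "\<And>x. x \<in> W \<Longrightarrow> x \<in> closure {x\<in>G. U x = i} \<Longrightarrow> x \<in> G \<and> U x = i"
proof -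
  show "open {x\<in>G. U x = i}"
    unfolding open_contains_ball
  proof
    fix x assume x: "x \<in> {x\<in>G. U x = i}"
    then have "x \<notin> T" using G(2) by blast
    then obtain d where d: "0 < d" "AE \<zeta> in \<mu>. d \<le> dist x \<zeta>" using AE_dist_ge[OF T] by blast
    obtain e where e: "0 < e" "ball x e \<subseteq> G" using G(1) x open_contains_ball by blast
    have min0: "0 < min d e" using d(1) e(1) by simp
    have inG: "y \<in> G" if "dist x y < min d e" for y using that e(2) by auto
    have "U y = U x" if "dist x y < min d e" for y
    proof (rule minimum_principle_local[OF min0 _ _ that])
      show "AE \<zeta> in \<mu>. min d e \<le> dist x \<zeta>" using d(2) by eventually_elim simp
      show "U x \<le> U y" if "dist x y < min d e" for y
        using inG[OF that] low x by simp
    qed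
    then have "ball x (min d e) \<subseteq> {x\<in>G. U x = i}" using inG x by auto
    then show "\<exists>e>0. ball x e \<subseteq> {x\<in>G. U x = i}" using min0 by blast
  qed
  fix l assume l: "l \<in> W" "l \<in> closure {x\<in>G. U x = i}"
  obtain e where e: "0 < e" "ball l e \<subseteq> W" using W l(1) open_contains_ball by blast
  obtain x where x: "\<And>n. x n \<in> {x\<in>G. U x = i}" "x \<longlonglongrightarrow> l"
    using l(2) closure_sequential by blast
  show "l \<in> G \<and> U l = i"
  proof (rule limit_of_low_values[OF T G e(1) _ _ x(2) _ \<open>i < c\<close>])
    fix y assume y: "y \<in> frontier G" "dist l y < e"
    then have "y \<in> W" using e(2) by auto
    then show "c \<le> U y" using front y(1) by blast
  next
    fix n
    show "x n \<in> G" using x(1)[of n] by simp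
  next
    have "(\<lambda>n. U (x n)) = (\<lambda>n. i)" using x(1) by auto
    then show "(\<lambda>n. U (x n)) \<longlonglongrightarrow> i" by simp
  qed
qed

text \<open>
  If \<open>G\<close> missed the carrier, the infimum of \<open>U\<close> over \<open>G\<close> would be attained inside \<open>G\<close>, on a
  set that is bounded, open and closed in the plane.
\<close>

lemma low_open_set_meets_carrier:
  assumes T: "closed T" "AE \<zeta> in \<mu>. \<zeta> \<in> T"
    and G: "open G" "G \<noteq> {}"
    and low: "\<And>x. x \<in> G \<Longrightarrow> U x < c" and front: "\<And>y. y \<in> frontier G \<Longrightarrow> c \<le> U y"
  shows "G \<inter> T \<noteq> {}"
proof
  assume GT: "G \<inter> T = {}"
  define i where "i = Inf (U ` G)"
  have bdd: "bdd_below (U ` G)" by (rule bdd_belowI2[of _ 0]) (rule exp_neg_potential_nonneg)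
  have il: "i \<le> U x" if "x \<in> G" for x unfolding i_def using bdd that by (auto intro: cInf_lower)
  have "\<exists>x\<in>G. U x < i + 1 / real (Suc n)" for n
  proof -
    have "Inf (U ` G) < i + 1 / real (Suc n)" unfolding i_def by simp
    then show ?thesis using cInf_lessD[of "U ` G"] G(2) by blast
  qed
  then obtain x where x: "\<And>n. x n \<in> G" "\<And>n. U (x n) < i + 1 / real (Suc n)" by metis
  have Ux: "(\<lambda>n. U (x n)) \<longlonglongrightarrow> i"
  proof (rule tendsto_sandwich[where f = "\<lambda>_. i" and h = "\<lambda>n. i + 1 / real (Suc n)"])
    show "(\<lambda>n. i + 1 / real (Suc n)) \<longlonglongrightarrow> i"
      using tendsto_add[OF tendsto_const LIMSEQ_Suc[OF lim_1_over_n], of i] by simp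
  qed (use x il in \<open>auto intro!: always_eventually less_imp_le\<close>)
  have bG: "bounded G" by (rule bounded_subset[OF bounded_level_set[of c]]) (use low in blast)
  then have "bounded (range x)" by (rule bounded_subset) (use x(1) in blast)
  then obtain l r where r: "strict_mono (r :: nat \<Rightarrow> nat)" "(x \<circ> r) \<longlonglongrightarrow> l"
    using bounded_imp_convergent_subsequence by blast
  obtain x0 where "x0 \<in> G" using G(2) by blast
  then have ic: "i < c" using il low by (meson le_less_trans)
  have l: "l \<in> G \<and> U l = i"
  proof (rule limit_of_low_values[OF T G(1) GT zero_less_one _ _ r(2) _ ic])
    show "(\<lambda>n. U ((x \<circ> r) n)) \<longlonglongrightarrow> i"
      using LIMSEQ_subseq_LIMSEQ[OF Ux r(1)] by (simp add: o_def)
  qed (use x front in auto)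
  define Z where "Z = {x\<in>G. U x = i}"
  have front': "\<forall>y\<in>frontier G \<inter> UNIV. c \<le> U y" and il': "\<forall>x\<in>G. i \<le> U x" using front il by auto
  note clopenZ = minimum_set_clopen[OF T G(1) GT open_UNIV front' il' ic]
  have Z: "open Z" unfolding Z_def by (rule clopenZ(1))
  have "closure Z \<subseteq> Z"
  proof
    fix x assume "x \<in> closure Z"
    then show "x \<in> Z" using clopenZ(2)[OF UNIV_I, of x] unfolding Z_def by simp
  qed
  then have "closed Z" by (metis closure_subset_eq)
  then have "Z = {} \<or> Z = UNIV" using Z clopen by blast
  moreover have "Z \<noteq> {}" using l unfolding Z_def by blast
  moreover have "bounded Z" by (rule bounded_subset[OF bG]) (auto simp: Z_def)
  ultimately show False using not_bounded_UNIV by blast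
qed

text \<open>
  The maximum principle of Maria for potentials, in the form that \<open>P\<close> nowhere exceeds its supremum
  on \<open>S\<close>. It makes the hypotheses on \<open>z\<close> place \<open>R\<close> above \<open>r_zero S \<mu>\<close>.
\<close>

lemma r_zero_le_exp_neg_potential: "r_zero S \<mu> \<le> U x"
proof (rule ccontr)
  assume below: "\<not> r_zero S \<mu> \<le> U x"
  define G where "G = {x. U x < r_zero S \<mu>}"
  have oG: "open G" unfolding G_def by (rule open_level_set)
  have xG: "x \<in> G" using below unfolding G_def by simp
  have "G \<inter> S \<noteq> {}"
  proof (rule low_open_set_meets_carrier[OF compact_imp_closed[OF compact_S] AE_in_S oG, where c = "r_zero S \<mu>"])
    show "G \<noteq> {}" using xG by blast
    fix y assume "y \<in> frontier G"
    then have "y \<notin> G" using oG by (simp add: frontier_def interior_open)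
    then show "r_zero S \<mu> \<le> U y" unfolding G_def by simp
  next
    fix y assume "y \<in> G"
    then show "U y < r_zero S \<mu>" unfolding G_def by simp
  qed
  then obtain s where s: "s \<in> S" "s \<in> G" by blast
  have "r_zero S \<mu> \<le> U s"
    unfolding r_zero_def by (rule cINF_lower[OF bdd_belowI2[of _ 0] s(1)]) (rule exp_neg_potential_nonneg)
  then show False using s(2) unfolding G_def by simp
qed

lemma exp_neg_potential_pos:
  assumes "z \<notin> S"
  shows "0 < U z"
proof -
  obtain d where d: "0 < d" "AE \<zeta> in \<mu>. d \<le> dist z \<zeta>"
    using AE_dist_ge[OF compact_imp_closed[OF compact_S] AE_in_S assms] by blast
  then show ?thesis using exp_neg_potential_ge_dist by fastforce
qed

definition support :: "complex set" where
  "support = - \<Union>{G. open G \<and> emeasure \<mu> G = 0}"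

lemma closed_support: "closed support"
proof -
  have "open (\<Union>{G. open G \<and> emeasure \<mu> G = 0})" by (rule open_Union) blast
  then show ?thesis unfolding support_def by (rule closed_Compl)
qed

lemma AE_in_support: "AE \<zeta> in \<mu>. \<zeta> \<in> support"
proof -
  obtain F where F: "F \<subseteq> {G. open G \<and> emeasure \<mu> G = 0}" "countable F"
    "\<Union>F = \<Union>{G. open G \<and> emeasure \<mu> G = 0}"
    using Lindelof[of "{G. open G \<and> emeasure \<mu> G = 0}"] by blast
  have "(\<Union>G\<in>F. G) \<in> null_sets \<mu>"
    by (rule null_sets_UN') (use F in \<open>auto simp: null_sets_def sets_eq borel_open\<close>)
  then have "- support \<in> null_sets \<mu>" unfolding support_def F(3)[symmetric] by simp
  then show ?thesis by (rule AE_I') auto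
qed

lemma support_emeasure_pos:
  assumes "s \<in> support" "open G" "s \<in> G"
  shows "0 < emeasure \<mu> G"
proof (rule ccontr)
  assume "\<not> 0 < emeasure \<mu> G"
  then have "emeasure \<mu> G = 0" by (simp add: not_gr_zero)
  then have "G \<in> {G. open G \<and> emeasure \<mu> G = 0}" using assms(2) by simp
  then show False using assms(1,3) unfolding support_def by blast
qed

lemma support_subset: "support \<subseteq> S"
proof -
  have "- S \<in> {G. open G \<and> emeasure \<mu> G = 0}"
    using null_off_S compact_S compact_imp_closed by (auto simp: open_Compl)
  then show ?thesis unfolding support_def by blast
qed

end

section \<open>The potential is not locally constant off the carrier\<close>

lemma ln_norm_one_plus_ge:
  fixes w :: complex
  assumes "cmod w \<le> 1 / 2"
  shows "Re w - 2 * (cmod w)\<^sup>2 \<le> ln (cmod (1 + w))"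
proof -
  have r: "\<bar>Re w\<bar> \<le> 1 / 2" using abs_Re_le_cmod[of w] assms by simp
  have "Re w - 2 * (cmod w)\<^sup>2 \<le> Re w - 2 * (Re w)\<^sup>2"
    using power_mono[OF abs_Re_le_cmod[of w], of 2] by simp
  also have "\<dots> \<le> ln (1 + Re w)"
    using abs_ln_one_plus_x_minus_x_bound[OF r] by simp
  also have "\<dots> \<le> ln (cmod (1 + w))"
    using r complex_Re_le_cmod[of "1 + w"] by (intro ln_mono) auto
  finally show ?thesis .
qed

lemma difference_quotient_inverse_bound:
  fixes a h :: complex
  assumes "h \<noteq> 0" and "0 < d" and a: "d \<le> cmod a" "d / 2 \<le> cmod (a + h)"
  shows "cmod ((1 / (a + h) - 1 / a) / h - (- (1 / a\<^sup>2))) \<le> 2 / d ^ 3 * cmod h"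
proof -
  have nz: "a \<noteq> 0" "a + h \<noteq> 0"
  proof -
    have "0 < cmod a" "0 < cmod (a + h)" using a assms(2) by linarith+
    then show "a \<noteq> 0" "a + h \<noteq> 0" by simp_all
  qed
  have "(1 / (a + h) - 1 / a) / h = - (1 / (a * (a + h)))"
    using assms(1) nz by (simp add: diff_frac_eq mult.commute)
  also have "1 / (a * (a + h)) = a / (a\<^sup>2 * (a + h))" using nz by (simp add: power2_eq_square)
  finally have e1: "(1 / (a + h) - 1 / a) / h = - (a / (a\<^sup>2 * (a + h)))" .
  have e2: "1 / a\<^sup>2 = (a + h) / (a\<^sup>2 * (a + h))" using nz by simp
  have "(1 / (a + h) - 1 / a) / h - (- (1 / a\<^sup>2)) = (a + h) / (a\<^sup>2 * (a + h)) - a / (a\<^sup>2 * (a + h))"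
    unfolding e1 e2 by simp
  also have "\<dots> = h / (a\<^sup>2 * (a + h))"
    by (simp only: diff_divide_distrib[symmetric]) simp
  finally have eq: "(1 / (a + h) - 1 / a) / h - (- (1 / a\<^sup>2)) = h / (a\<^sup>2 * (a + h))" .
  have "cmod (h / (a\<^sup>2 * (a + h))) = cmod h / (cmod a ^ 2 * cmod (a + h))"
    by (simp add: norm_divide norm_mult norm_power)
  also have "\<dots> \<le> cmod h / (d ^ 2 * (d / 2))"
    using a assms(2) by (intro divide_left_mono mult_mono power_mono mult_pos_pos) auto
  also have "\<dots> = 2 / d ^ 3 * cmod h" by (simp add: power3_eq_cube power2_eq_square)
  finally show ?thesis unfolding eq .
qed

context compactly_supported_prob
begin

text \<open>
  Up to conjugation this is the gradient of \<open>log_pot\<close>.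
\<close>

definition cauchy_transform :: "complex \<Rightarrow> complex" where
  "cauchy_transform x = (\<integral>\<zeta>. 1 / (x - \<zeta>) \<partial>\<mu>)"

lemma integrable_cauchy_kernel:
  assumes "0 < d" "AE \<zeta> in \<mu>. d \<le> dist x \<zeta>"
  shows "integrable \<mu> (\<lambda>\<zeta>. 1 / (x - \<zeta>) ^ k)"
proof (rule integrable_const_bound[where B = "1 / d ^ k"])
  show "AE \<zeta> in \<mu>. cmod (1 / (x - \<zeta>) ^ k) \<le> 1 / d ^ k"
    using assms(2)
  proof eventually_elim
    case (elim \<zeta>)
    then have "0 < cmod (x - \<zeta>)" "d \<le> cmod (x - \<zeta>)" using assms(1) by (auto simp: dist_norm)
    then show ?case using assms(1)
      by (auto simp: norm_divide norm_power intro!: divide_left_mono power_mono mult_pos_pos zero_less_power)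
  qed
next
  show "(\<lambda>\<zeta>. 1 / (x - \<zeta>) ^ k) \<in> borel_measurable \<mu>" by measurable
qed

lemma cauchy_transform_has_derivative:
  assumes d: "0 < d" and x: "AE \<zeta> in \<mu>. d \<le> dist x \<zeta>"
  shows "cauchy_transform field_differentiable (at x)"
proof -
  define D where "D = (\<integral>\<zeta>. - (1 / (x - \<zeta>)\<^sup>2) \<partial>\<mu>)"
  have est: "cmod ((cauchy_transform (x + h) - cauchy_transform x) / h - D) \<le> 2 / d ^ 3 * cmod h"
    if h: "h \<noteq> 0" "cmod h < d / 2" for h
  proof -
    have xh: "AE \<zeta> in \<mu>. d / 2 \<le> dist (x + h) \<zeta>"
      using x
    proof eventually_elim
      case (elim \<zeta>)
      have "dist x (x + h) = cmod h" by (simp add: dist_norm)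
      then show ?case using elim h dist_triangle[of x \<zeta> "x + h"] by linarith
    qed
    have i1: "integrable \<mu> (\<lambda>\<zeta>. 1 / (x - \<zeta>))" using integrable_cauchy_kernel[OF d x, of 1] by simp
    have i2: "integrable \<mu> (\<lambda>\<zeta>. 1 / (x + h - \<zeta>))"
      using integrable_cauchy_kernel[OF _ xh, of 1] d by simp
    have i3: "integrable \<mu> (\<lambda>\<zeta>. - (1 / (x - \<zeta>)\<^sup>2))"
      using integrable_cauchy_kernel[OF d x, of 2] by simp
    have eq: "(cauchy_transform (x + h) - cauchy_transform x) / h - D
        = (\<integral>\<zeta>. (1 / (x + h - \<zeta>) - 1 / (x - \<zeta>)) / h - (- (1 / (x - \<zeta>)\<^sup>2)) \<partial>\<mu>)"
      unfolding cauchy_transform_def D_def using i1 i2 i3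
      by (subst Bochner_Integration.integral_diff) (auto simp: Bochner_Integration.integral_diff)
    have "cmod ((cauchy_transform (x + h) - cauchy_transform x) / h - D) \<le> (\<integral>\<zeta>. cmod ((1 / (x + h - \<zeta>) - 1 / (x - \<zeta>)) / h - (- (1 / (x - \<zeta>)\<^sup>2))) \<partial>\<mu>)"
      unfolding eq by (rule integral_norm_bound)
    also have "\<dots> \<le> (\<integral>\<zeta>. 2 / d ^ 3 * cmod h \<partial>\<mu>)"
    proof (rule integral_mono_AE)
      show "AE \<zeta> in \<mu>. cmod ((1 / (x + h - \<zeta>) - 1 / (x - \<zeta>)) / h - (- (1 / (x - \<zeta>)\<^sup>2)))
          \<le> 2 / d ^ 3 * cmod h"
        using x xh
      proof eventually_elim
        case (elim \<zeta>)
        have eq: "x - \<zeta> + h = x + h - \<zeta>" by (rule diff_add_eq)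
        have "d \<le> cmod (x - \<zeta>)" "d / 2 \<le> cmod (x - \<zeta> + h)"
          using elim unfolding eq dist_norm .
        from difference_quotient_inverse_bound[OF h(1) d this] show ?case unfolding eq .
      qed
    next
      show "integrable \<mu> (\<lambda>\<zeta>. cmod ((1 / (x + h - \<zeta>) - 1 / (x - \<zeta>)) / h - (- (1 / (x - \<zeta>)\<^sup>2))))"
        by (intro integrable_norm Bochner_Integration.integrable_diff Bochner_Integration.integrable_divide i1 i2 i3)
    qed simp
    also have "\<dots> = 2 / d ^ 3 * cmod h" using prob_space by simp
    finally show ?thesis .
  qed
  have "((\<lambda>h. (cauchy_transform (x + h) - cauchy_transform x) / h - D) \<longlongrightarrow> 0) (at 0)"
  proof (rule Lim_null_comparison)
    have "\<forall>\<^sub>F h in at 0. cmod h < d / 2 \<and> h \<noteq> 0"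
      unfolding eventually_at using d by (intro exI[of _ "d / 2"]) auto
    then show "\<forall>\<^sub>F h in at 0. cmod ((cauchy_transform (x + h) - cauchy_transform x) / h - D) \<le> 2 / d ^ 3 * cmod h"
      by eventually_elim (use est in blast)
    show "((\<lambda>h. 2 / d ^ 3 * cmod h) \<longlongrightarrow> 0) (at 0)"
      by (rule tendsto_eq_intros refl | simp)+
  qed
  then have "((\<lambda>h. (cauchy_transform (x + h) - cauchy_transform x) / h) \<longlongrightarrow> D) (at 0)"
    by (simp add: LIM_zero_iff)
  then show ?thesis unfolding field_differentiable_def DERIV_def by blast
qed

text \<open>
  With \<open>H\<close> the value of the transform, a displacement \<open>h = \<tau> cnj H\<close> would change \<open>log_pot\<close> by
  \<open>Re (h H) = \<tau> \<bar>H\<bar>\<^sup>2\<close> up to an error of order \<open>\<tau>\<^sup>2\<close>.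
\<close>

lemma cauchy_transform_eq_0:
  assumes d: "0 < d" and x: "AE \<zeta> in \<mu>. d \<le> dist x \<zeta>"
    and const: "\<And>y. dist x y < e \<Longrightarrow> U y = U x" and e: "0 < e"
  shows "cauchy_transform x = 0"
proof (rule ccontr)
  define H where "H = cauchy_transform x"
  assume "cauchy_transform x \<noteq> 0"
  then have H: "0 < cmod H" unfolding H_def by simp
  define C where "C = 2 / d\<^sup>2"
  have step: "\<tau> * (cmod H)\<^sup>2 \<le> C * (\<tau> * cmod H)\<^sup>2"
    if \<tau>: "0 < \<tau>" "\<tau> * cmod H < min e (d / 2)" for \<tau>
  proof -
    define h where "h = of_real \<tau> * cnj H"
    have nh: "cmod h = \<tau> * cmod H" unfolding h_def using \<tau> by (simp add: norm_mult)
    have xh: "AE \<zeta> in \<mu>. d / 2 \<le> dist (x + h) \<zeta>"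
      using x
    proof eventually_elim
      case (elim \<zeta>)
      have "dist x (x + h) = cmod h" by (simp add: dist_norm)
      then show ?case using elim nh \<tau> dist_triangle[of x \<zeta> "x + h"] by linarith
    qed
    have d2: "0 < d / 2" using d by simp
    have i1: "integrable \<mu> (\<lambda>\<zeta>. 1 / (x - \<zeta>))" using integrable_cauchy_kernel[OF d x, of 1] by simp
    have "U (x + h) = U x" using nh \<tau> by (intro const) (simp add: dist_norm)
    then have eq: "log_pot (x + h) = log_pot x"
      unfolding exp_neg_potential_eq[OF d x] exp_neg_potential_eq[OF d2 xh] by simp
    have i4: "integrable \<mu> (\<lambda>\<zeta>. h * (1 / (x - \<zeta>)))" by (rule integrable_mult_right[OF i1])
    have i5: "integrable \<mu> (\<lambda>\<zeta>. Re (h * (1 / (x - \<zeta>))))" by (rule integrable_Re[OF i4])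
    have ReH: "(\<integral>\<zeta>. Re (h * (1 / (x - \<zeta>))) \<partial>\<mu>) = Re (h * H)"
      unfolding integral_Re[OF i4] H_def cauchy_transform_def integral_mult_right_zero ..
    have "Re (h * H) - C * (cmod h)\<^sup>2 = (\<integral>\<zeta>. Re (h * (1 / (x - \<zeta>))) - C * (cmod h)\<^sup>2 \<partial>\<mu>)"
      unfolding ReH[symmetric] using i5 prob_space
      by (subst Bochner_Integration.integral_diff) (simp_all del: times_complex.sel)
    also have "\<dots> \<le> (\<integral>\<zeta>. ln (dist (x + h) \<zeta>) - ln (dist x \<zeta>) \<partial>\<mu>)"
    proof (rule integral_mono_AE)
      show "AE \<zeta> in \<mu>. Re (h * (1 / (x - \<zeta>))) - C * (cmod h)\<^sup>2 \<le> ln (dist (x + h) \<zeta>) - ln (dist x \<zeta>)"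
        using x xh
      proof eventually_elim
        case (elim \<zeta>)
        define w where "w = h / (x - \<zeta>)"
        have a: "d \<le> cmod (x - \<zeta>)" "x - \<zeta> \<noteq> 0" using elim d by (auto simp: dist_norm)
        have nw: "cmod w \<le> cmod h / d"
          unfolding w_def norm_divide using a d by (intro divide_left_mono mult_pos_pos) auto
        also have "\<dots> \<le> 1 / 2" using nh \<tau> d by (simp add: field_simps)
        finally have w2: "cmod w \<le> 1 / 2" .
        have "2 * (cmod w)\<^sup>2 \<le> 2 * (cmod h / d)\<^sup>2" using nw by (simp add: power_mono)
        also have "\<dots> = C * (cmod h)\<^sup>2" unfolding C_def by (simp add: power_divide)
        finally have "Re w - C * (cmod h)\<^sup>2 \<le> ln (cmod (1 + w))"
          using ln_norm_one_plus_ge[OF w2] by simp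
        moreover have "1 + w = (x + h - \<zeta>) / (x - \<zeta>)"
          unfolding w_def using a by (simp add: field_simps)
        moreover have "ln (cmod ((x + h - \<zeta>) / (x - \<zeta>))) = ln (dist (x + h) \<zeta>) - ln (dist x \<zeta>)"
          using a elim d unfolding norm_divide dist_norm by (subst ln_divide_pos) auto
        ultimately show ?case unfolding w_def by simp
      qed
    next
      show "integrable \<mu> (\<lambda>\<zeta>. Re (h * (1 / (x - \<zeta>))) - C * (cmod h)\<^sup>2)"
        by (intro Bochner_Integration.integrable_diff i5) simp
      show "integrable \<mu> (\<lambda>\<zeta>. ln (dist (x + h) \<zeta>) - ln (dist x \<zeta>))"
        by (intro Bochner_Integration.integrable_diff integrable_log_dist[OF d x] integrable_log_dist[OF d2 xh])
    qed
    also have "\<dots> = 0"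
      unfolding Bochner_Integration.integral_diff[OF integrable_log_dist[OF d2 xh] integrable_log_dist[OF d x]]
      using eq by (simp add: log_pot_def)
    finally have "Re (h * H) \<le> C * (cmod h)\<^sup>2" by simp
    moreover have "h * H = of_real (\<tau> * (cmod H)\<^sup>2)"
      unfolding h_def by (simp only: of_real_mult complex_norm_square mult.assoc mult.commute[of "cnj H"])
    ultimately show ?thesis unfolding nh by simp
  qed
  \<comment> \<open>The first bound keeps the displaced point where \<open>U\<close> is constant and the kernel is regular; with
    the second the quadratic error is at most half of the linear term.\<close>
  define \<tau> where "\<tau> = min (min e (d / 2) / (2 * cmod H)) (1 / (2 * C))"
  have C: "0 < C" unfolding C_def using d by simp
  have \<tau>: "0 < \<tau>" unfolding \<tau>_def using e d H C by simp
  have "\<tau> * cmod H \<le> min e (d / 2) / (2 * cmod H) * cmod H"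
    unfolding \<tau>_def using H by (intro mult_right_mono) auto
  also have "\<dots> = min e (d / 2) / 2" using H by simp
  also have "\<dots> < min e (d / 2)"
  proof -
    have "0 < min e (d / 2)" using e d by simp
    then show ?thesis by linarith
  qed
  finally have "\<tau> * (cmod H)\<^sup>2 \<le> C * (\<tau> * cmod H)\<^sup>2" by (intro step \<tau>)
  also have "\<dots> = (C * \<tau>) * (\<tau> * (cmod H)\<^sup>2)" by (simp add: power2_eq_square)
  also have "\<dots> \<le> (1 / 2) * (\<tau> * (cmod H)\<^sup>2)"
  proof (rule mult_right_mono)
    have "C * \<tau> \<le> C * (1 / (2 * C))" unfolding \<tau>_def using C by (intro mult_left_mono) auto
    then show "C * \<tau> \<le> 1 / 2" using C by simp
  qed (use \<tau> in auto)
  finally show False using \<tau> H by (simp add: zero_less_mult_iff)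
qed

text \<open>
  On the connected set \<open>- S\<close> the holomorphic Cauchy transform would vanish identically, but
  \<open>x H(x)\<close> tends to \<open>1\<close> as \<open>x\<close> tends to infinity.
\<close>

lemma not_locally_constant_off_S:
  assumes conn: "connected (- S)" and G: "open G" "G \<subseteq> - S" "G \<noteq> {}"
    and const: "\<And>x. x \<in> G \<Longrightarrow> U x = c"
  shows False
proof -
  have cS: "closed S" using compact_S compact_imp_closed by blast
  have hol: "cauchy_transform holomorphic_on (- S)"
    unfolding holomorphic_on_def
  proof
    fix x assume "x \<in> - S"
    then obtain d where "0 < d" "AE \<zeta> in \<mu>. d \<le> dist x \<zeta>" using AE_dist_ge[OF cS AE_in_S] by auto
    then show "cauchy_transform field_differentiable (at x within - S)"
      using cauchy_transform_has_derivative field_differentiable_at_within by blast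
  qed
  have zero: "cauchy_transform x = 0" if x: "x \<in> G" for x
  proof -
    obtain d where d: "0 < d" "AE \<zeta> in \<mu>. d \<le> dist x \<zeta>"
      using AE_dist_ge[OF cS AE_in_S, of x] x G(2) by auto
    obtain e where e: "0 < e" "ball x e \<subseteq> G" using G(1) x open_contains_ball by blast
    show ?thesis
    proof (rule cauchy_transform_eq_0[OF d _ e(1)])
      fix y assume "dist x y < e"
      then show "U y = U x" using const[of x] const[of y] e(2) x by auto
    qed
  qed
  obtain D where D: "1 \<le> D" "\<And>\<zeta>. \<zeta> \<in> S \<Longrightarrow> dist 0 \<zeta> \<le> D" using dist_bound[of 0] by metis
  \<comment> \<open>Far enough out for \<open>\<bar>x H(x) - 1\<bar> \<le> 1 / 2\<close>.\<close>
  define x :: complex where "x = of_real (4 * D)"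
  have nx: "cmod x = 4 * D" unfolding x_def using D(1) by (simp add: norm_mult)
  have xS: "x \<in> - S" using D nx by (force simp: dist_norm)
  have far: "AE \<zeta> in \<mu>. 3 * D \<le> dist x \<zeta>"
    using AE_in_S
  proof eventually_elim
    case (elim \<zeta>)
    then show ?case using D(2)[OF elim] nx norm_triangle_ineq2[of x \<zeta>] by (simp add: dist_norm)
  qed
  obtain g where g: "g \<in> G" using G(3) by blast
  have "cauchy_transform x = 0"
  proof (rule analytic_continuation[OF hol _ conn _ _ _ zero xS])
    show "open (- S)" using cS by (simp add: open_Compl)
    show "G \<subseteq> - S" "g \<in> - S" using G g by auto
    show "g islimpt G" using G(1) g by (simp add: interior_limit_point interior_open)
  qed
  moreover have "cmod (x * cauchy_transform x - 1) \<le> 1 / 2"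
  proof -
    have D0: "0 < 3 * D" using D by simp
    have i1: "integrable \<mu> (\<lambda>\<zeta>. 1 / (x - \<zeta>))" using integrable_cauchy_kernel[OF D0 far, of 1] by simp
    have i2: "integrable \<mu> (\<lambda>\<zeta>. x * (1 / (x - \<zeta>)))" by (rule integrable_mult_right[OF i1])
    have "x * cauchy_transform x - 1 = (\<integral>\<zeta>. x * (1 / (x - \<zeta>)) - 1 \<partial>\<mu>)"
      unfolding cauchy_transform_def
      using i2 prob_space by (subst Bochner_Integration.integral_diff) (simp_all only: integral_mult_right_zero lebesgue_integral_const space_eq integrable_const scaleR_one)
    also have "cmod \<dots> \<le> (\<integral>\<zeta>. cmod (x * (1 / (x - \<zeta>)) - 1) \<partial>\<mu>)"
      by (rule integral_norm_bound)
    also have "\<dots> \<le> (\<integral>\<zeta>. 1 / 2 \<partial>\<mu>)"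
    proof (rule integral_mono_AE)
      show "AE \<zeta> in \<mu>. cmod (x * (1 / (x - \<zeta>)) - 1) \<le> 1 / 2"
        using far AE_in_S
      proof eventually_elim
        case (elim \<zeta>)
        have "x - \<zeta> \<noteq> 0" using elim D0 by auto
        then have "x * (1 / (x - \<zeta>)) - 1 = \<zeta> / (x - \<zeta>)" by (simp add: field_simps)
        then have "cmod (x * (1 / (x - \<zeta>)) - 1) = cmod \<zeta> / dist x \<zeta>" by (simp add: norm_divide dist_norm)
        also have "\<dots> \<le> D / (3 * D)"
          using elim D(2)[of \<zeta>] D0 by (intro frac_le) (auto simp: dist_norm)
        also have "\<dots> \<le> 1 / 2" using D by simp
        finally show ?case .
      qed
    next
      show "integrable \<mu> (\<lambda>\<zeta>. cmod (x * (1 / (x - \<zeta>)) - 1))"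
        by (intro integrable_norm Bochner_Integration.integrable_diff i2) simp
    qed simp
    also have "\<dots> = 1 / 2" using prob_space by simp
    finally show ?thesis .
  qed
  ultimately show False by simp
qed

text \<open>
  In the application \<open>G\<close> is the set where two candidates for the continuation disagree. If low
  values of \<open>U\<close> on \<open>G\<close> came arbitrarily close to \<open>S\<close>, a limit point would lie in \<open>G\<close> and the minimum
  set \<open>Z\<close> would be non-empty, open, and closed in \<open>V\<close>. Being bounded, \<open>Z\<close> has a frontier point; it
  lies outside \<open>V\<close>, hence outside \<open>S\<close>, and near it \<open>U\<close> is constant on a non-empty open subset of \<open>- S\<close>.
\<close>

lemma low_values_avoid_S:
  assumes conn: "connected (- S)" and V: "open V" "S \<subseteq> V"
    and T: "closed T" "AE \<zeta> in \<mu>. \<zeta> \<in> T"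
    and G: "open G" "G \<subseteq> V" "G \<inter> T = {}"
    and low: "\<And>x. x \<in> G \<Longrightarrow> i \<le> U x" and front: "\<And>y. y \<in> frontier G \<Longrightarrow> y \<in> V \<Longrightarrow> c \<le> U y"
    and "i < c"
  obtains r where "i < r" "r < c" "closure (G \<inter> {x. U x < r}) \<inter> S = {}"
proof (rule ccontr)
  assume neg: "\<not> thesis"
  have "\<exists>b\<in>G. U b < i + (c - i) / real (n + 2) \<and> (\<exists>s\<in>S. dist b s < 1 / real (Suc n))" for n
  proof -
    have "(c - i) / real (n + 2) < (c - i) / 1"
      using \<open>i < c\<close> by (intro divide_strict_left_mono) auto
    then have "(c - i) / real (n + 2) < c - i" by simp
    moreover have "0 < (c - i) / real (n + 2)" using \<open>i < c\<close> by simp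
    ultimately have "i < i + (c - i) / real (n + 2)" "i + (c - i) / real (n + 2) < c" by auto
    then have "closure (G \<inter> {x. U x < i + (c - i) / real (n + 2)}) \<inter> S \<noteq> {}" using neg that by blast
    then obtain s where s: "s \<in> S" "s \<in> closure (G \<inter> {x. U x < i + (c - i) / real (n + 2)})" by blast
    then obtain b where "b \<in> G \<inter> {x. U x < i + (c - i) / real (n + 2)}" "dist b s < 1 / real (Suc n)"
      using closure_approachable[of s] by (metis zero_less_divide_1_iff of_nat_0_less_iff zero_less_Suc)
    then show ?thesis using s(1) by blast
  qed
  then obtain b s where b: "\<And>n. b n \<in> G" "\<And>n. U (b n) < i + (c - i) / real (n + 2)"
    and s: "\<And>n. s n \<in> S" "\<And>n. dist (b n) (s n) < 1 / real (Suc n)" by metis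
  obtain l r where l: "l \<in> S" "strict_mono (r :: nat \<Rightarrow> nat)" "(s \<circ> r) \<longlonglongrightarrow> l"
    using compact_S s(1) unfolding compact_def by metis
  have "(\<lambda>n. b n - s n) \<longlonglongrightarrow> 0"
  proof (rule Lim_null_comparison[OF _ LIMSEQ_Suc[OF lim_1_over_n]])
    show "\<forall>\<^sub>F n in sequentially. cmod (b n - s n) \<le> 1 / real (Suc n)"
      using s(2) by (intro always_eventually) (auto simp: dist_norm intro: less_imp_le)
  qed
  then have "((\<lambda>n. b n - s n) \<circ> r) \<longlonglongrightarrow> 0" using l(2) LIMSEQ_subseq_LIMSEQ by blast
  from tendsto_add[OF this l(3)] have bl: "(b \<circ> r) \<longlonglongrightarrow> l" by (simp add: o_def)
  have Ub: "(\<lambda>n. U (b n)) \<longlonglongrightarrow> i"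
  proof (rule tendsto_sandwich[where f = "\<lambda>_. i" and h = "\<lambda>n. i + (c - i) / real (n + 2)"])
    show "(\<lambda>n. i + (c - i) / real (n + 2)) \<longlonglongrightarrow> i" by real_asymp
  qed (use b low in \<open>auto intro!: always_eventually less_imp_le\<close>)
  have lV: "l \<in> V" using l V by blast
  obtain e where e: "0 < e" "ball l e \<subseteq> V" using V(1) lV open_contains_ball by blast
  have lG: "l \<in> G \<and> U l = i"
  proof (rule limit_of_low_values[OF T G(1,3) e(1) _ _ bl _ \<open>i < c\<close>])
    show "(\<lambda>n. U ((b \<circ> r) n)) \<longlonglongrightarrow> i"
      using LIMSEQ_subseq_LIMSEQ[OF Ub l(2)] by (simp add: o_def)
    show "c \<le> U y" if "y \<in> frontier G" "dist l y < e" for y using front that e(2) by auto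
  qed (use b in auto)
  define Z where "Z = {x\<in>G. U x = i}"
  have front': "\<forall>y\<in>frontier G \<inter> V. c \<le> U y" and low': "\<forall>x\<in>G. i \<le> U x" using front low by auto
  note clopenZ = minimum_set_clopen[OF T G(1,3) V(1) front' low' \<open>i < c\<close>]
  have Z: "open Z" unfolding Z_def by (rule clopenZ(1))
  have Z2: "x \<in> Z" if "x \<in> V" "x \<in> closure Z" for x
    using clopenZ(2)[OF that(1)] that(2) unfolding Z_def by simp
  have "bounded Z" by (rule bounded_subset[OF bounded_level_set[of c]]) (use \<open>i < c\<close> in \<open>auto simp: Z_def\<close>)
  then have "Z \<noteq> UNIV" using not_bounded_UNIV by blast
  moreover have "Z \<noteq> {}" using lG unfolding Z_def by blast
  ultimately obtain y where y: "y \<in> frontier Z" using frontier_eq_empty by blast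
  then have yc: "y \<in> closure Z" "y \<notin> Z" using Z by (auto simp: frontier_def interior_open)
  then have "y \<in> - S" using Z2 V(2) by blast
  moreover have oS: "open (- S)" by (rule open_Compl[OF compact_imp_closed[OF compact_S]])
  ultimately have ne: "Z \<inter> - S \<noteq> {}" using yc(1) by (meson disjoint_iff open_Int_closure_eq_empty Int_commute)
  show False
  proof (rule not_locally_constant_off_S[OF conn _ _ ne])
    show "open (Z \<inter> - S)" using Z oS by (rule open_Int)
    show "U x = i" if "x \<in> Z \<inter> - S" for x using that unfolding Z_def by simp
  qed simp
qed

end

section \<open>Interpolation nodes and the potential\<close>

locale interpolation_scheme = compactly_supported_prob \<mu> S
  for \<mu> :: "complex measure" and S :: "complex set" +
  fixes w :: "nat \<Rightarrow> complex poly"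
  assumes monic: "\<And>n. lead_coeff (w n) = 1" and degree_w: "\<And>n. degree (w n) = n"
    and zeros_in_S: "\<And>n. {\<xi>. poly (w n) \<xi> = 0} \<subseteq> S"
    and azd: "asymptotic_zero_distribution S w \<mu>"
begin

lemma w_nonzero: "w n \<noteq> 0"
  using monic[of n] by auto

lemma finite_zeros: "finite {\<xi>. poly (w n) \<xi> = 0}"
  by (rule poly_roots_finite[OF w_nonzero])

text \<open>
  The integral of \<open>\<phi>\<close> with respect to \<open>n\<close> times the normalised zero counting measure.
\<close>

definition zero_sum :: "nat \<Rightarrow> (complex \<Rightarrow> real) \<Rightarrow> real" where
  "zero_sum n \<phi> = (\<Sum>\<xi> | poly (w n) \<xi> = 0. real (order \<xi> (w n)) * \<phi> \<xi>)"

lemma zero_sum_mono: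
  assumes "\<And>\<xi>. \<xi> \<in> S \<Longrightarrow> \<phi> \<xi> \<le> \<psi> \<xi>"
  shows "zero_sum n \<phi> \<le> zero_sum n \<psi>"
  unfolding zero_sum_def
proof (rule sum_mono)
  fix \<xi> assume "\<xi> \<in> {\<xi>. poly (w n) \<xi> = 0}"
  then have "\<xi> \<in> S" using zeros_in_S by blast
  then show "real (order \<xi> (w n)) * \<phi> \<xi> \<le> real (order \<xi> (w n)) * \<psi> \<xi>"
    using assms by (intro mult_left_mono) auto
qed

lemma sum_orders: "(\<Sum>\<xi> | poly (w n) \<xi> = 0. order \<xi> (w n)) = n"
proof -
  have "degree (w n) = degree (\<Prod>z|poly (w n) z = 0. [:-z, 1:] ^ order z (w n))"
    using complex_poly_decompose[of "w n"] monic[of n] by simp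
  also have "\<dots> = (\<Sum>z | poly (w n) z = 0. degree ([:-z, 1:] ^ order z (w n)))"
    by (rule degree_prod_sum_eq) simp
  also have "\<dots> = (\<Sum>z | poly (w n) z = 0. order z (w n))"
    by (intro sum.cong refl) (simp add: degree_power_eq)
  finally show ?thesis using degree_w[of n] by simp
qed

lemma zero_sum_add_const: "zero_sum n (\<lambda>\<xi>. \<phi> \<xi> + c) = zero_sum n \<phi> + real n * c"
proof -
  have "(\<Sum>\<xi> | poly (w n) \<xi> = 0. real (order \<xi> (w n))) = real n"
    using sum_orders[of n] by (simp flip: of_nat_sum)
  then show ?thesis
    unfolding zero_sum_def by (simp add: distrib_left sum.distrib flip: sum_distrib_right)
qed

lemma integral_zero_counting_measure:
  assumes "continuous_on S \<phi>" 
  shows "(LINT \<xi>:S|zero_counting_measure (w n). \<phi> \<xi>) = zero_sum n \<phi> / real n"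
proof -
  let ?A = "{\<xi>. poly (w n) \<xi> = 0}"
  have meas: "(\<lambda>\<xi>. indicator S \<xi> *\<^sub>R \<phi> \<xi>) \<in> borel_measurable borel"
    using assms compact_S
    by (intro borel_measurable_continuous_on_indicator) (auto intro: borel_closed compact_imp_closed)
  have "(LINT \<xi>:S|zero_counting_measure (w n). \<phi> \<xi>)
      = (\<integral>\<xi>. indicator S \<xi> *\<^sub>R \<phi> \<xi> \<partial>point_measure ?A (\<lambda>\<xi>. ennreal (real (order \<xi> (w n)) / real n)))"
    unfolding set_lebesgue_integral_def zero_counting_measure_def degree_w
    by (subst integral_distr) (use meas in \<open>auto simp: measurable_point_measure_eq1\<close>)
  also have "\<dots> = (\<Sum>\<xi>\<in>?A. (real (order \<xi> (w n)) / real n) *\<^sub>R (indicator S \<xi> *\<^sub>R \<phi> \<xi>))"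
    by (rule lebesgue_integral_point_measure_finite[OF finite_zeros]) simp
  also have "\<dots> = (\<Sum>\<xi>\<in>?A. real (order \<xi> (w n)) * \<phi> \<xi> / real n)"
  proof (rule sum.cong[OF refl])
    fix \<xi> assume "\<xi> \<in> ?A"
    then have "\<xi> \<in> S" using zeros_in_S by blast
    then show "(real (order \<xi> (w n)) / real n) *\<^sub>R (indicator S \<xi> *\<^sub>R \<phi> \<xi>) = real (order \<xi> (w n)) * \<phi> \<xi> / real n"
      by simp
  qed
  finally show ?thesis unfolding zero_sum_def by (simp add: sum_divide_distrib)
qed

lemma integral_on_S:
  assumes "continuous_on UNIV \<phi>"
  shows "(LINT \<xi>:S|\<mu>. \<phi> \<xi>) = (\<integral>\<xi>. \<phi> \<xi> \<partial>\<mu>)"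
  unfolding set_lebesgue_integral_def
proof (rule integral_cong_AE)
  have m: "\<phi> \<in> borel_measurable borel" by (rule borel_measurable_continuous_onI[OF assms])
  have S: "S \<in> sets borel" using compact_S by (intro borel_closed compact_imp_closed)
  show "\<phi> \<in> borel_measurable \<mu>" using m by simp
  show "(\<lambda>\<xi>. indicator S \<xi> *\<^sub>R \<phi> \<xi>) \<in> borel_measurable \<mu>"
    using m S by (intro borel_measurable_scaleR borel_measurable_indicator) (simp_all add: sets_eq)
  show "AE \<xi> in \<mu>. indicator S \<xi> *\<^sub>R \<phi> \<xi> = \<phi> \<xi>"
    using AE_in_S by eventually_elim simp
qed

lemma zero_sum_tendsto:
  assumes "continuous_on UNIV \<phi>"
  shows "(\<lambda>n. zero_sum n \<phi> / real n) \<longlonglongrightarrow> (\<integral>\<xi>. \<phi> \<xi> \<partial>\<mu>)"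
proof -
  have c: "continuous_on S \<phi>" using assms continuous_on_subset by blast
  then have "(\<lambda>n. LINT \<xi>:S|zero_counting_measure (w n). \<phi> \<xi>) \<longlonglongrightarrow> (LINT \<xi>:S|\<mu>. \<phi> \<xi>)"
    using azd unfolding asymptotic_zero_distribution_def by blast
  then show ?thesis unfolding integral_zero_counting_measure[OF c] integral_on_S[OF assms] .
qed

lemma norm_w_le_zero_sum:
  assumes "0 < \<delta>"
  shows "cmod (poly (w n) x) \<le> exp (zero_sum n (trunc_log \<delta> x))"
proof -
  have "cmod (poly (w n) x) = (\<Prod>\<xi> | poly (w n) \<xi> = 0. cmod (x - \<xi>) ^ order \<xi> (w n))"
    by (rule cmod_monic_poly[OF monic])
  also have "\<dots> \<le> (\<Prod>\<xi> | poly (w n) \<xi> = 0. max (dist x \<xi>) \<delta> ^ order \<xi> (w n))"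
    by (intro prod_mono conjI power_mono) (auto simp: dist_norm)
  also have "\<dots> = (\<Prod>\<xi> | poly (w n) \<xi> = 0. exp (real (order \<xi> (w n)) * trunc_log \<delta> x \<xi>))"
  proof (rule prod.cong[OF refl])
    fix \<xi>
    have "0 < max (dist x \<xi>) \<delta>" using assms by simp
    then show "max (dist x \<xi>) \<delta> ^ order \<xi> (w n) = exp (real (order \<xi> (w n)) * trunc_log \<delta> x \<xi>)"
      unfolding trunc_log_def by (simp add: exp_of_nat_mult)
  qed
  also have "\<dots> = exp (zero_sum n (trunc_log \<delta> x))"
    unfolding zero_sum_def by (rule exp_sum[OF finite_zeros, symmetric])
  finally show ?thesis .
qed

lemma norm_w_eq_zero_sum:
  assumes "0 < \<delta>" and far: "\<And>\<xi>. \<xi> \<in> S \<Longrightarrow> \<delta> \<le> dist x \<xi>"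
  shows "cmod (poly (w n) x) = exp (zero_sum n (trunc_log \<delta> x))"
proof -
  have "cmod (poly (w n) x) = (\<Prod>\<xi> | poly (w n) \<xi> = 0. cmod (x - \<xi>) ^ order \<xi> (w n))"
    by (rule cmod_monic_poly[OF monic])
  also have "\<dots> = (\<Prod>\<xi> | poly (w n) \<xi> = 0. exp (real (order \<xi> (w n)) * trunc_log \<delta> x \<xi>))"
  proof (rule prod.cong[OF refl])
    fix \<xi> assume "\<xi> \<in> {\<xi>. poly (w n) \<xi> = 0}"
    then have "\<delta> \<le> dist x \<xi>" using zeros_in_S far by blast
    then have "trunc_log \<delta> x \<xi> = ln (dist x \<xi>)" "0 < dist x \<xi>"
      unfolding trunc_log_def using assms(1) by (auto simp only: max_absorb1 intro: less_le_trans)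
    then show "cmod (x - \<xi>) ^ order \<xi> (w n) = exp (real (order \<xi> (w n)) * trunc_log \<delta> x \<xi>)"
      by (simp add: exp_of_nat_mult dist_norm)
  qed
  also have "\<dots> = exp (zero_sum n (trunc_log \<delta> x))"
    unfolding zero_sum_def by (rule exp_sum[OF finite_zeros, symmetric])
  finally show ?thesis .
qed

text \<open>
  Upper bounds by \<open>U\<close> hold locally uniformly (principle of descent), since truncating the kernel
  from below replaces \<open>\<bar>w\<^sub>n\<bar>\<close> by something larger and equicontinuous. A matching lower bound fails near the zeros and is only available outside \<open>S\<close>.
\<close>

lemma eventually_norm_w_le:
  assumes "U x0 < a"
  obtains e where "0 < e" "\<forall>\<^sub>F n in sequentially. \<forall>x\<in>ball x0 e. cmod (poly (w n) x) \<le> a ^ n"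
proof -
  obtain \<delta> where \<delta>: "0 < \<delta>" "exp (trunc_pot \<delta> x0) < a"
    using exp_neg_potential_lessE[OF assms] by blast
  define b where "b = (exp (trunc_pot \<delta> x0) + a) / 2"
  have b: "exp (trunc_pot \<delta> x0) < b" "b < a" using \<delta> unfolding b_def by auto
  have b0: "0 < b" using b(1) exp_gt_zero less_trans by blast
  define e where "e = \<delta> * (a / b - 1)"
  have e: "0 < e" using \<delta>(1) b b0 unfolding e_def by (simp add: field_simps)
  have be: "b * (1 + e / \<delta>) = a" using \<delta>(1) b0 unfolding e_def by (simp add: field_simps)
  have e1: "0 < 1 + e / \<delta>" using e \<delta>(1) by (simp add: add_pos_pos)
  have lim: "(\<lambda>n. zero_sum n (trunc_log \<delta> x0) / real n) \<longlonglongrightarrow> trunc_pot \<delta> x0"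
    unfolding trunc_pot_def by (rule zero_sum_tendsto[OF continuous_trunc_log[OF \<delta>(1)]])
  have "trunc_pot \<delta> x0 < ln b" using b(1) b0 by (metis exp_less_cancel_iff exp_ln)
  then have "\<forall>\<^sub>F n in sequentially. zero_sum n (trunc_log \<delta> x0) / real n < ln b"
    by (rule order_tendstoD(2)[OF lim])
  then have "\<forall>\<^sub>F n in sequentially. \<forall>x\<in>ball x0 e. cmod (poly (w n) x) \<le> a ^ n"
    using eventually_gt_at_top[of 0]
  proof eventually_elim
    case (elim n)
    show ?case
    proof
      fix x assume "x \<in> ball x0 e"
      then have x: "dist x0 x / \<delta> \<le> e / \<delta>" using \<delta>(1) by (simp add: divide_right_mono less_imp_le)
      have x1: "0 < 1 + dist x0 x / \<delta>" using \<delta>(1) by (simp add: add_pos_nonneg)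
      have "zero_sum n (trunc_log \<delta> x) \<le> zero_sum n (\<lambda>\<xi>. trunc_log \<delta> x0 \<xi> + ln (1 + e / \<delta>))"
      proof (rule zero_sum_mono)
        fix \<xi>
        have "ln (1 + dist x0 x / \<delta>) \<le> ln (1 + e / \<delta>)" using x x1 by (intro ln_mono) auto
        then show "trunc_log \<delta> x \<xi> \<le> trunc_log \<delta> x0 \<xi> + ln (1 + e / \<delta>)"
          using trunc_log_shift[OF \<delta>(1), of x \<xi> x0] by simp
      qed
      also have "\<dots> = zero_sum n (trunc_log \<delta> x0) + real n * ln (1 + e / \<delta>)"
        by (rule zero_sum_add_const)
      also have "zero_sum n (trunc_log \<delta> x0) \<le> real n * ln b"
        using elim by (simp add: divide_less_eq mult.commute less_imp_le)
      finally have "zero_sum n (trunc_log \<delta> x) \<le> real n * (ln b + ln (1 + e / \<delta>))"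
        by (simp add: distrib_left)
      also have "ln b + ln (1 + e / \<delta>) = ln a"
        unfolding be[symmetric] by (rule ln_mult_pos[OF b0 e1, symmetric])
      finally have "exp (zero_sum n (trunc_log \<delta> x)) \<le> exp (real n * ln a)" by simp
      also have "\<dots> = a ^ n" using b b0 by (simp add: exp_of_nat_mult)
      finally show "cmod (poly (w n) x) \<le> a ^ n"
        using norm_w_le_zero_sum[OF \<delta>(1), of n x] by simp
    qed
  qed
  then show ?thesis using that e by blast
qed

lemma eventually_norm_w_ge:
  assumes "z \<notin> S" "b < U z" "0 < b"
  shows "\<forall>\<^sub>F n in sequentially. b ^ n \<le> cmod (poly (w n) z)"
proof -
  have "open (- S)" "z \<in> - S" using compact_S assms(1) by (auto intro: open_Compl compact_imp_closed)
  then obtain d where d: "0 < d" "ball z d \<subseteq> - S" using openE by blast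
  have far: "d \<le> dist z \<xi>" if "\<xi> \<in> S" for \<xi> using d(2) that by force
  have AEd: "AE \<zeta> in \<mu>. d \<le> dist z \<zeta>" using AE_in_S by eventually_elim (rule far)
  have Uz: "U z = exp (trunc_pot d z)"
    using exp_neg_potential_eq[OF d(1) AEd] trunc_pot_eq_log_pot[OF d(1) AEd d(1)] by simp
  have lim: "(\<lambda>n. zero_sum n (trunc_log d z) / real n) \<longlonglongrightarrow> trunc_pot d z"
    unfolding trunc_pot_def by (rule zero_sum_tendsto[OF continuous_trunc_log[OF d(1)]])
  have "ln b < trunc_pot d z" using assms(2,3) Uz by (metis exp_less_cancel_iff exp_ln)
  then have "\<forall>\<^sub>F n in sequentially. ln b < zero_sum n (trunc_log d z) / real n"
    by (rule order_tendstoD(1)[OF lim])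
  then show ?thesis
    using eventually_gt_at_top[of 0]
  proof eventually_elim
    case (elim n)
    then have "real n * ln b \<le> zero_sum n (trunc_log d z)"
      by (simp add: less_divide_eq mult.commute less_imp_le)
    then have "exp (real n * ln b) \<le> exp (zero_sum n (trunc_log d z))" by simp
    then have "b ^ n \<le> exp (zero_sum n (trunc_log d z))" using assms(3) by (simp add: exp_of_nat_mult)
    then show ?case using norm_w_eq_zero_sum[OF d(1) far, of n] by simp
  qed
qed

text \<open>
  A continuous bump function at \<open>s\<close> has positive integral, so a positive proportion of the \<open>n\<close> zeros
  of \<open>w\<^sub>n\<close> lies in the ball.
\<close>

lemma zeros_accumulate_at_support:
  assumes s: "s \<in> support" and r: "0 < r"
  shows "filterlim (\<lambda>n. \<Sum>\<xi> | poly (w n) \<xi> = 0 \<and> \<xi> \<in> ball s r. order \<xi> (w n)) at_top sequentially"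
proof -
  define \<phi> where "\<phi> \<zeta> = max 0 (1 - dist s \<zeta> / r)" for \<zeta>
  define N where "N n = (\<Sum>\<xi> | poly (w n) \<xi> = 0 \<and> \<xi> \<in> ball s r. order \<xi> (w n))" for n
  have cont: "continuous_on UNIV \<phi>" unfolding \<phi>_def using r by (intro continuous_intros) auto
  define c where "c = (\<integral>\<xi>. \<phi> \<xi> \<partial>\<mu>)"
  have bm: "\<phi> \<in> borel_measurable borel" by (rule borel_measurable_continuous_onI[OF cont])
  have "0 < emeasure \<mu> (ball s (r / 2))"
    using support_emeasure_pos[OF s open_ball] r by simp
  then have pos: "0 < measure \<mu> (ball s (r / 2))"
    by (simp add: emeasure_eq_measure)
  have "measure \<mu> (ball s (r / 2)) / 2 = (\<integral>\<xi>. indicator (ball s (r / 2)) \<xi> / 2 \<partial>\<mu>)"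
    by (simp add: sets_eq)
  also have "\<dots> \<le> c"
    unfolding c_def
  proof (rule integral_mono)
    show "integrable \<mu> \<phi>"
      by (rule integrable_const_bound[where B = 1]) (use bm r in \<open>auto simp: \<phi>_def\<close>)
    show "indicator (ball s (r / 2)) \<xi> / 2 \<le> \<phi> \<xi>" for \<xi>
      unfolding \<phi>_def using r by (auto simp: indicator_def field_simps max_def)
  qed simp
  finally have c0: "0 < c" using pos by simp
  have le: "zero_sum n \<phi> \<le> real (N n)" for n
  proof -
    have "zero_sum n \<phi> \<le> (\<Sum>\<xi> | poly (w n) \<xi> = 0. if \<xi> \<in> ball s r then real (order \<xi> (w n)) else 0)"
      unfolding zero_sum_def
    proof (rule sum_mono)
      fix \<xi>
      have "\<phi> \<xi> \<le> 1" "\<xi> \<notin> ball s r \<Longrightarrow> \<phi> \<xi> = 0" unfolding \<phi>_def using r by (auto simp: field_simps)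
      then show "real (order \<xi> (w n)) * \<phi> \<xi> \<le> (if \<xi> \<in> ball s r then real (order \<xi> (w n)) else 0)"
        by (cases "\<xi> \<in> ball s r") (auto intro: mult_left_le)
    qed
    also have "\<dots> = (\<Sum>\<xi>\<in>{\<xi>. poly (w n) \<xi> = 0} \<inter> ball s r. real (order \<xi> (w n)))"
      by (rule sum.inter_restrict[OF finite_zeros, symmetric])
    also have "\<dots> = real (N n)" unfolding N_def by (simp add: Int_def)
    finally show ?thesis .
  qed
  have lim: "(\<lambda>n. zero_sum n \<phi> / real n) \<longlonglongrightarrow> c" unfolding c_def by (rule zero_sum_tendsto[OF cont])
  have "\<forall>\<^sub>F n in sequentially. c / 2 < zero_sum n \<phi> / real n"
    by (rule order_tendstoD(1)[OF lim]) (use c0 in simp)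
  then have "\<forall>\<^sub>F n in sequentially. c / 2 * real n \<le> real (N n)"
    using eventually_gt_at_top[of 0]
  proof eventually_elim
    case (elim n)
    then have "c / 2 * real n \<le> zero_sum n \<phi>" by (simp add: less_divide_eq)
    then show ?case using le[of n] by simp
  qed
  moreover have "filterlim (\<lambda>n. c / 2 * real n) at_top sequentially"
    using c0 by real_asymp
  ultimately have "filterlim (\<lambda>n. real (N n)) at_top sequentially"
    by (rule filterlim_at_top_mono[rotated])
  then show ?thesis unfolding N_def[symmetric] by (simp add: filterlim_sequentially_iff_filterlim_real)
qed

end

section \<open>Bounds for a row of approximants\<close>

lemma summable_geometric_times_power:
  fixes \<theta> :: real
  assumes "0 < \<theta>" "\<theta> < 1"
  shows "summable (\<lambda>k. \<theta> ^ k * ((real k + 1) * (real k + 2)) ^ M)"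
proof -
  define g where "g k = \<theta> ^ k * ((real k + 1) * (real k + 2)) ^ M" for k
  have "(\<lambda>k. (real k + 3) / (real k + 1)) \<longlonglongrightarrow> 1" by real_asymp
  then have "(\<lambda>k. \<theta> * ((real k + 3) / (real k + 1)) ^ M) \<longlonglongrightarrow> \<theta> * 1 ^ M"
    by (intro tendsto_intros)
  then have "\<forall>\<^sub>F k in sequentially. \<theta> * ((real k + 3) / (real k + 1)) ^ M < (1 + \<theta>) / 2"
    by (rule order_tendstoD) (use assms in simp)
  then obtain N where N: "\<And>k. N \<le> k \<Longrightarrow> \<theta> * ((real k + 3) / (real k + 1)) ^ M < (1 + \<theta>) / 2"
    by (auto simp: eventually_sequentially)
  have "summable g"
  proof (rule summable_ratio_test[of "(1 + \<theta>) / 2" N])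
    show "(1 + \<theta>) / 2 < 1" using assms by simp
    fix k assume k: "N \<le> k"
    have gpos: "0 < g k" unfolding g_def using assms by (intro mult_pos_pos zero_less_power) auto
    have "(real k + 2) * (real k + 3) = ((real k + 3) / (real k + 1)) * ((real k + 1) * (real k + 2))"
      by (simp add: field_simps)
    then have "g (Suc k) = (\<theta> * ((real k + 3) / (real k + 1)) ^ M) * g k"
      unfolding g_def by (simp add: power_mult_distrib[symmetric] algebra_simps)
    also have "\<dots> \<le> ((1 + \<theta>) / 2) * g k" using N[OF k] gpos by (intro mult_right_mono) auto
    finally have "g (Suc k) \<le> (1 + \<theta>) / 2 * g k" .
    moreover have "0 < g (Suc k)" unfolding g_def using assms by (intro mult_pos_pos zero_less_power) auto
    ultimately show "norm (g (Suc k)) \<le> (1 + \<theta>) / 2 * norm (g k)" using gpos by simp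
  qed
  then show ?thesis unfolding g_def .
qed

lemma telescoping_bound:
  fixes c :: "nat \<Rightarrow> complex"
  assumes "\<And>k. n0 \<le> k \<Longrightarrow> cmod (c (Suc k) - c k) \<le> g k" and g: "summable g" "\<And>k. 0 \<le> g k"
    and "n0 \<le> n"
  shows "cmod (c n) \<le> cmod (c n0) + suminf g"
proof -
  have "cmod (c n) \<le> cmod (c n0) + (\<Sum>k<n. g k)"
    using assms(4)
  proof (induction n rule: dec_induct)
    case base
    then show ?case using g(2) by (simp add: sum_nonneg)
  next
    case (step n)
    have "cmod (c (Suc n)) \<le> cmod (c n) + cmod (c (Suc n) - c n)"
      using norm_triangle_ineq[of "c n" "c (Suc n) - c n"] by simp
    then show ?case using step assms(1)[of n] by simp
  qed
  also have "(\<Sum>k<n. g k) \<le> suminf g" using g by (intro sum_le_suminf) auto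
  finally show ?thesis by simp
qed

locale pade_row = interpolation_scheme \<mu> S w
  for \<mu> :: "complex measure" and S :: "complex set" and w :: "nat \<Rightarrow> complex poly" +
  fixes f :: "complex \<Rightarrow> complex" and V :: "complex set" and m :: nat
    and P Q :: "nat \<Rightarrow> complex poly"
  assumes open_V: "open V" and S_subset_V: "S \<subseteq> V" and f_analytic: "f analytic_on V"
    and newtonian: "newtonian_table w"
    and pair: "\<And>n. m \<le> n \<Longrightarrow> multipoint_pade_pair f V w n m (P n) (Q n)"
    and Q_normalized: "\<And>n. m \<le> n \<Longrightarrow> coeff_norm (Q n) = 1"
begin

lemma degree_Q: "m \<le> n \<Longrightarrow> degree (Q n) \<le> m"
  and degree_P: "m \<le> n \<Longrightarrow> degree (P n) \<le> n - m"
  using pair[of n] unfolding multipoint_pade_pair_def by auto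

lemma remainder:
  assumes "m \<le> n"
  obtains h where "h analytic_on V"
    "\<And>\<zeta>. \<zeta> \<in> V \<Longrightarrow> poly (Q n) \<zeta> * f \<zeta> - poly (P n) \<zeta> = h \<zeta> * poly (w (Suc n)) \<zeta>"
  using pair[OF assms] unfolding multipoint_pade_pair_def by blast

text \<open>
  Both remainders are divisible by \<open>w\<^sub>n\<^sub>+\<^sub>1\<close>, the second one because the table is newtonian.
  Eliminating \<open>f\<close> leaves a polynomial, whose degree leaves room for a constant factor only.
\<close>

lemma consecutive_difference_ex:
  assumes "m \<le> n"
  shows "\<exists>a. P (Suc n) * Q n - P n * Q (Suc n) = smult a (w (Suc n))"
proof -
  define X where "X = P (Suc n) * Q n - P n * Q (Suc n)"
  obtain h where h: "h analytic_on V"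
    "\<And>\<zeta>. \<zeta> \<in> V \<Longrightarrow> poly (Q n) \<zeta> * f \<zeta> - poly (P n) \<zeta> = h \<zeta> * poly (w (Suc n)) \<zeta>"
    using remainder[OF assms] by blast
  have "m \<le> Suc n" using assms by simp
  then obtain h' where h': "h' analytic_on V"
    "\<And>\<zeta>. \<zeta> \<in> V \<Longrightarrow> poly (Q (Suc n)) \<zeta> * f \<zeta> - poly (P (Suc n)) \<zeta> = h' \<zeta> * poly (w (Suc (Suc n))) \<zeta>"
    using remainder by blast
  obtain v where v: "w (Suc (Suc n)) = w (Suc n) * v"
    using newtonian unfolding newtonian_table_def by blast
  define H where "H \<zeta> = poly (Q (Suc n)) \<zeta> * h \<zeta> - poly (Q n) \<zeta> * (h' \<zeta> * poly v \<zeta>)" for \<zeta>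
  have "w (Suc n) dvd X"
  proof (rule poly_dvd_of_continuous_quotient[OF open_V _ w_nonzero])
    have "continuous_on V h" "continuous_on V h'"
      using h(1) h'(1) by (auto intro: holomorphic_on_imp_continuous_on analytic_imp_holomorphic)
    then show "continuous_on V H" unfolding H_def by (intro continuous_intros)
    show "{\<xi>. poly (w (Suc n)) \<xi> = 0} \<subseteq> V" using zeros_in_S S_subset_V by blast
    fix \<zeta> assume "\<zeta> \<in> V"
    have "poly X \<zeta> = poly (Q (Suc n)) \<zeta> * (poly (Q n) \<zeta> * f \<zeta> - poly (P n) \<zeta>)
        - poly (Q n) \<zeta> * (poly (Q (Suc n)) \<zeta> * f \<zeta> - poly (P (Suc n)) \<zeta>)"
      unfolding X_def by (simp add: algebra_simps)
    also have "\<dots> = H \<zeta> * poly (w (Suc n)) \<zeta>"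
      unfolding h(2)[OF \<open>\<zeta> \<in> V\<close>] h'(2)[OF \<open>\<zeta> \<in> V\<close>] v H_def by (simp add: algebra_simps)
    finally show "poly X \<zeta> = H \<zeta> * poly (w (Suc n)) \<zeta>" .
  qed
  then obtain k where k: "X = w (Suc n) * k" by blast
  have "degree (P (Suc n) * Q n) \<le> (Suc n - m) + m"
    using degree_mult_le[of "P (Suc n)" "Q n"] degree_P[of "Suc n"] degree_Q[of n] assms by simp
  moreover have "degree (P n * Q (Suc n)) \<le> (n - m) + m"
    using degree_mult_le[of "P n" "Q (Suc n)"] degree_P[of n] degree_Q[of "Suc n"] assms by simp
  ultimately have dX: "degree X \<le> Suc n"
    unfolding X_def using assms by (intro degree_diff_le) auto
  have "degree k = 0"
  proof (cases "k = 0")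
    case False
    then have "degree X = Suc n + degree k"
      unfolding k using w_nonzero[of "Suc n"] degree_w[of "Suc n"] by (simp add: degree_mult_eq)
    then show ?thesis using dX by simp
  qed simp
  then obtain a where "k = [:a:]" using degree_eq_zeroE by blast
  then have "X = smult a (w (Suc n))" using k by simp
  then show ?thesis unfolding X_def by blast
qed

definition A :: "nat \<Rightarrow> complex" where
  "A n = (SOME a. P (Suc n) * Q n - P n * Q (Suc n) = smult a (w (Suc n)))"

lemma consecutive_difference:
  assumes "m \<le> n"
  shows "poly (P (Suc n)) x * poly (Q n) x - poly (P n) x * poly (Q (Suc n)) x = A n * poly (w (Suc n)) x"
proof -
  have "P (Suc n) * Q n - P n * Q (Suc n) = smult (A n) (w (Suc n))"
    unfolding A_def by (rule someI_ex[OF consecutive_difference_ex[OF assms]])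
  then have "poly (P (Suc n) * Q n - P n * Q (Suc n)) x = poly (smult (A n) (w (Suc n))) x" by simp
  then show ?thesis by simp
qed

text \<open>
  At \<open>z\<close> the difference of consecutive approximants is \<open>A\<^sub>n w\<^sub>n\<^sub>+\<^sub>1(z) / (Q\<^sub>n(z) Q\<^sub>n\<^sub>+\<^sub>1(z))\<close>; here the
  denominators are bounded above and \<open>\<bar>w\<^sub>n\<^sub>+\<^sub>1(z)\<bar>\<close> is bounded below. The number \<open>c\<close> that the
  approximants approach is arbitrary: it cancels in the difference.
\<close>

lemma coefficient_decay:
  fixes p q :: "nat \<Rightarrow> complex poly" and R :: ereal
  assumes reduced: "\<And>n. m \<le> n \<Longrightarrow> P n * q n = p n * Q n"
    and z: "z \<notin> S" and R: "0 < R"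
    and rate: "limsup (\<lambda>n. nth_root_error n c (p n) (q n) z) \<le> ereal (U z) / R"
    and r: "0 < r" "ereal r < R"
  shows "\<exists>C. \<forall>\<^sub>F n in sequentially. cmod (A n) \<le> C / r ^ n"
proof -
  obtain r3 where r3: "r < r3" "ereal r3 < R" using ereal_dense2[OF r(2)] by auto
  have r30: "0 < r3" using r r3 by simp
  have U0: "0 < U z" by (rule exp_neg_potential_pos[OF z])
  define \<sigma> where "\<sigma> = U z / r3"
  have \<sigma>: "0 < \<sigma>" unfolding \<sigma>_def using U0 r30 by simp
  have "ereal (U z) / R < ereal \<sigma>"
  proof (cases R)
    case (real R')
    then show ?thesis using r3 r30 U0 R unfolding \<sigma>_def by (auto intro: divide_strict_left_mono)
  next
    case PInf
    then show ?thesis using \<sigma> by simp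
  next
    case MInf
    then show ?thesis using R by simp
  qed
  then have "limsup (\<lambda>n. nth_root_error n c (p n) (q n) z) < ereal \<sigma>" using rate by simp
  then have ev: "\<forall>\<^sub>F n in sequentially. nth_root_error n c (p n) (q n) z < ereal \<sigma>"
    by (rule Limsup_lessD)
  have ev1: "\<forall>\<^sub>F n in sequentially. poly (q n) z \<noteq> 0 \<and> cmod (c - poly (p n) z / poly (q n) z) \<le> \<sigma> ^ n"
    using ev eventually_gt_at_top[of 0]
  proof eventually_elim
    case (elim n)
    then have nz: "poly (q n) z \<noteq> 0" unfolding nth_root_error_def by (auto split: if_splits)
    then have "root n (cmod (c - poly (p n) z / poly (q n) z)) < \<sigma>"
      using elim unfolding nth_root_error_def by simp
    then have "root n (cmod (c - poly (p n) z / poly (q n) z)) ^ n \<le> \<sigma> ^ n"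
      using elim by (intro power_mono) auto
    then show ?case using elim nz by (simp add: real_root_pow_pos2)
  qed
  have ev2: "\<forall>\<^sub>F n in sequentially. poly (q (Suc n)) z \<noteq> 0 \<and>
      cmod (c - poly (p (Suc n)) z / poly (q (Suc n)) z) \<le> \<sigma> ^ Suc n"
    by (rule eventually_compose_filterlim[OF ev1 filterlim_Suc])
  \<comment> \<open>With \<open>\<sigma> = U(z) / r3\<close>, the rate of convergence, this choice makes \<open>\<sigma> / b = 1 / r\<close>; the slack
    between \<open>r\<close> and \<open>r3\<close> pays for the lower bound of \<open>\<bar>w\<^sub>n(z)\<bar>\<close>.\<close>
  define b where "b = U z * (r / r3)"
  have b: "0 < b" "b < U z" unfolding b_def using U0 r r3 r30 by (auto simp: field_simps)
  have ev3: "\<forall>\<^sub>F n in sequentially. b ^ Suc n \<le> cmod (poly (w (Suc n)) z)"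
    by (rule eventually_compose_filterlim[OF eventually_norm_w_ge[OF z b(2,1)] filterlim_Suc])
  define L where "L = max 1 (cmod z)"
  have L: "1 \<le> L" "cmod z \<le> L" unfolding L_def by auto
  define C where "C = L ^ m * L ^ m * (1 + \<sigma>) / b"
  have "\<forall>\<^sub>F n in sequentially. cmod (A n) \<le> C / r ^ n"
    using ev1 ev2 ev3 eventually_ge_at_top[of m]
  proof eventually_elim
    case (elim n)
    let ?a = "poly (p n) z / poly (q n) z" and ?b = "poly (p (Suc n)) z / poly (q (Suc n)) z"
    have Pq: "poly (P k) z = poly (Q k) z * (poly (p k) z / poly (q k) z)"
      if "m \<le> k" "poly (q k) z \<noteq> 0" for k
    proof -
      have "poly (P k * q k) z = poly (p k * Q k) z" using reduced[OF that(1)] by simp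
      then show ?thesis using that(2) by (simp add: field_simps)
    qed
    have "A n * poly (w (Suc n)) z = poly (Q n) z * poly (Q (Suc n)) z * (?b - ?a)"
      unfolding consecutive_difference[OF elim(4), symmetric]
      using Pq[of n] Pq[of "Suc n"] elim by (simp add: algebra_simps)
    then have "cmod (A n) * cmod (poly (w (Suc n)) z) = cmod (poly (Q n) z) * cmod (poly (Q (Suc n)) z) * cmod (?b - ?a)"
      by (metis norm_mult)
    also have "\<dots> \<le> (L ^ m * L ^ m) * ((1 + \<sigma>) * \<sigma> ^ n)"
    proof (intro mult_mono)
      show "cmod (poly (Q n) z) \<le> L ^ m"
        using norm_poly_le_coeff_norm[OF degree_Q L(2,1)] Q_normalized elim(4) by (metis mult_1)
      show "cmod (poly (Q (Suc n)) z) \<le> L ^ m"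
        using norm_poly_le_coeff_norm[OF degree_Q L(2,1), of "Suc n"] Q_normalized[of "Suc n"] elim(4) by simp
      have "cmod (?b - ?a) \<le> cmod (c - ?a) + cmod (c - ?b)"
        using norm_triangle_ineq4[of "c - ?a" "c - ?b"] by simp
      then show "cmod (?b - ?a) \<le> (1 + \<sigma>) * \<sigma> ^ n" using elim by (simp add: algebra_simps)
    qed (use L \<sigma> in auto)
    finally have "cmod (A n) * b ^ Suc n \<le> (L ^ m * L ^ m) * ((1 + \<sigma>) * \<sigma> ^ n)"
      using mult_left_mono[OF elim(3), of "cmod (A n)"] by simp
    then have "cmod (A n) \<le> (L ^ m * L ^ m) * ((1 + \<sigma>) * \<sigma> ^ n) / b ^ Suc n"
      using b by (simp add: pos_le_divide_eq)
    also have "\<dots> = C * (\<sigma> / b) ^ n" unfolding C_def using b by (simp add: power_divide)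
    also have "\<sigma> / b = 1 / r" unfolding \<sigma>_def b_def using U0 r r30 by (simp add: field_simps)
    finally show ?case by (simp add: power_divide)
  qed
  then show ?thesis by blast
qed

text \<open>
  On a circle that keeps a distance of order \<open>1 / k\<^sup>2\<close> from the zeros of all \<open>Q\<^sub>k\<close> at once, the
  telescoping series is dominated by a geometric series times a power of \<open>k\<close>. This bounds
  \<open>P\<^sub>n = Q\<^sub>n (P\<^sub>n / Q\<^sub>n)\<close> on the circle, hence inside it. It does not matter where the zeros of the
  denominators inside the circle are, or whether they converge.
\<close>

lemma P_locally_bounded:
  fixes R :: ereal
  assumes decay: "\<And>r. 0 < r \<Longrightarrow> ereal r < R \<Longrightarrow> \<exists>C. \<forall>\<^sub>F n in sequentially. cmod (A n) \<le> C / r ^ n"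
    and x0: "x0 \<in> level_set \<mu> R"
  obtains e M where "0 < e" "\<And>n x. m \<le> n \<Longrightarrow> x \<in> ball x0 e \<Longrightarrow> cmod (poly (P n) x) \<le> M"
proof -
  have "ereal (U x0) < R" using x0 unfolding level_set_def by simp
  then obtain r2 where r2: "U x0 < r2" "ereal r2 < R" using ereal_dense2 by (metis less_ereal.simps(1))
  then obtain r1 where r1: "U x0 < r1" "r1 < r2" using dense by blast
  have r10: "0 < r1" using r1 exp_neg_potential_nonneg[of x0] by simp
  have r20: "0 < r2" using r1 r10 by simp
  obtain e where e: "0 < e" "\<forall>\<^sub>F n in sequentially. \<forall>x\<in>ball x0 e. cmod (poly (w n) x) \<le> r1 ^ n"
    using eventually_norm_w_le[OF r1(1)] by blast
  obtain C' where C': "\<forall>\<^sub>F n in sequentially. cmod (A n) \<le> C' / r2 ^ n" using decay[OF r20 r2(2)] by blast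
  obtain N1 where N1: "\<And>n x. N1 \<le> n \<Longrightarrow> x \<in> ball x0 e \<Longrightarrow> cmod (poly (w n) x) \<le> r1 ^ n"
    using e(2) unfolding eventually_sequentially by blast
  obtain N2 where N2: "\<And>n. N2 \<le> n \<Longrightarrow> cmod (A n) \<le> C' / r2 ^ n"
    using C' unfolding eventually_sequentially by blast
  define n0 where "n0 = max m (max N1 N2)"
  have n0: "m \<le> n0" "N1 \<le> n0" "N2 \<le> n0" unfolding n0_def by auto
  define C where "C = max 0 C'"
  have C: "0 \<le> C" "cmod (A n) \<le> C / r2 ^ n" if "N2 \<le> n" for n
  proof -
    show "0 \<le> C" unfolding C_def by simp
    have "C' / r2 ^ n \<le> C / r2 ^ n" unfolding C_def using r20 by (intro divide_right_mono) auto
    then show "cmod (A n) \<le> C / r2 ^ n" using N2[OF that] by simp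
  qed
  define L where "L = max 1 (cmod x0 + e)"
  have L: "1 \<le> L" and inL: "cmod x \<le> L" if "dist x0 x < e" for x
  proof -
    show "1 \<le> L" unfolding L_def by simp
    have "cmod x \<le> cmod x0 + dist x0 x" using norm_triangle_ineq2[of x x0] by (simp add: dist_norm norm_minus_commute)
    then show "cmod x \<le> L" unfolding L_def using that by simp
  qed
  have L1: "1 \<le> L" unfolding L_def by simp
  \<comment> \<open>A good set plays the role of the zero set of \<open>Q (n0 + k)\<close>: away from it, the polynomial is
    bounded below.\<close>
  define good where "good k \<Xi> \<longleftrightarrow> finite \<Xi> \<and> card \<Xi> \<le> m \<and>
    (\<forall>x \<epsilon>. cmod x \<le> L \<longrightarrow> 0 < \<epsilon> \<longrightarrow> \<epsilon> \<le> 1 \<longrightarrow> (\<forall>\<xi>\<in>\<Xi>. \<epsilon> \<le> cmod (x - \<xi>)) \<longrightarrow>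
       coeff_norm (Q (n0 + k)) * (\<epsilon> / (4 * L)) ^ m \<le> cmod (poly (Q (n0 + k)) x))" for k \<Xi>
  have "\<exists>\<Xi>. good k \<Xi>" for k
    unfolding good_def using n0(1) by (intro poly_lower_bound_off_roots[OF L1] degree_Q) simp
  then obtain \<Xi> where good: "\<And>k. good k (\<Xi> k)" by metis
  have \<Xi>: "finite (\<Xi> k)" "card (\<Xi> k) \<le> m" for k using good[of k] unfolding good_def by auto
  have \<Xi>3: "coeff_norm (Q (n0 + k)) * (\<epsilon> / (4 * L)) ^ m \<le> cmod (poly (Q (n0 + k)) x)"
    if "cmod x \<le> L" "0 < \<epsilon>" "\<epsilon> \<le> 1" "\<forall>\<xi>\<in>\<Xi> k. \<epsilon> \<le> cmod (x - \<xi>)" for k x \<epsilon>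
    using good[of k] that unfolding good_def by blast
  obtain t c where t: "e / 2 < t" "t < e" and c: "0 < c" "c \<le> 1"
    and avoid: "\<And>k \<xi> x. \<xi> \<in> \<Xi> k \<Longrightarrow> cmod (x - x0) = t \<Longrightarrow> c / (real k + 1) ^ 2 \<le> cmod (x - \<xi>)"
    by (rule radius_avoiding_finite_sets[OF e(1) \<Xi>, where ?x0.0 = x0]) (rule that)
  define \<kappa> where "\<kappa> = c / (4 * L)"
  have \<kappa>: "0 < \<kappa>" unfolding \<kappa>_def using c L1 by simp
  define lb where "lb k = (\<kappa> / (real k + 1) ^ 2) ^ m" for k
  have lb0: "0 < lb k" for k unfolding lb_def using \<kappa> by (intro zero_less_power divide_pos_pos) auto
  have Qlb: "lb k \<le> cmod (poly (Q (n0 + k)) x)" if x: "cmod (x - x0) = t" for k x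
  proof -
    have "dist x0 x < e" using x t by (simp add: dist_norm norm_minus_commute)
    then have xL: "cmod x \<le> L" by (rule inL)
    have k1: "1 \<le> (real k + 1) ^ 2" by (simp add: power2_eq_square algebra_simps)
    have "c / (real k + 1) ^ 2 \<le> c" using c k1 by (simp add: divide_le_eq mult_le_cancel_left1)
    then have c1: "c / (real k + 1) ^ 2 \<le> 1" using c(2) by linarith
    have c2: "0 < c / (real k + 1) ^ 2" using c(1) k1 by (intro divide_pos_pos) linarith+
    have "coeff_norm (Q (n0 + k)) * (c / (real k + 1) ^ 2 / (4 * L)) ^ m \<le> cmod (poly (Q (n0 + k)) x)"
      using avoid[OF _ x] by (intro \<Xi>3[OF xL c2 c1]) blast
    then show ?thesis using Q_normalized[of "n0 + k"] n0(1) unfolding lb_def \<kappa>_def by (simp add: mult.commute)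
  qed
  define \<theta> where "\<theta> = r1 / r2"
  have \<theta>: "0 < \<theta>" "\<theta> < 1" unfolding \<theta>_def using r1 r10 r20 by auto
  define K where "K = C * \<theta> ^ n0 * r1 / (\<kappa> ^ m * \<kappa> ^ m)"
  have K0: "0 \<le> K" unfolding K_def using C(1)[of N2] \<theta> r10 \<kappa> by simp
  define g where "g k = K * (\<theta> ^ k * ((real k + 1) * (real k + 2)) ^ (2 * m))" for k
  have g: "summable g" "\<And>k. 0 \<le> g k"
    unfolding g_def using summable_geometric_times_power[OF \<theta>] K0 \<theta>
    by (auto intro!: summable_mult mult_nonneg_nonneg)
  have step: "cmod (poly (P (n0 + Suc k)) x / poly (Q (n0 + Suc k)) x - poly (P (n0 + k)) x / poly (Q (n0 + k)) x) \<le> g k"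
    if x: "cmod (x - x0) = t" for x k
  proof -
    let ?n = "n0 + k"
    have nz: "poly (Q ?n) x \<noteq> 0" "poly (Q (Suc ?n)) x \<noteq> 0"
      using Qlb[OF x, of k] Qlb[OF x, of "Suc k"] lb0[of k] lb0[of "Suc k"] by auto
    have "poly (P (Suc ?n)) x / poly (Q (Suc ?n)) x - poly (P ?n) x / poly (Q ?n) x
       = A ?n * poly (w (Suc ?n)) x / (poly (Q ?n) x * poly (Q (Suc ?n)) x)"
      using consecutive_difference[of ?n x] n0(1) nz by (simp add: diff_frac_eq mult.commute)
    then have "cmod (poly (P (Suc ?n)) x / poly (Q (Suc ?n)) x - poly (P ?n) x / poly (Q ?n) x)
       = cmod (A ?n) * cmod (poly (w (Suc ?n)) x) / (cmod (poly (Q ?n) x) * cmod (poly (Q (Suc ?n)) x))"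
      by (simp add: norm_divide norm_mult)
    also have "\<dots> \<le> (C / r2 ^ ?n * r1 ^ Suc ?n) / (lb k * lb (Suc k))"
    proof (intro frac_le mult_mono)
      show "cmod (A ?n) \<le> C / r2 ^ ?n" using C(2)[of ?n] n0 by simp
      show "cmod (poly (w (Suc ?n)) x) \<le> r1 ^ Suc ?n"
        using n0 x t by (intro N1) (auto simp: dist_norm norm_minus_commute)
      show "lb (Suc k) \<le> cmod (poly (Q (Suc ?n)) x)" using Qlb[OF x, of "Suc k"] by simp
    qed (use Qlb[OF x, of k] lb0 C(1)[of N2] r10 r20 in \<open>auto intro: less_imp_le mult_pos_pos\<close>)
    also have "\<dots> = g k"
    proof -
      have 1: "C / r2 ^ ?n * r1 ^ Suc ?n = C * r1 * \<theta> ^ n0 * \<theta> ^ k"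
        unfolding \<theta>_def by (simp add: power_divide power_add)
      have 2: "lb k * lb (Suc k) = \<kappa> ^ m * \<kappa> ^ m / ((real k + 1) * (real k + 2)) ^ (2 * m)"
        unfolding lb_def by (simp add: power_divide power_mult power_mult_distrib add.commute add.left_commute)
      show ?thesis unfolding 1 2 g_def K_def by simp
    qed
    finally show ?thesis by simp
  qed
  define B where "B n = coeff_norm (P n) * L ^ degree (P n)" for n
  have B: "cmod (poly (P n) x) \<le> B n" if "dist x0 x < e" for n x
    unfolding B_def using norm_poly_le_coeff_norm[OF order_refl inL[OF that] L1] .
  have B0: "0 \<le> B n" for n unfolding B_def using L1 by simp
  define M1 where "M1 = L ^ m * (B n0 / lb 0 + suminf g)"
  have circle: "cmod (poly (P (n0 + k)) x) \<le> M1" if x: "cmod (x - x0) = t" for k x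
  proof -
    have dx: "dist x0 x < e" using x t by (simp add: dist_norm norm_minus_commute)
    have nz: "poly (Q (n0 + k)) x \<noteq> 0" using Qlb[OF x, of k] lb0[of k] by auto
    have "cmod (poly (P (n0 + k)) x / poly (Q (n0 + k)) x)
       \<le> cmod (poly (P (n0 + 0)) x / poly (Q (n0 + 0)) x) + suminf g"
      by (rule telescoping_bound[where c = "\<lambda>k. poly (P (n0 + k)) x / poly (Q (n0 + k)) x" and ?n0.0 = 0])
         (use step[OF x] g in auto)
    also have "cmod (poly (P (n0 + 0)) x / poly (Q (n0 + 0)) x) \<le> B n0 / lb 0"
      unfolding norm_divide using B[OF dx, of n0] Qlb[OF x, of 0] lb0[of 0] B0 by (intro frac_le) auto
    finally have 1: "cmod (poly (P (n0 + k)) x / poly (Q (n0 + k)) x) \<le> B n0 / lb 0 + suminf g" by simp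
    have "cmod (poly (P (n0 + k)) x) = cmod (poly (Q (n0 + k)) x) * cmod (poly (P (n0 + k)) x / poly (Q (n0 + k)) x)"
      using nz by (simp add: norm_divide)
    also have "\<dots> \<le> L ^ m * (B n0 / lb 0 + suminf g)"
    proof (rule mult_mono[OF _ 1])
      show "cmod (poly (Q (n0 + k)) x) \<le> L ^ m"
        using norm_poly_le_coeff_norm[OF degree_Q inL[OF dx] L1, of "n0 + k"] Q_normalized[of "n0 + k"] n0 by simp
    qed (use L1 in auto)
    finally show ?thesis unfolding M1_def .
  qed
  have large: "cmod (poly (P (n0 + k)) x) \<le> M1" if x: "x \<in> ball x0 (e / 2)" for k x
  proof (rule maximum_modulus_frontier[where S = "cball x0 t" and f = "poly (P (n0 + k))"])
    show "x \<in> cball x0 t" using x t by auto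
    show "cmod (poly (P (n0 + k)) y) \<le> M1" if "y \<in> frontier (cball x0 t)" for y
      using that t e by (intro circle) (auto simp: dist_norm norm_minus_commute)
  qed (auto intro!: holomorphic_intros continuous_intros)
  define M where "M = max M1 (\<Sum>n<n0. B n)"
  have bnd: "cmod (poly (P n) x) \<le> M" if x: "x \<in> ball x0 (e / 2)" for n x
  proof (cases "n0 \<le> n")
    case True
    then obtain k where "n = n0 + k" using le_Suc_ex by blast
    then show ?thesis using large[OF x, of k] unfolding M_def by simp
  next
    case False
    have "cmod (poly (P n) x) \<le> B n" using x e by (intro B) auto
    also have "\<dots> \<le> (\<Sum>n<n0. B n)" using False B0 by (intro member_le_sum) auto
    finally show ?thesis unfolding M_def by simp
  qed
  show ?thesis
  proof (rule that)
    show "0 < e / 2" using e(1) by simp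
    show "cmod (poly (P n) x) \<le> M" if "x \<in> ball x0 (e / 2)" for n x using bnd[OF that] .
  qed
qed

lemma P_bounded_on_compact:
  fixes R :: ereal
  assumes decay: "\<And>r. 0 < r \<Longrightarrow> ereal r < R \<Longrightarrow> \<exists>C. \<forall>\<^sub>F n in sequentially. cmod (A n) \<le> C / r ^ n"
    and K: "compact K" "K \<subseteq> level_set \<mu> R"
  obtains M where "\<And>n x. m \<le> n \<Longrightarrow> x \<in> K \<Longrightarrow> cmod (poly (P n) x) \<le> M"
proof -
  have "\<exists>e M. 0 < e \<and> (\<forall>n\<ge>m. \<forall>x\<in>ball x0 e. cmod (poly (P n) x) \<le> M)" if "x0 \<in> K" for x0
    using P_locally_bounded[OF decay, of R x0] that K(2) by (metis subsetD)
  then obtain e M where eM: "\<And>x0. x0 \<in> K \<Longrightarrow> 0 < e x0"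
    "\<And>x0 n x. x0 \<in> K \<Longrightarrow> m \<le> n \<Longrightarrow> x \<in> ball x0 (e x0) \<Longrightarrow> cmod (poly (P n) x) \<le> M x0"
    by metis
  obtain D where D: "D \<subseteq> K" "finite D" "K \<subseteq> (\<Union>x0\<in>D. ball x0 (e x0))"
    by (rule compactE_image[OF K(1), of K "\<lambda>x0. ball x0 (e x0)"]) (use eM(1) in auto)
  have "cmod (poly (P n) x) \<le> (\<Sum>x0\<in>D. \<bar>M x0\<bar>)" if n: "m \<le> n" and x: "x \<in> K" for n x
  proof -
    obtain x0 where x0: "x0 \<in> D" "x \<in> ball x0 (e x0)" using D(3) x by blast
    have "cmod (poly (P n) x) \<le> \<bar>M x0\<bar>" using eM(2)[of x0 n x] x0 D(1) n by fastforce
    also have "\<dots> \<le> (\<Sum>x0\<in>D. \<bar>M x0\<bar>)" using D(2) x0(1) by (intro member_le_sum) auto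
    finally show ?thesis .
  qed
  then show ?thesis using that by blast
qed

text \<open>
  A subsequence suffices: whatever limit arises is a candidate for the continuation, and it will be
  identified by its agreement with \<open>f\<close>.
\<close>

lemma limit_function_exists:
  fixes R :: ereal
  assumes decay: "\<And>r. 0 < r \<Longrightarrow> ereal r < R \<Longrightarrow> \<exists>C. \<forall>\<^sub>F n in sequentially. cmod (A n) \<le> C / r ^ n"
  obtains \<sigma> g Q' where "filterlim \<sigma> at_top sequentially" "\<And>n. m \<le> \<sigma> n"
    "g holomorphic_on level_set \<mu> R" "degree Q' \<le> m" "Q' \<noteq> 0"
    "\<And>x. x \<in> level_set \<mu> R \<Longrightarrow> (\<lambda>n. poly (P (\<sigma> n)) x) \<longlonglongrightarrow> g x"
    "\<And>x. (\<lambda>n. poly (Q (\<sigma> n)) x) \<longlonglongrightarrow> poly Q' x"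
proof -
  define F where "F n = poly (P (n + m))" for n
  obtain g r where g: "g holomorphic_on level_set \<mu> R" "strict_mono (r :: nat \<Rightarrow> nat)"
    "\<And>x. x \<in> level_set \<mu> R \<Longrightarrow> ((\<lambda>n. F (r n) x) \<longlongrightarrow> g x) sequentially"
  proof (rule Montel[of "level_set \<mu> R" "range F" F])
    show "open (level_set \<mu> R)" by (rule open_level_set_ereal)
    show "h holomorphic_on level_set \<mu> R" if "h \<in> range F" for h
      using that unfolding F_def by (auto intro!: holomorphic_intros)
    fix K assume "compact K" "K \<subseteq> level_set \<mu> R"
    then obtain M where "\<And>n x. m \<le> n \<Longrightarrow> x \<in> K \<Longrightarrow> cmod (poly (P n) x) \<le> M"
      using P_bounded_on_compact[OF decay, of R K] by metis
    then show "\<exists>B. \<forall>h\<in>range F. \<forall>z\<in>K. cmod (h z) \<le> B"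
      unfolding F_def by (intro exI[of _ M]) auto
  qed auto
  obtain r' Q' where Q': "strict_mono (r' :: nat \<Rightarrow> nat)" "degree Q' \<le> m" "Q' \<noteq> 0"
    "\<And>x. (\<lambda>n. poly (Q (r (r' n) + m)) x) \<longlonglongrightarrow> poly Q' x"
    by (rule polys_convergent_subsequence[of "\<lambda>n. Q (r n + m)" m]) (use degree_Q Q_normalized in auto)
  define \<sigma> where "\<sigma> n = r (r' n) + m" for n
  show ?thesis
  proof (rule that[of \<sigma> g Q'])
    have "strict_mono \<sigma>" unfolding \<sigma>_def using g(2) Q'(1) by (simp add: strict_mono_def)
    then show "filterlim \<sigma> at_top sequentially" by (rule filterlim_subseq)
    show "m \<le> \<sigma> n" for n unfolding \<sigma>_def by simp
    show "(\<lambda>n. poly (P (\<sigma> n)) x) \<longlonglongrightarrow> g x" if "x \<in> level_set \<mu> R" for x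
      using LIMSEQ_subseq_LIMSEQ[OF g(3)[OF that] Q'(1)] unfolding F_def \<sigma>_def o_def .
    show "(\<lambda>n. poly (Q (\<sigma> n)) x) \<longlonglongrightarrow> poly Q' x" for x unfolding \<sigma>_def by (rule Q'(4))
  qed (use g Q' in auto)
qed

end

section \<open>Interpolation at the support forces agreement\<close>

text \<open>
  Schwarz's lemma for many zeros: each zero near the centre gains a factor \<open>1 / 2\<close>, the ratio of
  its largest distance from the small ball to its least distance from the large circle.
\<close>

lemma schwarz_bound_many_zeros:
  fixes k :: "complex \<Rightarrow> complex"
  assumes hol: "k holomorphic_on cball s d" and "0 < d" and Z: "finite Z" "Z \<subseteq> ball s (d / 5)"
    and bound: "\<And>y. y \<in> cball s d \<Longrightarrow> cmod (k y * (\<Prod>\<xi>\<in>Z. (y - \<xi>) ^ o' \<xi>)) \<le> M"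
    and x: "x \<in> ball s (d / 5)"
  shows "cmod (k x * (\<Prod>\<xi>\<in>Z. (x - \<xi>) ^ o' \<xi>)) \<le> M * (1 / 2) ^ (\<Sum>\<xi>\<in>Z. o' \<xi>)"
proof -
  define N where "N = (\<Sum>\<xi>\<in>Z. o' \<xi>)"
  have pr: "cmod (\<Prod>\<xi>\<in>Z. (y - \<xi>) ^ o' \<xi>) = (\<Prod>\<xi>\<in>Z. cmod (y - \<xi>) ^ o' \<xi>)" for y
    by (simp add: prod_norm[symmetric] norm_power)
  have M0: "0 \<le> M" using bound[of s] \<open>0 < d\<close> by (meson centre_in_cball less_imp_le norm_ge_zero order_trans)
  have circ: "cmod (k y) \<le> M / (4 * d / 5) ^ N" if y: "y \<in> frontier (cball s d)" for y
  proof -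
    have yd: "dist s y = d" using y \<open>0 < d\<close> by simp
    have "(4 * d / 5) ^ N = (\<Prod>\<xi>\<in>Z. (4 * d / 5) ^ o' \<xi>)" unfolding N_def by (rule power_sum)
    also have "\<dots> \<le> (\<Prod>\<xi>\<in>Z. cmod (y - \<xi>) ^ o' \<xi>)"
    proof (intro prod_mono conjI power_mono)
      fix \<xi> assume "\<xi> \<in> Z"
      then have "dist s \<xi> < d / 5" using Z(2) by auto
      then show "4 * d / 5 \<le> cmod (y - \<xi>)"
        using yd dist_triangle[of s y \<xi>] by (simp add: dist_norm norm_minus_commute)
    qed (use \<open>0 < d\<close> in auto)
    finally have lo: "(4 * d / 5) ^ N \<le> (\<Prod>\<xi>\<in>Z. cmod (y - \<xi>) ^ o' \<xi>)" .
    have "cmod (k y) * (4 * d / 5) ^ N \<le> cmod (k y) * (\<Prod>\<xi>\<in>Z. cmod (y - \<xi>) ^ o' \<xi>)"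
      using lo by (intro mult_left_mono) auto
    also have "\<dots> = cmod (k y * (\<Prod>\<xi>\<in>Z. (y - \<xi>) ^ o' \<xi>))" by (simp add: norm_mult pr)
    also have "\<dots> \<le> M" using yd by (intro bound) simp
    finally show ?thesis using \<open>0 < d\<close> by (simp add: pos_le_divide_eq)
  qed
  have kx: "cmod (k x) \<le> M / (4 * d / 5) ^ N"
  proof (rule maximum_modulus_frontier[where S = "cball s d" and f = k])
    show "k holomorphic_on interior (cball s d)" using hol by (rule holomorphic_on_subset) (rule interior_subset)
    show "continuous_on (closure (cball s d)) k" using hol by (simp add: holomorphic_on_imp_continuous_on)
    show "x \<in> cball s d" using x \<open>0 < d\<close> by auto
  qed (use circ in auto)
  have "(\<Prod>\<xi>\<in>Z. cmod (x - \<xi>) ^ o' \<xi>) \<le> (\<Prod>\<xi>\<in>Z. (2 * d / 5) ^ o' \<xi>)"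
  proof (intro prod_mono conjI power_mono)
    fix \<xi> assume "\<xi> \<in> Z"
    then have "dist s \<xi> < d / 5" "dist s x < d / 5" using Z(2) x by auto
    then show "cmod (x - \<xi>) \<le> 2 * d / 5"
      using dist_triangle[of x \<xi> s] by (simp add: dist_norm norm_minus_commute)
  qed auto
  also have "\<dots> = (2 * d / 5) ^ N" unfolding N_def by (rule power_sum[symmetric])
  finally have px: "(\<Prod>\<xi>\<in>Z. cmod (x - \<xi>) ^ o' \<xi>) \<le> (2 * d / 5) ^ N" .
  have "cmod (k x * (\<Prod>\<xi>\<in>Z. (x - \<xi>) ^ o' \<xi>)) = cmod (k x) * (\<Prod>\<xi>\<in>Z. cmod (x - \<xi>) ^ o' \<xi>)"
    by (simp add: norm_mult pr)
  also have "\<dots> \<le> M / (4 * d / 5) ^ N * (2 * d / 5) ^ N"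
    using kx px M0 \<open>0 < d\<close> by (intro mult_mono) (auto intro!: prod_nonneg)
  also have "\<dots> = M * ((2 * d / 5) / (4 * d / 5)) ^ N" by (simp only: power_divide[of "2 * d / 5" "4 * d / 5"] times_divide_eq_left times_divide_eq_right)
  also have "(2 * d / 5) / (4 * d / 5) = 1 / 2" using \<open>0 < d\<close> by simp
  finally show ?thesis unfolding N_def .
qed

context pade_row
begin

text \<open>
  The remainders \<open>Q\<^sub>n f - P\<^sub>n\<close> are bounded near \<open>s\<close> and vanish at a number of zeros of \<open>w\<^sub>n\<^sub>+\<^sub>1\<close>, counted
  with multiplicity, that tends to infinity. So they tend to \<open>0\<close>.
\<close>

lemma limit_interpolates_at_support:
  fixes R :: ereal
  assumes decay: "\<And>r. 0 < r \<Longrightarrow> ereal r < R \<Longrightarrow> \<exists>C. \<forall>\<^sub>F n in sequentially. cmod (A n) \<le> C / r ^ n"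
    and \<sigma>: "filterlim \<sigma> at_top sequentially" "\<And>n. m \<le> \<sigma> n"
    and P: "\<And>x. x \<in> level_set \<mu> R \<Longrightarrow> (\<lambda>n. poly (P (\<sigma> n)) x) \<longlonglongrightarrow> g x"
    and Q: "\<And>x. (\<lambda>n. poly (Q (\<sigma> n)) x) \<longlonglongrightarrow> poly Q' x"
    and s: "s \<in> support" "s \<in> level_set \<mu> R"
  obtains e where "0 < e" "ball s e \<subseteq> V \<inter> level_set \<mu> R"
    "\<And>x. x \<in> ball s e \<Longrightarrow> poly Q' x * f x = g x"
proof -
  have "open (V \<inter> level_set \<mu> R)" "s \<in> V \<inter> level_set \<mu> R"
    using open_V open_level_set_ereal support_subset S_subset_V s by auto
  then obtain d where d: "0 < d" "cball s d \<subseteq> V \<inter> level_set \<mu> R" using open_contains_cball by blast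
  obtain MP where MP: "\<And>n x. m \<le> n \<Longrightarrow> x \<in> cball s d \<Longrightarrow> cmod (poly (P n) x) \<le> MP"
    using P_bounded_on_compact[OF decay compact_cball, of R s d] d(2) by auto
  have "continuous_on (cball s d) f"
    using f_analytic d(2) by (meson analytic_imp_holomorphic continuous_on_subset holomorphic_on_imp_continuous_on le_inf_iff)
  then have "bounded (f ` cball s d)" by (intro compact_imp_bounded compact_continuous_image compact_cball)
  then obtain Mf where Mf: "\<And>x. x \<in> cball s d \<Longrightarrow> cmod (f x) \<le> Mf" unfolding bounded_iff by blast
  define L where "L = max 1 (cmod s + d)"
  have L: "1 \<le> L" unfolding L_def by simp
  have xL: "cmod x \<le> L" if "x \<in> cball s d" for x
    using that norm_triangle_ineq2[of x s] unfolding L_def by (simp add: dist_norm norm_minus_commute)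
  define M where "M = L ^ m * Mf + MP"
  have FM: "cmod (poly (Q n) x * f x - poly (P n) x) \<le> M" if n: "m \<le> n" and x: "x \<in> cball s d" for n x
  proof -
    have "cmod (poly (Q n) x) \<le> L ^ m"
      using norm_poly_le_coeff_norm[OF degree_Q[OF n] xL[OF x] L] Q_normalized[OF n] by simp
    then have "cmod (poly (Q n) x * f x) \<le> L ^ m * Mf"
      unfolding norm_mult using Mf[OF x] L by (intro mult_mono) auto
    then show ?thesis
      using norm_triangle_ineq4[of "poly (Q n) x * f x" "poly (P n) x"] MP[OF n x] unfolding M_def by simp
  qed
  define N where "N n = (\<Sum>\<xi> | poly (w n) \<xi> = 0 \<and> \<xi> \<in> ball s (d / 5). order \<xi> (w n))" for n
  have limN: "filterlim N at_top sequentially"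
    unfolding N_def by (rule zeros_accumulate_at_support[OF s(1)]) (use d in simp)
  have small: "cmod (poly (Q n) x * f x - poly (P n) x) \<le> M * (1 / 2) ^ N (Suc n)"
    if n: "m \<le> n" and x: "x \<in> ball s (d / 5)" for n x
  proof -
    obtain h where h: "h analytic_on V"
      "\<And>\<zeta>. \<zeta> \<in> V \<Longrightarrow> poly (Q n) \<zeta> * f \<zeta> - poly (P n) \<zeta> = h \<zeta> * poly (w (Suc n)) \<zeta>"
      using remainder[OF n] by blast
    let ?A = "{\<xi>. poly (w (Suc n)) \<xi> = 0}"
    define Z where "Z = {\<xi>. poly (w (Suc n)) \<xi> = 0 \<and> \<xi> \<in> ball s (d / 5)}"
    define k where "k y = h y * (\<Prod>\<xi>\<in>?A - Z. (y - \<xi>) ^ order \<xi> (w (Suc n)))" for y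
    have ZA: "Z \<subseteq> ?A" unfolding Z_def by auto
    have wprod: "poly (w (Suc n)) y = (\<Prod>\<xi>\<in>?A - Z. (y - \<xi>) ^ order \<xi> (w (Suc n))) *
        (\<Prod>\<xi>\<in>Z. (y - \<xi>) ^ order \<xi> (w (Suc n)))" for y
    proof -
      have "w (Suc n) = (\<Prod>z\<in>?A. [:-z, 1:] ^ order z (w (Suc n)))"
        using complex_poly_decompose[of "w (Suc n)"] monic[of "Suc n"] by simp
      then have "poly (w (Suc n)) y = poly (\<Prod>z\<in>?A. [:-z, 1:] ^ order z (w (Suc n))) y" by simp
      also have "\<dots> = (\<Prod>\<xi>\<in>?A. (y - \<xi>) ^ order \<xi> (w (Suc n)))" by (simp add: poly_prod)
      also have "\<dots> = (\<Prod>\<xi>\<in>?A - Z. (y - \<xi>) ^ order \<xi> (w (Suc n))) *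
        (\<Prod>\<xi>\<in>Z. (y - \<xi>) ^ order \<xi> (w (Suc n)))"
        by (rule prod.subset_diff[OF ZA finite_zeros])
      finally show ?thesis .
    qed
    have eq: "poly (Q n) y * f y - poly (P n) y = k y * (\<Prod>\<xi>\<in>Z. (y - \<xi>) ^ order \<xi> (w (Suc n)))"
      if "y \<in> V" for y
    proof -
      have "poly (Q n) y * f y - poly (P n) y = h y * poly (w (Suc n)) y" by (rule h(2)[OF that])
      also have "\<dots> = h y * ((\<Prod>\<xi>\<in>?A - Z. (y - \<xi>) ^ order \<xi> (w (Suc n))) *
        (\<Prod>\<xi>\<in>Z. (y - \<xi>) ^ order \<xi> (w (Suc n))))" by (rule arg_cong[OF wprod])
      also have "\<dots> = k y * (\<Prod>\<xi>\<in>Z. (y - \<xi>) ^ order \<xi> (w (Suc n)))"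
        unfolding k_def by (rule mult.assoc[symmetric])
      finally show ?thesis .
    qed
    have dV: "cball s d \<subseteq> V" using d(2) by blast
    have "h holomorphic_on cball s d"
      by (rule holomorphic_on_subset[OF analytic_imp_holomorphic[OF h(1)] dV])
    then have kh: "k holomorphic_on cball s d" unfolding k_def by (intro holomorphic_intros)
    have "cmod (k x * (\<Prod>\<xi>\<in>Z. (x - \<xi>) ^ order \<xi> (w (Suc n)))) \<le> M * (1 / 2) ^ (\<Sum>\<xi>\<in>Z. order \<xi> (w (Suc n)))"
    proof (rule schwarz_bound_many_zeros[OF kh d(1) _ _ _ x])
      show "finite Z" using finite_subset[OF ZA finite_zeros] .
      show "Z \<subseteq> ball s (d / 5)" unfolding Z_def by auto
      show "cmod (k y * (\<Prod>\<xi>\<in>Z. (y - \<xi>) ^ order \<xi> (w (Suc n)))) \<le> M" if "y \<in> cball s d" for y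
        using FM[OF n that] eq[of y] dV that by auto
    qed
    moreover have "x \<in> V" using x d dV by (auto intro!: subsetD[OF dV])
    ultimately show ?thesis using eq[of x] unfolding N_def Z_def by simp
  qed
  show ?thesis
  proof (rule that[of "d / 5"])
    show "0 < d / 5" using d by simp
    have sub: "ball s (d / 5) \<subseteq> cball s d" using d(1) by (intro subsetI) auto
    then show "ball s (d / 5) \<subseteq> V \<inter> level_set \<mu> R" using d(2) by blast
    fix x assume x: "x \<in> ball s (d / 5)"
    have xR: "x \<in> level_set \<mu> R" using x sub d(2) by blast
    have "(\<lambda>n. poly (Q (\<sigma> n)) x * f x - poly (P (\<sigma> n)) x) \<longlonglongrightarrow> poly Q' x * f x - g x"
      by (intro tendsto_intros Q P xR)
    moreover have "(\<lambda>n. poly (Q (\<sigma> n)) x * f x - poly (P (\<sigma> n)) x) \<longlonglongrightarrow> 0"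
    proof (rule Lim_null_comparison)
      show "\<forall>\<^sub>F n in sequentially. cmod (poly (Q (\<sigma> n)) x * f x - poly (P (\<sigma> n)) x) \<le> M * (1 / 2) ^ N (Suc (\<sigma> n))"
        using small[OF \<sigma>(2) x] by simp
      have "filterlim (\<lambda>n. N (Suc (\<sigma> n))) at_top sequentially"
        by (rule filterlim_compose[OF limN filterlim_compose[OF filterlim_Suc \<sigma>(1)]])
      moreover have "(\<lambda>n. M * (1 / 2) ^ n) \<longlonglongrightarrow> M * (0 :: real)"
        by (intro tendsto_intros LIMSEQ_power_zero) simp
      ultimately show "(\<lambda>n. M * (1 / 2) ^ N (Suc (\<sigma> n))) \<longlonglongrightarrow> 0"
        using filterlim_compose[of "\<lambda>n. M * (1 / 2) ^ n" _ sequentially] by fastforce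
    qed
    ultimately show "poly Q' x * f x = g x" using LIMSEQ_unique by fastforce
  qed
qed

end

section \<open>Meromorphic continuation by a quotient\<close>

lemma zorder_poly:
  fixes p :: "complex poly"
  assumes "p \<noteq> 0"
  shows "zorder (poly p) \<zeta> = int (order \<zeta> p)"
proof -
  obtain r where r: "p = [:-\<zeta>, 1:] ^ order \<zeta> p * r" "\<not> [:-\<zeta>, 1:] dvd r"
    using order_decomp[OF assms] by blast
  show ?thesis
  proof (rule zorder_eqI[of UNIV])
    show "poly r holomorphic_on UNIV" by (intro holomorphic_intros)
    show "poly r \<zeta> \<noteq> 0" using r(2) by (simp add: poly_eq_0_iff_dvd)
    fix w
    have "poly p w = poly ([:-\<zeta>, 1:] ^ order \<zeta> p * r) w" using r(1) by simp
    also have "\<dots> = poly r w * (w - \<zeta>) ^ order \<zeta> p" by simp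
    finally show "poly p w = poly r w * (w - \<zeta>) powi int (order \<zeta> p)"
      by (simp only: power_int_of_nat)
  qed auto
qed

lemma poly_analytic_at: "poly p analytic_on {\<zeta>::complex}"
  by (rule holomorphic_on_imp_analytic_at[of _ UNIV]) (auto intro!: holomorphic_intros)

lemma eventually_poly_nonzero:
  assumes "p \<noteq> (0 :: complex poly)"
  shows "\<forall>\<^sub>F x in at \<zeta>. poly p x \<noteq> 0"
proof -
  have "finite ({x. poly p x = 0} - {\<zeta>})" using poly_roots_finite[OF assms] by simp
  then have "open (- ({x. poly p x = 0} - {\<zeta>}))" by (intro open_Compl finite_imp_closed)
  then have "\<forall>\<^sub>F x in at \<zeta>. x \<in> - ({x. poly p x = 0} - {\<zeta>}) - {\<zeta>}"
    by (intro eventually_at_in_open) auto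
  then show ?thesis by eventually_elim auto
qed

text \<open>
  Dividing by \<open>Q\<close> lowers the order of a holomorphic function at \<open>\<zeta>\<close> by the multiplicity of \<open>\<zeta>\<close> as a
  zero of \<open>Q\<close>, and these multiplicities add up to at most the degree.
\<close>

lemma at_most_poles_quotient:
  assumes E: "open E" "g holomorphic_on E" and Q: "Q \<noteq> 0" "degree Q \<le> m"
    and G: "\<And>\<zeta>. \<zeta> \<in> E \<Longrightarrow> \<forall>\<^sub>F x in at \<zeta>. G x = g x / poly Q x"
  shows "at_most_poles G E m"
proof -
  have g_an: "g analytic_on {\<zeta>}" if "\<zeta> \<in> E" for \<zeta> using E that analytic_at by blast
  have roots: "poly Q \<zeta> = 0" if \<zeta>: "\<zeta> \<in> E" "is_pole G \<zeta>" for \<zeta>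
  proof (rule ccontr)
    assume nz: "poly Q \<zeta> \<noteq> 0"
    have "(\<lambda>x. g x / poly Q x) analytic_on {\<zeta>}"
      by (rule analytic_on_divide[OF g_an[OF \<zeta>(1)] poly_analytic_at]) (use nz in simp)
    then have "\<not> is_pole (\<lambda>x. g x / poly Q x) \<zeta>" using analytic_at not_is_pole_holomorphic by blast
    then show False using \<zeta>(2) is_pole_cong[OF G[OF \<zeta>(1)] refl] by blast
  qed
  have ord: "nat (- zorder G \<zeta>) \<le> order \<zeta> Q" if \<zeta>: "\<zeta> \<in> E" "is_pole G \<zeta>" for \<zeta>
  proof -
    have freq: "\<exists>\<^sub>F x in at \<zeta>. g x \<noteq> 0"
    proof (rule ccontr)
      assume "\<not> ?thesis"
      then have "\<forall>\<^sub>F x in at \<zeta>. g x = 0" by (simp add: not_frequently)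
      then have "\<forall>\<^sub>F x in at \<zeta>. G x = 0" using G[OF \<zeta>(1)] by eventually_elim simp
      then have "\<exists>\<^sub>F x in at \<zeta>. G x = 0" by (intro eventually_frequently) auto
      then show False using frequently_const_imp_not_is_pole \<zeta>(2) by blast
    qed
    have freqQ: "\<exists>\<^sub>F x in at \<zeta>. poly Q x \<noteq> 0"
      by (intro eventually_frequently eventually_poly_nonzero Q) auto
    have "zorder G \<zeta> = zorder (\<lambda>x. g x / poly Q x) \<zeta>" by (rule zorder_cong[OF G[OF \<zeta>(1)] refl])
    also have "\<dots> = zorder g \<zeta> - zorder (poly Q) \<zeta>"
      by (rule zorder_divide[OF _ freq _ freqQ])
         (intro analytic_on_imp_meromorphic_on g_an[OF \<zeta>(1)] poly_analytic_at)+
    also have "\<dots> = zorder g \<zeta> - int (order \<zeta> Q)" by (simp only: zorder_poly[OF Q(1)])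
    finally show ?thesis using zorder_ge_0[OF g_an[OF \<zeta>(1)] freq] by simp
  qed
  let ?poles = "{\<zeta> \<in> E. is_pole G \<zeta>}"
  have sub: "?poles \<subseteq> {\<zeta>. poly Q \<zeta> = 0}" using roots by blast
  have fin: "finite {\<zeta>. poly Q \<zeta> = 0}" by (rule poly_roots_finite[OF Q(1)])
  have "(\<Sum>\<zeta>\<in>?poles. nat (- zorder G \<zeta>)) \<le> (\<Sum>\<zeta>\<in>?poles. order \<zeta> Q)"
    using ord by (intro sum_mono) auto
  also have "\<dots> \<le> (\<Sum>\<zeta> | poly Q \<zeta> = 0. order \<zeta> Q)" using fin sub by (intro sum_mono2) auto
  also have "\<dots> \<le> m" using sum_order_le_degree[OF Q(1)] Q(2) by simp
  finally show ?thesis unfolding at_most_poles_def using finite_subset[OF sub fin] by simp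
qed

lemma continuation_from_quotient:
  assumes E: "open E" "g holomorphic_on E" and Q: "Q \<noteq> 0" "degree Q \<le> m"
    and V0: "open V0" "S \<subseteq> V0" "V0 \<subseteq> V" and f: "f analytic_on V0"
    and agree: "\<And>x. x \<in> V0 \<Longrightarrow> x \<in> E \<Longrightarrow> poly Q x * f x = g x"
  shows "meromorphic_continuation f S V m E"
proof -
  define h where "h = remove_sings (\<lambda>x. g x / poly Q x)"
  define G where "G x = (if x \<in> V0 then f x else h x)" for x
  have g_an: "g analytic_on {\<zeta>}" if "\<zeta> \<in> E" for \<zeta> using E that analytic_at by blast
  have f_an: "f analytic_on {\<zeta>}" if "\<zeta> \<in> V0" for \<zeta>
    by (rule analytic_on_subset[OF f]) (use that in simp)
  have mero: "(\<lambda>x. g x / poly Q x) meromorphic_on E"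
  proof (rule meromorphic_on_divide)
    show "g meromorphic_on E" using E by (intro analytic_on_imp_meromorphic_on) (simp add: analytic_on_open)
    show "poly Q meromorphic_on E"
      by (intro analytic_on_imp_meromorphic_on) (metis analytic_on_analytic_at poly_analytic_at)
  qed
  have nice_h: "h nicely_meromorphic_on E" unfolding h_def by (rule remove_sings_nicely_meromorphic[OF mero])
  have hf: "h x = f x" if x: "x \<in> V0" "x \<in> E" for x
  proof -
    have "\<forall>\<^sub>F y in at x. y \<in> V0 \<inter> E - {x}"
      using V0 E x by (intro eventually_at_in_open) auto
    then have "\<forall>\<^sub>F y in at x. g y / poly Q y = f y"
      using eventually_poly_nonzero[OF Q(1), of x]
      by eventually_elim (use agree in \<open>auto simp: field_simps\<close>)
    then have "h x = remove_sings f x" unfolding h_def by (rule remove_sings_cong) simp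
    also have "\<dots> = f x" by (rule remove_sings_at_analytic[OF f_an[OF x(1)]])
    finally show ?thesis .
  qed
  have GV: "G x = f x" if "x \<in> V0" for x using that unfolding G_def by simp
  have GE: "G x = h x" if "x \<in> E" for x using that hf unfolding G_def by simp
  have nearV: "\<forall>\<^sub>F y in at x. G y = f y" if "x \<in> V0" for x
    using eventually_at_in_open'[OF V0(1) that] by eventually_elim (rule GV)
  have nearE: "\<forall>\<^sub>F y in at x. G y = h y" if "x \<in> E" for x
    using eventually_at_in_open'[OF E(1) that] by eventually_elim (rule GE)
  have "G nicely_meromorphic_on (E \<union> V0)"
    unfolding nicely_meromorphic_on_def
  proof (intro conjI ballI)
    have 1: "G meromorphic_on E"
      using nice_h meromorphic_on_cong[of E G h E] nearE unfolding nicely_meromorphic_on_def by blast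
    have 2: "G meromorphic_on V0"
      using analytic_on_imp_meromorphic_on[OF f] meromorphic_on_cong[of V0 G f V0] nearV by blast
    show "G meromorphic_on (E \<union> V0)" by (rule meromorphic_on_Un[OF 1 2])
    fix x assume "x \<in> E \<union> V0"
    then consider "x \<in> V0" | "x \<in> E" by blast
    then show "is_pole G x \<and> G x = 0 \<or> G \<midarrow>x\<rightarrow> G x"
    proof cases
      case 1
      have "f \<midarrow>x\<rightarrow> f x" using analytic_at_imp_isCont[OF f_an[OF 1]] by (simp add: isCont_def)
      then have "G \<midarrow>x\<rightarrow> G x" unfolding GV[OF 1] using tendsto_cong[OF nearV[OF 1]] by blast
      then show ?thesis ..
    next
      case 2
      have "is_pole h x \<and> h x = 0 \<or> h \<midarrow>x\<rightarrow> h x" using nice_h 2 unfolding nicely_meromorphic_on_def by blast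
      then show ?thesis
        unfolding GE[OF 2] is_pole_cong[OF nearE[OF 2] refl] tendsto_cong[OF nearE[OF 2]] .
    qed
  qed
  moreover have "at_most_poles G E m"
  proof (rule at_most_poles_quotient[OF E Q])
    fix \<zeta> assume \<zeta>: "\<zeta> \<in> E"
    have "isolated_singularity_at (\<lambda>x. g x / poly Q x) \<zeta>"
      using mero \<zeta> unfolding meromorphic_on_altdef by blast
    then have "\<forall>\<^sub>F x in at \<zeta>. h x = g x / poly Q x" unfolding h_def by (rule eventually_remove_sings_eq_at)
    then show "\<forall>\<^sub>F x in at \<zeta>. G x = g x / poly Q x" using nearE[OF \<zeta>] by eventually_elim simp
  qed
  ultimately show ?thesis unfolding meromorphic_continuation_def using V0 GV by blast
qed

lemma meromorphic_continuation_subset: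
  assumes "meromorphic_continuation f S V m A" "B \<subseteq> A"
  shows "meromorphic_continuation f S V m B"
proof -
  obtain V0 g where g: "open V0" "S \<subseteq> V0" "V0 \<subseteq> V" "g nicely_meromorphic_on (A \<union> V0)"
    "\<forall>\<zeta>\<in>V0. g \<zeta> = f \<zeta>" "at_most_poles g A m"
    using assms(1) unfolding meromorphic_continuation_def by blast
  have fin: "finite {\<zeta> \<in> A. is_pole g \<zeta>}" using g(6) unfolding at_most_poles_def by blast
  have sub: "{\<zeta> \<in> B. is_pole g \<zeta>} \<subseteq> {\<zeta> \<in> A. is_pole g \<zeta>}" using assms(2) by blast
  have "(\<Sum>\<zeta> | \<zeta> \<in> B \<and> is_pole g \<zeta>. nat (- zorder g \<zeta>)) \<le> (\<Sum>\<zeta> | \<zeta> \<in> A \<and> is_pole g \<zeta>. nat (- zorder g \<zeta>))"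
    by (rule sum_mono2[OF fin sub]) simp
  then have "at_most_poles g B m"
    using g(6) finite_subset[OF sub fin] unfolding at_most_poles_def by simp
  moreover have "g nicely_meromorphic_on (B \<union> V0)"
    by (rule nicely_meromorphic_on_subset[OF g(4)]) (use assms(2) in blast)
  ultimately show ?thesis unfolding meromorphic_continuation_def using g by blast
qed

text \<open>
  The identity theorem for meromorphic functions; at every point such a function vanishes identically
  nearby or has no zeros in a punctured neighbourhood.
\<close>

lemma meromorphic_eventually_zero_propagates:
  assumes F: "F meromorphic_on C" and C: "open C" "connected C" "a \<in> C" "b \<in> C"
    and a: "\<forall>\<^sub>F x in at a. F x = 0"
  shows "\<forall>\<^sub>F x in at b. F x = (0 :: complex)"
proof (rule connected_induction_simple[OF C(2-4), where P = "\<lambda>a. \<forall>\<^sub>F x in at a. F x = 0"])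
  show "\<forall>\<^sub>F x in at a. F x = 0" by (rule a)
  fix c assume c: "c \<in> C"
  have sing: "isolated_singularity_at F c" "not_essential F c"
    using F c unfolding meromorphic_on_altdef by auto
  have "\<exists>T. openin (top_of_set C) T \<and> c \<in> T \<and> (\<forall>x\<in>T. \<forall>y\<in>T. (\<forall>\<^sub>F x in at x. F x = 0) \<longrightarrow> (\<forall>\<^sub>F x in at y. F x = 0))"
  proof (cases "\<exists>\<^sub>F x in at c. F x = 0")
    case True
    then have "\<forall>\<^sub>F x in at c. F x = 0" by (rule not_essential_frequently_0_imp_eventually_0[OF sing])
    then obtain T where T: "open T" "c \<in> T" "\<And>x. x \<in> T \<Longrightarrow> x \<noteq> c \<Longrightarrow> F x = 0"
      unfolding eventually_at_topological by blast
    have ev: "\<forall>\<^sub>F x in at y. F x = 0" if "y \<in> T" for y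
    proof (cases "y = c")
      case True
      then show ?thesis using \<open>\<forall>\<^sub>F x in at c. F x = 0\<close> by simp
    next
      case False
      have "\<forall>\<^sub>F x in at y. x \<in> T - {c}"
        using T(1) that False by (intro eventually_at_in_open') (auto intro: open_delete)
      then show ?thesis by eventually_elim (use T(3) in blast)
    qed
    show ?thesis
    proof (intro exI[of _ "T \<inter> C"] conjI ballI impI)
      show "openin (top_of_set C) (T \<inter> C)" using T(1) by (metis Int_commute openin_open_Int)
      show "\<forall>\<^sub>F x in at y. F x = 0" if "y \<in> T \<inter> C" for y using ev that by blast
    qed (use T c in auto)
  next
    case False
    then have "\<forall>\<^sub>F x in at c. F x \<noteq> 0" by (simp add: not_frequently)
    then obtain T where T: "open T" "c \<in> T" "\<And>x. x \<in> T \<Longrightarrow> x \<noteq> c \<Longrightarrow> F x \<noteq> 0"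
      unfolding eventually_at_topological by blast
    have no: "\<not> (\<forall>\<^sub>F x in at y. F x = 0)" if "y \<in> T" for y
    proof
      assume "\<forall>\<^sub>F x in at y. F x = 0"
      moreover have "\<forall>\<^sub>F x in at y. x \<noteq> c" 
      proof (cases "y = c")
        case True
        then show ?thesis by (simp add: eventually_at_filter)
      next
        case False
        have "\<forall>\<^sub>F x in at y. x \<in> - {c}" using False by (intro eventually_at_in_open') auto
        then show ?thesis by simp
      qed
      moreover have "\<forall>\<^sub>F x in at y. x \<in> T" by (rule eventually_at_in_open'[OF T(1) that])
      ultimately have "\<forall>\<^sub>F x in at y. False" by eventually_elim (use T(3) in blast)
      then show False by simp
    qed
    show ?thesis
    proof (intro exI[of _ "T \<inter> C"] conjI ballI impI)
      show "openin (top_of_set C) (T \<inter> C)" using T(1) by (metis Int_commute openin_open_Int)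
      show "\<forall>\<^sub>F x in at y. F x = 0" if "x \<in> T \<inter> C" "\<forall>\<^sub>F x in at x. F x = 0" for x y using no that by blast
    qed (use T c in auto)
  qed
  then show "\<exists>T. openin (top_of_set C) T \<and> c \<in> T \<and> (\<forall>x\<in>T. \<forall>y\<in>T. (\<forall>\<^sub>F x in at x. F x = 0) \<longrightarrow> (\<forall>\<^sub>F x in at y. F x = 0))" .
qed

section \<open>Continuation across the radius of meromorphy\<close>

context pade_row
begin

text \<open>
  The limit \<open>g / Q'\<close> may fail to continue \<open>f\<close> to \<open>E(R)\<close> itself, for want of agreement near \<open>S\<close>. The
  continuation up to the radius of meromorphy, assumed in \<open>cont\<close>, confines the disagreement set to
  points with \<open>U \<ge> i\<close>, and then a slightly larger level set is safe. Here \<open>i\<close> is the radius of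
  meromorphy, or \<open>r_zero S \<mu>\<close> if that is larger.
\<close>

lemma continuation_beyond_meromorphy_radius:
  fixes R :: ereal
  assumes conn: "connected (- S)"
    and cont: "meromorphic_continuation f S V m (meromorphy_set f S V \<mu> m)"
    and decay: "\<And>r. 0 < r \<Longrightarrow> ereal r < R \<Longrightarrow> \<exists>C. \<forall>\<^sub>F n in sequentially. cmod (A n) \<le> C / r ^ n"
    and r0: "ereal (r_zero S \<mu>) < R" and less: "meromorphy_radius f S V \<mu> m < R"
  obtains r where "r_zero S \<mu> < r" "meromorphy_radius f S V \<mu> m < ereal r"
    "meromorphic_continuation f S V m (level_set \<mu> (ereal r))"
proof -
  define Rm where "Rm = meromorphy_radius f S V \<mu> m"
  obtain \<sigma> g Q' where lim: "filterlim \<sigma> at_top sequentially" "\<And>n. m \<le> \<sigma> n"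
    "g holomorphic_on level_set \<mu> R" "degree Q' \<le> m" "Q' \<noteq> 0"
    "\<And>x. x \<in> level_set \<mu> R \<Longrightarrow> (\<lambda>n. poly (P (\<sigma> n)) x) \<longlonglongrightarrow> g x"
    "\<And>x. (\<lambda>n. poly (Q (\<sigma> n)) x) \<longlonglongrightarrow> poly Q' x"
    by (rule limit_function_exists[OF decay]) (assumption | (rule that; assumption))+
  obtain V0 ft where V0: "open V0" "S \<subseteq> V0" "V0 \<subseteq> V" "ft nicely_meromorphic_on (level_set \<mu> Rm \<union> V0)"
    "\<And>\<zeta>. \<zeta> \<in> V0 \<Longrightarrow> ft \<zeta> = f \<zeta>"
    using cont unfolding meromorphic_continuation_def meromorphy_set_def Rm_def by blast
  define E where "E = level_set \<mu> R"
  have oE: "open E" unfolding E_def by (rule open_level_set_ereal)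
  define W where "W = V0 \<inter> E"
  have oW: "open W" unfolding W_def using V0(1) oE by (rule open_Int)
  have f_V0: "f analytic_on V0" by (rule analytic_on_subset[OF f_analytic V0(3)])
  define D where "D x = poly Q' x * f x - g x" for x
  have D_hol: "D holomorphic_on W"
    unfolding D_def
  proof (intro holomorphic_intros)
    show "f holomorphic_on W"
      by (rule holomorphic_on_subset[OF analytic_imp_holomorphic[OF f_V0]]) (simp add: W_def)
    show "g holomorphic_on W"
      by (rule holomorphic_on_subset[OF lim(3)]) (simp add: W_def E_def)
  qed
  have D_zero: "\<exists>e>0. ball s e \<subseteq> E \<and> (\<forall>x\<in>ball s e. D x = 0)" if s: "s \<in> support" "s \<in> E" for s
  proof -
    have s': "s \<in> level_set \<mu> R" using s(2) unfolding E_def .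
    obtain e where e: "0 < e" "ball s e \<subseteq> V \<inter> level_set \<mu> R"
      "\<And>x. x \<in> ball s e \<Longrightarrow> poly Q' x * f x = g x"
      by (rule limit_interpolates_at_support[OF decay lim(1,2,6,7) s(1) s']) (assumption | (rule that; assumption))+
    then show ?thesis unfolding D_def E_def by (intro exI[of _ e]) auto
  qed
  define B where "B = {x\<in>W. \<not> (\<forall>\<^sub>F y in nhds x. D y = 0)}"
  have BW: "B \<subseteq> W" unfolding B_def by blast
  have oB: "open B"
    unfolding open_contains_ball
  proof
    fix x assume x: "x \<in> B"
    then obtain e where e: "0 < e" "ball x e \<subseteq> W" using oW BW open_contains_ball by blast
    have "y \<in> B" if y: "y \<in> ball x e" for y
    proof (rule ccontr)
      assume "y \<notin> B"
      then have "\<forall>\<^sub>F u in nhds y. D u = 0" using y e(2) unfolding B_def by blast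
      then obtain T where T: "open T" "y \<in> T" "\<And>u. u \<in> T \<Longrightarrow> D u = 0" unfolding eventually_nhds by blast
      have oT: "open (T \<inter> ball x e)" using T(1) by (intro open_Int) auto
      have "D u = 0" if u: "u \<in> ball x e" for u
      proof (rule analytic_continuation[OF _ open_ball connected_ball _ _ _ _ u])
        show "D holomorphic_on ball x e" by (rule holomorphic_on_subset[OF D_hol e(2)])
        show "T \<inter> ball x e \<subseteq> ball x e" by blast
        show "y \<in> ball x e" by (rule y)
        show "y islimpt T \<inter> ball x e"
        proof (rule interior_limit_point)
          show "y \<in> interior (T \<inter> ball x e)" unfolding interior_open[OF oT] using T(2) y by blast
        qed
        show "D u = 0" if "u \<in> T \<inter> ball x e" for u using T(3) that by blast
      qed
      then have "\<forall>\<^sub>F u in nhds x. D u = 0"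
        unfolding eventually_nhds using e(1) by (intro exI[of _ "ball x e"]) auto
      then show False using x unfolding B_def by blast
    qed
    then show "\<exists>e>0. ball x e \<subseteq> B" using e(1) by blast
  qed
  have Bsupp: "B \<inter> support = {}"
  proof -
    have "s \<notin> B" if s: "s \<in> support" for s
    proof
      assume sB: "s \<in> B"
      then have "s \<in> E" using BW unfolding W_def by blast
      then obtain e where "0 < e" "\<forall>x\<in>ball s e. D x = 0" using D_zero[OF s] by blast
      then have "\<forall>\<^sub>F u in nhds s. D u = 0"
        unfolding eventually_nhds by (intro exI[of _ "ball s e"]) auto
      then show False using sB unfolding B_def by blast
    qed
    then show ?thesis by blast
  qed
  \<comment> \<open>Points of \<open>V0\<close> with smaller values belong to \<open>W\<close>, in which \<open>B\<close> is also closed.\<close>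
  have front: "R \<le> ereal (U y)" if y: "y \<in> frontier B" "y \<in> V0" for y
  proof (rule ccontr)
    assume "\<not> ?thesis"
    then have "y \<in> W" using y(2) unfolding W_def E_def level_set_def by simp
    moreover have yB: "y \<in> closure B" "y \<notin> B" using y(1) oB by (auto simp: frontier_def interior_open)
    ultimately have "\<forall>\<^sub>F u in nhds y. D u = 0" unfolding B_def by blast
    then obtain T where T: "open T" "y \<in> T" "\<And>u. u \<in> T \<Longrightarrow> D u = 0" unfolding eventually_nhds by blast
    then obtain b where b: "b \<in> B" "b \<in> T" using yB(1) by (meson closure_iff_nhds_not_empty disjoint_iff order_refl)
    have "\<forall>\<^sub>F u in nhds b. D u = 0" unfolding eventually_nhds using T b(2) by blast
    then show False using b(1) unfolding B_def by blast
  qed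
  define i where "i = (if Rm \<le> ereal (r_zero S \<mu>) then r_zero S \<mu> else real_of_ereal Rm)"
  have i: "Rm \<le> ereal i" "r_zero S \<mu> \<le> i" "ereal i < R" "i \<noteq> r_zero S \<mu> \<Longrightarrow> Rm = ereal i"
  proof -
    have "Rm \<le> ereal i \<and> r_zero S \<mu> \<le> i \<and> ereal i < R \<and> (i \<noteq> r_zero S \<mu> \<longrightarrow> Rm = ereal i)"
    proof (cases "Rm \<le> ereal (r_zero S \<mu>)")
      case True
      then show ?thesis using r0 unfolding i_def by simp
    next
      case False
      have "Rm < R" using less unfolding Rm_def .
      then have "Rm \<noteq> \<infinity>" by auto
      moreover have "Rm \<noteq> - \<infinity>" using False by auto
      ultimately have "Rm = ereal (real_of_ereal Rm)" by (cases Rm) auto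
      then have "Rm = ereal i" using False unfolding i_def by simp
      then show ?thesis using False \<open>Rm < R\<close> by auto
    qed
    then show "Rm \<le> ereal i" "r_zero S \<mu> \<le> i" "ereal i < R" "i \<noteq> r_zero S \<mu> \<Longrightarrow> Rm = ereal i" by auto
  qed
  have low: "i \<le> U x" if x: "x \<in> B" for x
  proof (rule ccontr)
    assume "\<not> i \<le> U x"
    then have Ux: "U x < i" by simp
    then have "i \<noteq> r_zero S \<mu>" using r_zero_le_exp_neg_potential[of x] by auto
    then have Rmi: "Rm = ereal i" by (rule i(4))
    \<comment> \<open>This component of \<open>E(Rm)\<close> contains a point \<open>s\<close> of the support, where \<open>g / Q'\<close> agrees with \<open>f\<close>
      and thus with the given continuation \<open>ft\<close>; the agreement spreads to \<open>x\<close>.\<close>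
    define C where "C = connected_component_set {x. U x < i} x"
    have lsRm: "level_set \<mu> Rm = {x. U x < i}" unfolding level_set_def Rmi by simp
    have oC: "open C" unfolding C_def by (rule open_connected_component[OF open_level_set])
    have Csub: "C \<subseteq> {x. U x < i}" unfolding C_def by (rule connected_component_subset)
    have xC: "x \<in> C" unfolding C_def using Ux by simp
    have "C \<inter> support \<noteq> {}"
    proof (rule low_open_set_meets_carrier[OF closed_support AE_in_support oC])
      show "C \<noteq> {}" using xC by blast
      show "U y < i" if "y \<in> C" for y using Csub that by blast
      fix y assume "y \<in> frontier C"
      then have "y \<in> frontier {x. U x < i}"
        unfolding C_def using frontier_of_connected_component_subset by blast
      then show "i \<le> U y" using open_level_set[of i] by (simp add: frontier_def interior_open)
    qed
    then obtain s where s: "s \<in> C" "s \<in> support" by blast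
    have CE: "C \<subseteq> E"
    proof
      fix y assume "y \<in> C"
      then have "ereal (U y) < ereal i" using Csub by auto
      from this i(3) have "ereal (U y) < R" by (rule less_trans)
      then show "y \<in> E" unfolding E_def level_set_def by simp
    qed
    define F where "F y = poly Q' y * ft y - g y" for y
    have mero: "F meromorphic_on C"
      unfolding F_def
    proof (intro meromorphic_on_diff meromorphic_on_mult)
      show "poly Q' meromorphic_on C"
        by (intro analytic_on_imp_meromorphic_on) (metis analytic_on_analytic_at poly_analytic_at)
      have "ft meromorphic_on (level_set \<mu> Rm \<union> V0)" using V0(4) unfolding nicely_meromorphic_on_def by blast
      then show "ft meromorphic_on C" by (rule meromorphic_on_subset) (use Csub lsRm in blast)
      have "g holomorphic_on C" by (rule holomorphic_on_subset[OF lim(3)]) (use CE in \<open>simp add: E_def\<close>)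
      then show "g meromorphic_on C"
        using oC by (intro analytic_on_imp_meromorphic_on) (simp add: analytic_on_open)
    qed
    have FD: "F y = D y" if "y \<in> V0" for y unfolding F_def D_def V0(5)[OF that] ..
    obtain e where e: "0 < e" "\<forall>x\<in>ball s e. D x = 0" using D_zero[OF s(2)] CE s(1) by blast
    have "s \<in> V0" using s(2) support_subset V0(2) by blast
    then have "\<forall>\<^sub>F y in at s. y \<in> V0 \<inter> ball s e"
      using V0(1) e(1) by (intro eventually_at_in_open') auto
    then have "\<forall>\<^sub>F y in at s. F y = 0" by eventually_elim (use FD e(2) in auto)
    from meromorphic_eventually_zero_propagates[OF mero oC _ s(1) xC this]
    have Fx: "\<forall>\<^sub>F y in at x. F y = 0" unfolding C_def by simp
    have xW: "x \<in> W" using x BW by blast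
    then have "\<forall>\<^sub>F y in at x. y \<in> W" by (rule eventually_at_in_open'[OF oW])
    with Fx have Dx: "\<forall>\<^sub>F y in at x. D y = 0" by eventually_elim (use FD in \<open>auto simp: W_def\<close>)
    have "isCont D x" using D_hol oW xW by (metis continuous_on_eq_continuous_at holomorphic_on_imp_continuous_on)
    then have "(D \<longlongrightarrow> D x) (at x)" by (simp add: isCont_def)
    moreover have "(D \<longlongrightarrow> 0) (at x)" using tendsto_cong[OF Dx, of 0] by simp
    ultimately have "D x = 0" by (rule tendsto_unique[rotated]) simp
    with Dx have "\<forall>\<^sub>F y in nhds x. D y = 0" by (simp add: eventually_nhds_conv_at)
    then show False using x unfolding B_def by blast
  qed
  obtain c where c: "ereal i < ereal c" "ereal c < R" using ereal_dense2[OF i(3)] by blast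
  have frontc: "c \<le> U y" if "y \<in> frontier B" "y \<in> V0" for y
  proof -
    have "ereal c < ereal (U y)" using c(2) front[OF that] by (rule less_le_trans)
    then show ?thesis by simp
  qed
  have BV0: "B \<subseteq> V0" using BW unfolding W_def by blast
  have ic: "i < c" using c(1) by simp
  obtain r where r: "i < r" "r < c" "closure (B \<inter> {x. U x < r}) \<inter> S = {}"
    by (rule low_values_avoid_S[OF conn V0(1,2) closed_support AE_in_support oB BV0 Bsupp low frontc ic]) (assumption | (rule that; assumption))+
  \<comment> \<open>Shrinking the neighbourhood of \<open>S\<close> removes all disagreement with \<open>g / Q'\<close> on \<open>E(r)\<close>.\<close>
  define V1 where "V1 = V0 - closure (B \<inter> {x. U x < r})"
  have rE: "level_set \<mu> (ereal r) \<subseteq> E"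
  proof
    fix y assume "y \<in> level_set \<mu> (ereal r)"
    then have "U y < r" unfolding level_set_def by simp
    then have "ereal (U y) < ereal c" using r(2) by simp
    from this c(2) have "ereal (U y) < R" by (rule less_trans)
    then show "y \<in> E" unfolding E_def level_set_def by simp
  qed
  have "meromorphic_continuation f S V m (level_set \<mu> (ereal r))"
  proof (rule continuation_from_quotient[OF open_level_set_ereal _ lim(5,4)])
    show "g holomorphic_on level_set \<mu> (ereal r)"
      by (rule holomorphic_on_subset[OF lim(3)]) (use rE in \<open>simp add: E_def\<close>)
    show "open V1" unfolding V1_def using V0(1) by (intro open_Diff) auto
    show "S \<subseteq> V1" unfolding V1_def using V0(2) r(3) by blast
    show "V1 \<subseteq> V" unfolding V1_def using V0(3) by blast
    show "f analytic_on V1" by (rule analytic_on_subset[OF f_V0]) (simp add: V1_def)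
    fix x assume x: "x \<in> V1" "x \<in> level_set \<mu> (ereal r)"
    then have "x \<in> W" using rE unfolding V1_def W_def by blast
    moreover have "x \<notin> B"
    proof
      assume "x \<in> B"
      then have "x \<in> B \<inter> {x. U x < r}" using x(2) unfolding level_set_def by simp
      then have "x \<in> closure (B \<inter> {x. U x < r})" by (rule subsetD[OF closure_subset])
      then show False using x(1) unfolding V1_def by simp
    qed
    ultimately have "\<forall>\<^sub>F y in nhds x. D y = 0" unfolding B_def by blast
    then have "D x = 0" by (rule eventually_nhds_x_imp_x)
    then show "poly Q' x * f x = g x" unfolding D_def by simp
  qed
  moreover have "Rm < ereal r"
  proof -
    have "ereal i < ereal r" using r(1) by simp
    with i(1) show ?thesis by (rule le_less_trans)
  qed
  moreover have "r_zero S \<mu> < r" using i(2) r(1) by simp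
  ultimately show ?thesis unfolding Rm_def by (intro that)
qed

end

theorem proposition4p2:
  fixes S V :: "complex set"
    and f :: "complex \<Rightarrow> complex"
    and m :: nat
    and w p q :: "nat \<Rightarrow> complex poly"
    and \<mu> :: "complex measure"
    and z :: complex
    and R :: ereal
  assumes "compact S" and "connected (- S)"
    and "open V" and "S \<subseteq> V" and "f analytic_on V"
    and "\<And>n. lead_coeff (w n) = 1" and "\<And>n. degree (w n) = n"
    and "\<And>n. {\<xi>. poly (w n) \<xi> = 0} \<subseteq> S"
    and "prob_space \<mu>" and "sets \<mu> = sets borel" and "emeasure \<mu> (- S) = 0"
    and "asymptotic_zero_distribution S w \<mu>"
    and "newtonian_table w"
    and "meromorphic_continuation f S V m (meromorphy_set f S V \<mu> m)"
    and "\<And>n. n \<ge> m \<Longrightarrow> multipoint_pade f V w n m (p n) (q n)"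
    and "z \<notin> S"
    and "R > 0"
    and "limsup (\<lambda>n. nth_root_error n (f z) (p n) (q n) z) \<le> ereal (rho \<mu> {z}) / R"
    and "ereal (rho \<mu> {z}) / R < 1"
  shows "R \<le> meromorphy_radius f S V \<mu> m \<and>
         meromorphic_continuation f S V m (level_set \<mu> R)"
proof -
  have scheme: "interpolation_scheme \<mu> S w"
    unfolding interpolation_scheme_def compactly_supported_prob_def compactly_supported_prob_axioms_def
      interpolation_scheme_axioms_def
    using assms(1,6-12) by blast
  have "\<exists>P Q. multipoint_pade_pair f V w n m P Q \<and> coeff_norm Q = 1 \<and> P * q n = p n * Q" if n: "m \<le> n" for n
  proof -
    obtain P Q where PQ: "multipoint_pade_pair f V w n m P Q" "P * q n = p n * Q"
      using assms(15)[OF n] unfolding multipoint_pade_def by blast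
    have Q0: "Q \<noteq> 0" using PQ(1) unfolding multipoint_pade_pair_def by blast
    define c where "c = complex_of_real (1 / coeff_norm Q)"
    have c: "c \<noteq> 0" "cmod c * coeff_norm Q = 1"
      unfolding c_def using coeff_norm_pos[OF Q0] by (auto simp: norm_divide)
    obtain h where h: "h analytic_on V"
      "\<forall>\<zeta>\<in>V. poly Q \<zeta> * f \<zeta> - poly P \<zeta> = h \<zeta> * poly (w (Suc n)) \<zeta>"
      using PQ(1) unfolding multipoint_pade_pair_def by blast
    have "multipoint_pade_pair f V w n m (smult c P) (smult c Q)"
      unfolding multipoint_pade_pair_def
    proof (intro conjI exI[of _ "\<lambda>\<zeta>. c * h \<zeta>"])
      show "degree (smult c P) \<le> n - m" "degree (smult c Q) \<le> m" "smult c Q \<noteq> 0"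
        using PQ(1) c(1) unfolding multipoint_pade_pair_def by auto
      show "(\<lambda>\<zeta>. c * h \<zeta>) analytic_on V" using h(1) by (intro analytic_intros)
      show "\<forall>\<zeta>\<in>V. poly (smult c Q) \<zeta> * f \<zeta> - poly (smult c P) \<zeta> = c * h \<zeta> * poly (w (Suc n)) \<zeta>"
      proof
        fix \<zeta> assume "\<zeta> \<in> V"
        have "poly (smult c Q) \<zeta> * f \<zeta> - poly (smult c P) \<zeta> = c * (poly Q \<zeta> * f \<zeta> - poly P \<zeta>)"
          by (simp add: algebra_simps)
        also have "\<dots> = c * (h \<zeta> * poly (w (Suc n)) \<zeta>)" using h(2) \<open>\<zeta> \<in> V\<close> by simp
        finally show "poly (smult c Q) \<zeta> * f \<zeta> - poly (smult c P) \<zeta> = c * h \<zeta> * poly (w (Suc n)) \<zeta>" by simp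
      qed
    qed
    moreover have "coeff_norm (smult c Q) = 1" using c(2) by (simp add: coeff_norm_smult)
    moreover have "smult c P * q n = p n * smult c Q" using PQ(2) by simp
    ultimately show ?thesis by blast
  qed
  then obtain P Q where PQ: "\<And>n. m \<le> n \<Longrightarrow> multipoint_pade_pair f V w n m (P n) (Q n)"
    "\<And>n. m \<le> n \<Longrightarrow> coeff_norm (Q n) = 1" "\<And>n. m \<le> n \<Longrightarrow> P n * q n = p n * Q n"
    by metis
  interpret pade_row \<mu> S w f V m P Q
    by (rule pade_row.intro[OF scheme], unfold_locales) (use assms(3-5,13) PQ in auto)
  have rho: "rho \<mu> {z} = U z" unfolding rho_def by simp
  have decay: "\<exists>C. \<forall>\<^sub>F n in sequentially. cmod (A n) \<le> C / r ^ n" if "0 < r" "ereal r < R" for r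
    by (rule coefficient_decay[OF PQ(3) assms(16,17) assms(18)[unfolded rho] that])
  have "ereal (U z) < R"
    using assms(19) assms(17) unfolding rho by (cases R) (auto simp: divide_less_eq)
  then have r0: "ereal (r_zero S \<mu>) < R"
    using r_zero_le_exp_neg_potential[of z] by (meson ereal_less_eq(3) le_less_trans)
  have radius: "R \<le> meromorphy_radius f S V \<mu> m"
  proof (rule ccontr)
    assume "\<not> ?thesis"
    then have less: "meromorphy_radius f S V \<mu> m < R" by simp
    obtain r where r: "r_zero S \<mu> < r" "meromorphy_radius f S V \<mu> m < ereal r"
      "meromorphic_continuation f S V m (level_set \<mu> (ereal r))"
      by (rule continuation_beyond_meromorphy_radius[OF assms(2,14) decay r0 less]) (assumption | (rule that; assumption))+
    have "ereal r \<le> meromorphy_radius f S V \<mu> m"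
      unfolding meromorphy_radius_def by (rule Sup_upper) (use r(1,3) in blast)
    then show False using r(2) by simp
  qed
  have "level_set \<mu> R \<subseteq> meromorphy_set f S V \<mu> m"
    unfolding meromorphy_set_def level_set_def using radius by (auto intro: less_le_trans)
  then have "meromorphic_continuation f S V m (level_set \<mu> R)"
    by (rule meromorphic_continuation_subset[OF assms(14)])
  then show ?thesis using radius by blast
qed

end
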